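(* Under the setup in the context (fixed, undirected, connected graph), assume additionally that all roots of $s^{n-1}+b_{n-1}s^{n-2}+\dots+b_2s+b_1=0$ lie strictly inside the unit circle. Then: (i) if $\beta>\frac{1}{2f_M}\big(\frac{\gamma\lambda_G^2}{\lambda_2^3}+\gamma\alpha\big)$, then $\lim_{t\to\infty}E\big[\|x_i(t)-\bar x(t)\|^2\big]=0$ for every $i=1,\dots,N$; (ii) if $\gamma>\frac1{\lambda_2}$ and $\beta>\frac{1}{2f_M}\big(\frac{\gamma^2\lambda_G^2}{\lambda_2^2(\gamma\lambda_2-1)}+\gamma\alpha+1\big)$, then $E\big[\|x_i(t)-\bar x(t)\|^2\big]=O(1/t)$ for every $i=1,\dots,N$.
   Context: Fix integers $n\ge 2$ and $N\ge 2$. Let $a_1,\dots,a_n\in\mathbb{R}$, let $A\in\mathbb{R}^{n\times n}$ be the matrix with $A_{k,k+1}=1$ for $k=1,\dots,n-1$, last row $(a_1,a_2,\dots,a_n)$, and all other entries $0$, and let $B=(0,\dots,0,1)^T\in\mathbb{R}^n$. There are $N$ agents with dynamics $x_i(t+1)=Ax_i(t)+Bu_i(t)$, $i=1,\dots,N$, where $x_i(t)=(x_{i1}(t),\dots,x_{in}(t))^T\in\mathbb{R}^n$ and $u_i(t)\in\mathbb{R}$; write $\bar x(t)=\frac1N\sum_{i=1}^N x_i(t)$. $\|\cdot\|$ is the Euclidean norm for vectors and spectral norm for matrices. Communication graph: $G$ is a fixed, undirected, connected graph on $\{1,\dots,N\}$; $N_i$ is the neighbor set of agent $i$, $d_i=|N_i|$,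 $d_{\max}=\max_i d_i$, and $L$ is the Laplacian of $G$ (degree matrix minus adjacency matrix), with eigenvalues $0=\lambda_1<\lambda_2\le\dots\le\lambda_N$. Gains: real numbers $b_1,\dots,b_{n-1}$ (compression coefficients), $K_2=[b_1,\dots,b_{n-1},1]\in\mathbb R^{1\times n}$, and $K_1=[-a_1+b_1,\,-a_2+b_2-b_1,\,\dots,\,-a_{n-1}+b_{n-1}-b_{n-2},\,-a_n-b_{n-1}+1]\in\mathbb R^{1\times n}$. Communication: for every ordered pair $(i,j)$ with $j\in N_i$ and every integer $t$, agent $i$ receives the bit $s_{ij}(t)=1$ if $K_2x_j(t)+d_{ij}(t)\le c_{ij}$ and $s_{ij}(t)=0$ otherwise, where $c_{ij}\in\mathbb R$ are fixed thresholds and the noises $\{d_{ij}(t)\}$ are i.i.d. $N(0,\sigma^2)$, $\sigma>0$, over all $i,j,t$; $F$ and $f$ denote the distribution function and density of $N(0,\sigma^2)$. Algorithm: fix $\beta>0$, $\gamma>0$, an integer $t_0>\gamma d_{\max}-1$, deterministic initial states $x_i(t_0+1)=x_i^0$ and deterministic initial estimates $\hat z_{ij}(t_0)=\hat z_{ij}^0$, and $M>0$ with $|K_2x_i^0|\le M$ and $|\hat z^0_{ij}|\le M$ for all $i$ and $j\in N_i$. Let $\Pi_M(\zeta)=\max\{-M,\min\{M,\zeta\}\}$ (projection onto $[-M,M]$). For $t\ge t_0+1$, for all $i$ and $j\in N_i$: $\hat z_{ij}(t)=\Pi_M\big(\hat z_{ij}(t-1)+\tfrac{\beta}{t}(F(c_{ij}-\hat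 z_{ij}(t-1))-s_{ij}(t))\big)$, and $u_i(t)=K_1x_i(t)+\frac{\gamma}{t+1}\sum_{j\in N_i}(\hat z_{ij}(t)-K_2x_i(t))$. Constants: enumerate the $d=\sum_i d_i$ ordered pairs $(i,j)$ with $j\in N_i$ as $p=1,\dots,d$. Let $W\in\mathbb R^{N\times d}$ with $W_{k,p}=1$ if pair $p$ has first component $k$ and $0$ otherwise; $Q\in\mathbb R^{d\times N}$ with $Q_{p,k}=1$ if pair $p$ has second component $k$ and $0$ otherwise; $J_N=I_N-\frac1N\mathbf 1_N\mathbf 1_N^T$. Set $\lambda_G=\|J_NW\|^2$, $\lambda_{QW}=\|QW\|^2$, $\lambda_{QL}=\|QL\|^2$, $\alpha=2\sqrt{\lambda_{QW}}+\lambda_{QL}\lambda_2/\lambda_G$, and $f_M=\min_{(i,j):\,j\in N_i} f(|c_{ij}|+M)$. $O(1/t)$ means bounded by $C/t$ for a constant $C$ and all $t\ge t_0+1$. *)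

theory Defs
  imports "HOL-Probability.Probability" "Jordan_Normal_Form.Char_Poly"
begin

section \<open>Linear algebra helpers (0-based indices; paper indices are 1-based)\<close>

definition enorm :: "real vec \<Rightarrow> real" where
  "enorm v = sqrt (v \<bullet> v)"

definition spec_norm :: "real mat \<Rightarrow> real" where
  "spec_norm A = Sup {enorm (A *\<^sub>v v) | v. v \<in> carrier_vec (dim_col A) \<and> enorm v \<le> 1}"

text \<open>Eigenvalues of a real matrix whose characteristic polynomial splits over the reals,
  listed in increasing order with multiplicity.\<close>
definition sorted_eigs :: "real mat \<Rightarrow> real list" where
  "sorted_eigs L = (THE ls. sorted ls \<and> char_poly L = prod_list (map (\<lambda>a. [:-a, 1:]) ls))"

definition graph_ok :: "nat \<Rightarrow> (nat \<Rightarrow> nat \<Rightarrow> bool) \<Rightarrow> bool" where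
  "graph_ok N E \<longleftrightarrow> (\<forall>i j. E i j \<longrightarrow> i < N \<and> j < N) \<and> (\<forall>i j. E i j \<longrightarrow> E j i) \<and> (\<forall>i. \<not> E i i)"

definition connected_graph :: "nat \<Rightarrow> (nat \<Rightarrow> nat \<Rightarrow> bool) \<Rightarrow> bool" where
  "connected_graph N E \<longleftrightarrow> (\<forall>i<N. \<forall>j<N. E\<^sup>*\<^sup>* i j)"

definition deg :: "nat \<Rightarrow> (nat \<Rightarrow> nat \<Rightarrow> bool) \<Rightarrow> nat \<Rightarrow> nat" where
  "deg N E i = card {j. j < N \<and> E i j}"

definition dmax :: "nat \<Rightarrow> (nat \<Rightarrow> nat \<Rightarrow> bool) \<Rightarrow> nat" where
  "dmax N E = Max (deg N E ` {..<N})"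

definition laplacian :: "nat \<Rightarrow> (nat \<Rightarrow> nat \<Rightarrow> bool) \<Rightarrow> real mat" where
  "laplacian N E = mat N N (\<lambda>(i, j). if i = j then real (deg N E i) else if E i j then -1 else 0)"

definition lambda2 :: "nat \<Rightarrow> (nat \<Rightarrow> nat \<Rightarrow> bool) \<Rightarrow> real" where
  "lambda2 N E = sorted_eigs (laplacian N E) ! 1"

definition pairs :: "nat \<Rightarrow> (nat \<Rightarrow> nat \<Rightarrow> bool) \<Rightarrow> (nat \<times> nat) list" where
  "pairs N E = [(i, j). i \<leftarrow> [0..<N], j \<leftarrow> [0..<N], E i j]"

definition Wmat :: "nat \<Rightarrow> (nat \<Rightarrow> nat \<Rightarrow> bool) \<Rightarrow> real mat" where
  "Wmat N E = mat N (length (pairs N E)) (\<lambda>(k, p). if fst (pairs N E ! p) = k then 1 else 0)"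

definition Qmat :: "nat \<Rightarrow> (nat \<Rightarrow> nat \<Rightarrow> bool) \<Rightarrow> real mat" where
  "Qmat N E = mat (length (pairs N E)) N (\<lambda>(p, k). if snd (pairs N E ! p) = k then 1 else 0)"

definition JNmat :: "nat \<Rightarrow> real mat" where
  "JNmat N = mat N N (\<lambda>(i, j). (if i = j then 1 else 0) - 1 / real N)"

definition lambda_G :: "nat \<Rightarrow> (nat \<Rightarrow> nat \<Rightarrow> bool) \<Rightarrow> real" where
  "lambda_G N E = (spec_norm (JNmat N * Wmat N E))\<^sup>2"

definition lambda_QW :: "nat \<Rightarrow> (nat \<Rightarrow> nat \<Rightarrow> bool) \<Rightarrow> real" where
  "lambda_QW N E = (spec_norm (Qmat N E * Wmat N E))\<^sup>2"

definition lambda_QL :: "nat \<Rightarrow> (nat \<Rightarrow> nat \<Rightarrow> bool) \<Rightarrow> real" where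
  "lambda_QL N E = (spec_norm (Qmat N E * laplacian N E))\<^sup>2"

definition alpha_const :: "nat \<Rightarrow> (nat \<Rightarrow> nat \<Rightarrow> bool) \<Rightarrow> real" where
  "alpha_const N E = 2 * sqrt (lambda_QW N E) + lambda_QL N E * lambda2 N E / lambda_G N E"

definition gauss_cdf :: "real \<Rightarrow> real \<Rightarrow> real" where
  "gauss_cdf \<sigma> x = measure (density lborel (\<lambda>y. ennreal (normal_density 0 \<sigma> y))) {..x}"

definition f_M :: "nat \<Rightarrow> (nat \<Rightarrow> nat \<Rightarrow> bool) \<Rightarrow> real \<Rightarrow> (nat \<Rightarrow> nat \<Rightarrow> real) \<Rightarrow> real \<Rightarrow> real" where
  "f_M N E \<sigma> c M = Min {normal_density 0 \<sigma> (\<bar>c i j\<bar> + M) | i j. i < N \<and> j < N \<and> E i j}"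

definition proj :: "real \<Rightarrow> real \<Rightarrow> real" where
  "proj M z = max (- M) (min M z)"

section \<open>System matrices and gains (a k, b k use the paper's 1-based indices)\<close>

definition Amat :: "nat \<Rightarrow> (nat \<Rightarrow> real) \<Rightarrow> real mat" where
  "Amat n a = mat n n (\<lambda>(k, l). if k = n - 1 then a (l + 1) else if l = k + 1 then 1 else 0)"

definition Bvec :: "nat \<Rightarrow> real vec" where
  "Bvec n = vec n (\<lambda>k. if k = n - 1 then 1 else 0)"

definition K2vec :: "nat \<Rightarrow> (nat \<Rightarrow> real) \<Rightarrow> real vec" where
  "K2vec n b = vec n (\<lambda>k. if k < n - 1 then b (k + 1) else 1)"

definition K1vec :: "nat \<Rightarrow> (nat \<Rightarrow> real) \<Rightarrow> (nat \<Rightarrow> real) \<Rightarrow> real vec" where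
  "K1vec n a b = vec n (\<lambda>k. let m = k + 1 in
     if m = 1 then - a 1 + b 1
     else if m < n then - a m + b m - b (m - 1)
     else - a n - b (n - 1) + 1)"

definition comp_poly :: "nat \<Rightarrow> (nat \<Rightarrow> real) \<Rightarrow> complex poly" where
  "comp_poly n b = monom 1 (n - 1) + (\<Sum>k = 1..n - 1. monom (complex_of_real (b k)) (k - 1))"

definition xbar :: "nat \<Rightarrow> nat \<Rightarrow> (nat \<Rightarrow> real vec) \<Rightarrow> real vec" where
  "xbar n N x = vec n (\<lambda>k. (\<Sum>i<N. x i $ k) / real N)"

end

theory Submission
  imports Defs
begin

text \<open>
  The compressed states \<open>z\<^sub>i = K\<^sub>2 x\<^sub>i\<close> obey the scalar consensus recursion
  \<open>z\<^sub>i(t+1) = z\<^sub>i(t) + \<gamma>/(t+1) \<Sum>\<^sub>j (w\<^sub>i\<^sub>j(t) - z\<^sub>i(t))\<close>, where \<open>w\<^sub>i\<^sub>j\<close> is the estimate of \<open>z\<^sub>j\<close>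
  held by agent \<open>i\<close>, and stay in \<open>[-M, M]\<close>.  Let \<open>V\<close> and \<open>R\<close> be the mean squares of the
  disagreement \<open>z - avg z\<close> and of the estimation error.  With \<open>h = 1/(t+1)\<close>, \<open>p = \<gamma> \<lambda>\<^sub>2\<close>,
  \<open>q = \<gamma> \<lambda>\<^sub>G / \<lambda>\<^sub>2\<close> and \<open>m = 2 \<beta> f\<^sub>M - \<gamma> \<alpha>\<close>, the Poincare inequality for the Laplacian, strong
  monotonicity of \<open>F\<close> on the relevant interval and independence of the fresh noise from the past
  give \<open>V' \<le> V + h (q R - p V) + O(h\<^sup>2)\<close> and \<open>R' \<le> R + h (q V - m R) + O(h\<^sup>2)\<close>.
  The hypotheses on \<open>\<beta>\<close> say exactly that \<open>p m > q\<^sup>2\<close>, respectively \<open>(p - 1) (m - 1) > q\<^sup>2\<close> with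
  \<open>p > 1\<close>, so that some combination \<open>V + \<kappa> R\<close> contracts by the factor \<open>1 - \<eta> h\<close> with \<open>\<eta> > 0\<close>,
  respectively \<open>\<eta> > 1\<close>.  Finally the state components are recovered from \<open>z\<close> by the linear
  recursion with the compression polynomial, which is stable because its roots lie inside the
  unit disc, and so inherits the decay of its input.
\<close>

section \<open>Decay of scalar recursions\<close>

text \<open>The cross terms are balanced so that both off-diagonal rates equal q. Poincare gives V
  the rate -2 \<lambda>_2; half of it pays, by a weighted Young inequality, for the cross term with
  R, which leaves \<lambda>_G / \<lambda>_2 at R. The cross term of R is weighted to return the same
  coefficient at V, and its price is the summand \<lambda>_QL \<lambda>_2 / \<lambda>_G of \<alpha>.
  Two obstacles shape the estimates. The distribution function is strongly monotone only on bounded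
  sets, so estimates and compressed states must both stay in [-M, M]: the former by projection, the
  latter because the bound on \<open>t0\<close> makes their update a convex combination. Moreover
  the bit received at t+1 samples z_j(t+1), not z_j(t). The noise is therefore centred at z_j(t+1)
  and multiplied by the estimate at t minus z_j(t+1), both fixed by earlier noises; the motion of
  the target contributes the coupling and terms of second order. The eigenvalue \<lambda>_2 is
  defined through the characteristic polynomial but is used variationally, so the spectral theorem
  has to connect the two. The threshold 1 for the rate is the relative decay, 1/(t+1) per step, of
  K/t itself.\<close>

lemma recursion_rate_inverse:
  fixes u :: "nat \<Rightarrow> real"
  assumes nonneg: "\<And>t. t \<ge> T \<Longrightarrow> 0 \<le> u t" and eta: "\<eta> > 1"
    and step: "\<And>t. t \<ge> T \<Longrightarrow> u (Suc t) \<le> (1 - \<eta> / real (Suc t)) * u t + C / (real (Suc t))\<^sup>2"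
  shows "\<exists>K T. \<forall>t\<ge>T. u t \<le> K / real t"
proof -
  \<comment> \<open>From S on the factor 1 - \<eta>/(t+1) is nonnegative, so the induction bound may
    be inserted into the recursion.\<close>
  define S where "S = max (Suc T) (nat \<lceil>\<eta>\<rceil>)"
  have S: "S \<ge> T" "S > 0" "real S \<ge> \<eta>" unfolding S_def by (auto simp: le_max_iff_disj) linarith
  \<comment> \<open>The first argument starts the induction; the second gives K (\<eta> - 1) >= C,
    which makes K/t a supersolution. Here \<eta> > 1 is essential.\<close>
  define K where "K = max (real S * u S) (\<bar>C\<bar> / (\<eta> - 1))"
  have K0: "K \<ge> 0" unfolding K_def using eta by (simp add: le_max_iff_disj)
  have KC: "K * (\<eta> - 1) \<ge> C"
  proof -
    have "\<bar>C\<bar> / (\<eta> - 1) \<le> K" unfolding K_def by simp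
    then have "\<bar>C\<bar> \<le> K * (\<eta> - 1)" using eta by (simp add: field_simps)
    then show ?thesis by linarith
  qed
  have "u t \<le> K / real t" if "t \<ge> S" for t
    using that
  proof (induction t rule: dec_induct)
    case base
    have "real S * u S \<le> K" unfolding K_def by simp
    then show ?case using S by (simp add: field_simps)
  next
    case (step t)
    have t: "real t > 0" "t \<ge> T" "real t \<ge> \<eta>" using step S by auto
    have "u (Suc t) \<le> (1 - \<eta> / real (Suc t)) * u t + C / (real (Suc t))\<^sup>2"
      using assms(3) t by simp
    also have "\<dots> \<le> (1 - \<eta> / real (Suc t)) * (K / real t) + C / (real (Suc t))\<^sup>2"
      using step t by (intro add_mono mult_left_mono) (auto simp: field_simps)
    also have "\<dots> \<le> K / real (Suc t)"
    proof -
      have "C * real t \<le> (K * (\<eta> - 1)) * (real t + 1)"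
      proof -
        have "C * real t \<le> (K * (\<eta> - 1)) * real t" using KC t by (intro mult_right_mono) auto
        moreover have "0 \<le> K * (\<eta> - 1)" using K0 eta by simp
        ultimately show ?thesis by (simp add: algebra_simps)
      qed
      moreover have "K / real (Suc t) - ((1 - \<eta> / real (Suc t)) * (K / real t) + C / (real (Suc t))\<^sup>2)
         = ((K * (\<eta> - 1)) * (real t + 1) - C * real t) / (real t * (real t + 1)\<^sup>2)"
        using t by (simp add: divide_simps power2_eq_square) (simp add: algebra_simps)
      moreover have "0 \<le> real t * (real t + 1)\<^sup>2" using t by simp
      ultimately have "0 \<le> K / real (Suc t) - ((1 - \<eta> / real (Suc t)) * (K / real t) + C / (real (Suc t))\<^sup>2)"
        by (simp only:) (intro divide_nonneg_nonneg, auto)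
      then show ?thesis by linarith
    qed
    finally show ?case .
  qed
  then show ?thesis by blast
qed

text \<open>For large t the perturbation C/(t+1)^2 is at most the fraction \<eta>/(t+1) of a fixed
  level, so the excess over that level is multiplied by at most exp(-\<eta>/(t+1)); the product of
  these factors vanishes because the harmonic series diverges.\<close>

lemma recursion_tendsto_0:
  fixes u :: "nat \<Rightarrow> real"
  assumes nonneg: "\<And>t. t \<ge> T \<Longrightarrow> 0 \<le> u t" and eta: "\<eta> > 0"
    and step: "\<And>t. t \<ge> T \<Longrightarrow> u (Suc t) \<le> (1 - \<eta> / real (Suc t)) * u t + C / (real (Suc t))\<^sup>2"
  shows "u \<longlonglongrightarrow> 0"
proof (rule LIMSEQ_I)
  fix e :: real assume e: "e > 0"
  define \<epsilon> where "\<epsilon> = e / 2"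
  have eps: "\<epsilon> > 0" using e \<epsilon>_def by simp
  define S where "S = max (Suc T) (max (nat \<lceil>\<eta>\<rceil>) (nat \<lceil>\<bar>C\<bar> / (\<eta> * \<epsilon>)\<rceil>))"
  have S: "S \<ge> T" "S > 0" "real S \<ge> \<eta>" "real S \<ge> \<bar>C\<bar> / (\<eta> * \<epsilon>)"
    unfolding S_def by (auto simp: le_max_iff_disj) linarith+
  \<comment> \<open>The positive part is taken because replacing 1 - s by exp(-s) enlarges only
    products with a nonnegative quantity.\<close>
  define w where "w t = max 0 (u t - \<epsilon>)" for t
  have w0: "w t \<ge> 0" for t by (simp add: w_def)
  have wstep: "w (Suc t) \<le> exp (- \<eta> / real (Suc t)) * w t" if "t \<ge> S" for t
  proof -
    have t: "real t > 0" "t \<ge> T" "real t \<ge> \<eta>" "real t \<ge> \<bar>C\<bar> / (\<eta> * \<epsilon>)" using that S by auto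
    have a: "0 \<le> 1 - \<eta> / real (Suc t)" using t by (simp add: field_simps)
    have "\<bar>C\<bar> \<le> real (Suc t) * (\<eta> * \<epsilon>)"
    proof -
      have "\<bar>C\<bar> \<le> real t * (\<eta> * \<epsilon>)" using t(4) eta eps by (simp add: field_simps)
      moreover have "0 < \<eta> * \<epsilon>" using eta eps by simp
      ultimately show ?thesis by (simp add: algebra_simps)
    qed
    then have "C / (real (Suc t))\<^sup>2 \<le> \<eta> / real (Suc t) * \<epsilon>"
      by (simp add: divide_simps power2_eq_square) (simp add: algebra_simps)
    then have "u (Suc t) - \<epsilon> \<le> (1 - \<eta> / real (Suc t)) * (u t - \<epsilon>)"
      using step[OF t(2)] by (simp add: algebra_simps diff_divide_distrib)
    also have "\<dots> \<le> (1 - \<eta> / real (Suc t)) * w t"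
      using a by (intro mult_left_mono) (auto simp: w_def)
    finally have "w (Suc t) \<le> (1 - \<eta> / real (Suc t)) * w t"
      using mult_nonneg_nonneg[OF a w0[of t]] unfolding w_def[of "Suc t"] by linarith
    also have "\<dots> \<le> exp (- \<eta> / real (Suc t)) * w t"
      using exp_ge_add_one_self[of "- \<eta> / real (Suc t)"] w0 by (intro mult_right_mono) auto
    finally show ?thesis .
  qed
  have wbound: "w t \<le> exp (- \<eta> * (harm t - harm S)) * w S" if "t \<ge> S" for t
    using that
  proof (induction t rule: dec_induct)
    case base then show ?case by simp
  next
    case (step t)
    have "w (Suc t) \<le> exp (- \<eta> / real (Suc t)) * w t" using wstep step by simp
    also have "\<dots> \<le> exp (- \<eta> / real (Suc t)) * (exp (- \<eta> * (harm t - harm S)) * w S)"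
      using step by (intro mult_left_mono) auto
    also have "\<dots> = exp (- \<eta> * (harm (Suc t) - harm S)) * w S"
      by (simp add: harm_Suc exp_add[symmetric] algebra_simps divide_inverse)
    finally show ?case .
  qed
  have "filterlim (\<lambda>t. harm t - harm S :: real) at_top sequentially"
    using filterlim_tendsto_add_at_top[OF tendsto_const[of "- harm S :: real"] harm_at_top] by simp
  then have "filterlim (\<lambda>t. - \<eta> * (harm t - harm S)) at_bot sequentially"
    using eta by (intro filterlim_tendsto_neg_mult_at_bot[OF tendsto_const]) auto
  then have "(\<lambda>t. exp (- \<eta> * (harm t - harm S)) * w S) \<longlonglongrightarrow> 0 * w S"
    by (intro tendsto_mult filterlim_compose[OF exp_at_bot]) auto
  then have "\<forall>\<^sub>F t in sequentially. exp (- \<eta> * (harm t - harm S)) * w S < \<epsilon>"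
    using eps by (auto dest: order_tendstoD(2))
  then obtain S' where S': "\<And>t. t \<ge> S' \<Longrightarrow> exp (- \<eta> * (harm t - harm S)) * w S < \<epsilon>"
    by (auto simp: eventually_sequentially)
  show "\<exists>no. \<forall>n\<ge>no. norm (u n - 0) < e"
  proof (intro exI allI impI)
    fix n assume n: "n \<ge> max S S'"
    then have "w n < \<epsilon>" using wbound[of n] S'[of n] by simp
    then have "u n < 2 * \<epsilon>" by (simp add: w_def)
    then show "norm (u n - 0) < e" using nonneg[of n] n S by (simp add: \<epsilon>_def)
  qed
qed

section \<open>Modes of decay that survive stable linear filtering\<close>

text \<open>Collects the closure properties used to pass from compressed states back to states, so
  that convergence to 0 and the rate 1/t share one argument. The essential one is
  \<open>contract\<close>: a first-order filter of ratio r < 1 must not slow the decay.\<close>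

locale decay_class =
  fixes R :: "(nat \<Rightarrow> real) \<Rightarrow> bool"
  assumes mono: "\<And>u v T. R v \<Longrightarrow> (\<And>t. t \<ge> T \<Longrightarrow> 0 \<le> u t \<and> u t \<le> v t) \<Longrightarrow> R u"
    and add: "\<And>u v. R u \<Longrightarrow> R v \<Longrightarrow> R (\<lambda>t. u t + v t)"
    and scale: "\<And>u C. R u \<Longrightarrow> 0 \<le> C \<Longrightarrow> R (\<lambda>t. C * u t)"
    and shift: "\<And>u k. R u \<Longrightarrow> R (\<lambda>t. u (t + k))"
    and zero: "R (\<lambda>_. 0)"
    and contract: "\<And>u v r T. R v \<Longrightarrow> 0 \<le> r \<Longrightarrow> r < 1 \<Longrightarrow>
      (\<And>t. t \<ge> T \<Longrightarrow> 0 \<le> u t \<and> u (Suc t) \<le> r * u t + v t) \<Longrightarrow> R u"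
begin

lemma sum: "(\<And>i. i \<in> I \<Longrightarrow> R (u i)) \<Longrightarrow> R (\<lambda>t. \<Sum>i\<in>I. u i t)"
  by (induction I rule: infinite_finite_induct) (auto simp: zero add)

end

text \<open>One-sided and eventual: it is applied to nonnegative sequences, and
  \<open>inverse_rate_from\<close> later recovers the bound from a prescribed time.\<close>

definition inverse_rate :: "(nat \<Rightarrow> real) \<Rightarrow> bool" where
  "inverse_rate u \<longleftrightarrow> (\<exists>K T. \<forall>t\<ge>T. u t \<le> K / real t)"

lemma inverse_rateE:
  assumes "inverse_rate u"
  obtains K T where "K \<ge> 0" "T > 0" "\<And>t. t \<ge> T \<Longrightarrow> u t \<le> K / real t"
proof -
  from assms obtain K T where KT: "\<And>t. t \<ge> T \<Longrightarrow> u t \<le> K / real t"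
    unfolding inverse_rate_def by blast
  have "u t \<le> \<bar>K\<bar> / real t" if "t \<ge> Suc T" for t
    using KT[of t] that divide_right_mono[of K "\<bar>K\<bar>" "real t"] by linarith
  then show ?thesis using that[of "\<bar>K\<bar>" "Suc T"] by simp
qed

lemma inverse_rate_from:
  assumes "inverse_rate u" "s > 0"
  shows "\<exists>C. \<forall>t\<ge>s. u t \<le> C / real t"
proof -
  from assms(1) obtain K T where KT: "K \<ge> 0" "\<And>t. t \<ge> T \<Longrightarrow> u t \<le> K / real t"
    using inverse_rateE by blast
  \<comment> \<open>The sum accounts for the finitely many times below T that the eventual bound
    misses.\<close>
  define C where "C = K + (\<Sum>t<T. \<bar>real t * u t\<bar>)"
  have "u t \<le> C / real t" if t: "t \<ge> s" for t
  proof (cases "t \<ge> T")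
    case True
    have "K \<le> C" unfolding C_def by (simp add: sum_nonneg)
    then have "K / real t \<le> C / real t" by (intro divide_right_mono) auto
    then show ?thesis using KT(2)[OF True] by linarith
  next
    case False
    have "\<bar>real t * u t\<bar> \<le> (\<Sum>t<T. \<bar>real t * u t\<bar>)"
      using False by (intro member_le_sum) auto
    then have "real t * u t \<le> C" unfolding C_def using KT(1) by linarith
    then show ?thesis using t assms(2) by (simp add: field_simps)
  qed
  then show ?thesis by blast
qed

lemma decay_class_tendsto_0: "decay_class (\<lambda>u. u \<longlonglongrightarrow> 0)"
proof (unfold_locales, goal_cases)
  case (1 u v T)
  then show ?case
    by (intro tendsto_sandwich[of "\<lambda>_. 0" u sequentially v]) (auto simp: eventually_sequentially)
next
  case (2 u v) then show ?case using tendsto_add[of u 0 _ v 0] by simp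
next
  case (3 u C) then show ?case using tendsto_mult_right[of u 0 _ C] by (simp add: tendsto_mult_right_zero)
next
  case (4 u k) then show ?case by (rule LIMSEQ_ignore_initial_segment)
next
  case 5 then show ?case by simp
next
  case (6 u v r T)
  show ?case
  proof (rule LIMSEQ_I)
    fix e :: real assume e: "e > 0"
    \<comment> \<open>Input below (1 - r) e/2 makes the excess of u over e/2 contract with ratio
      r.\<close>
    have "\<forall>\<^sub>F t in sequentially. v t < (1 - r) * (e / 2)"
      using 6 e by (intro order_tendstoD(2)[OF 6(1)]) auto
    then obtain S0 where S0: "\<And>t. t \<ge> S0 \<Longrightarrow> v t < (1 - r) * (e / 2)"
      by (auto simp: eventually_sequentially)
    define S where "S = max S0 T"
    have bd: "u (S + k) - e / 2 \<le> r ^ k * u S" for k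
    proof (induction k)
      case 0 then show ?case using e by simp
    next
      case (Suc k)
      have "u (Suc (S + k)) \<le> r * u (S + k) + v (S + k)" using 6(4)[of "S + k"] S_def by simp
      moreover have "v (S + k) < (1 - r) * (e / 2)" using S0[of "S + k"] S_def by simp
      moreover have "r * (u (S + k) - e / 2) \<le> r * (r ^ k * u S)"
        using Suc 6(2) by (rule mult_left_mono)
      ultimately show ?case by (simp add: algebra_simps)
    qed
    have "(\<lambda>k. r ^ k * u S) \<longlonglongrightarrow> 0"
      using 6 by (intro tendsto_mult_left_zero LIMSEQ_realpow_zero) auto
    then have "\<forall>\<^sub>F k in sequentially. r ^ k * u S < e / 2"
      using e by (intro order_tendstoD(2)) auto
    then obtain k0 where k0: "\<And>k. k \<ge> k0 \<Longrightarrow> r ^ k * u S < e / 2"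
      by (auto simp: eventually_sequentially)
    show "\<exists>no. \<forall>n\<ge>no. norm (u n - 0) < e"
    proof (intro exI allI impI)
      fix n assume n: "n \<ge> S + k0"
      have "u (S + (n - S)) - e / 2 \<le> r ^ (n - S) * u S" by (rule bd)
      moreover have "r ^ (n - S) * u S < e / 2" using n by (intro k0) auto
      moreover have "0 \<le> u n" using 6(4)[of n] n S_def by simp
      ultimately show "norm (u n - 0) < e" using n by simp
    qed
  qed
qed

lemma decay_class_inverse_rate: "decay_class inverse_rate"
proof (unfold_locales, goal_cases)
  case (1 u v T)
  obtain K S where KS: "\<And>t. t \<ge> S \<Longrightarrow> v t \<le> K / real t" using inverse_rateE[OF 1(1)] by metis
  show ?case unfolding inverse_rate_def
  proof (intro exI[of _ K] exI[of _ "max T S"] allI impI)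
    fix t assume "t \<ge> max T S"
    then show "u t \<le> K / real t" using KS[of t] 1(2)[of t] by auto
  qed
next
  case (2 u v)
  obtain K S where KS: "\<And>t. t \<ge> S \<Longrightarrow> u t \<le> K / real t" using inverse_rateE[OF 2(1)] by metis
  obtain K' S' where KS': "\<And>t. t \<ge> S' \<Longrightarrow> v t \<le> K' / real t" using inverse_rateE[OF 2(2)] by metis
  show ?case unfolding inverse_rate_def
  proof (intro exI[of _ "K + K'"] exI[of _ "max S S'"] allI impI)
    fix t assume "t \<ge> max S S'"
    then show "u t + v t \<le> (K + K') / real t"
      using KS[of t] KS'[of t] by (auto simp: add_divide_distrib)
  qed
next
  case (3 u C)
  obtain K S where KS: "\<And>t. t \<ge> S \<Longrightarrow> u t \<le> K / real t" using inverse_rateE[OF 3(1)] by metis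
  show ?case unfolding inverse_rate_def
  proof (intro exI[of _ "C * K"] exI[of _ S] allI impI)
    fix t assume "t \<ge> S"
    then show "C * u t \<le> C * K / real t" using mult_left_mono[OF KS 3(2), of t] by auto
  qed
next
  case (4 u k)
  obtain K S where KS: "K \<ge> 0" "S > 0" "\<And>t. t \<ge> S \<Longrightarrow> u t \<le> K / real t"
    using inverse_rateE[OF 4] by metis
  show ?case unfolding inverse_rate_def
  proof (intro exI[of _ K] exI[of _ S] allI impI)
    fix t assume "t \<ge> S"
    then show "u (t + k) \<le> K / real t"
      using KS(3)[of "t + k"] divide_left_mono[of "real t" "real (t + k)" K] KS(1,2) by auto
  qed
next
  case 5 then show ?case unfolding inverse_rate_def by (intro exI[of _ 0]) auto
next
  case (6 u v r T)
  obtain C S where CS: "C \<ge> 0" "S > 0" "\<And>t. t \<ge> S \<Longrightarrow> v t \<le> C / real t"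
    using inverse_rateE[OF 6(1)] by metis
  \<comment> \<open>From S' on, half of the gap 1 - r covers the loss in passing from 1/t to
    1/(t+1); the choice of K lets the other half cover the input C/t.\<close>
  define S' where "S' = max (max T S) (nat \<lceil>2 / (1 - r)\<rceil>)"
  define K where "K = max (real S' * u S') (2 * C / (1 - r))"
  have S': "S' \<ge> T" "S' \<ge> S" "S' > 0" "real S' \<ge> 2 / (1 - r)"
    using CS(2) unfolding S'_def by (auto simp: le_max_iff_disj) linarith
  have "2 * C / (1 - r) \<le> K" unfolding K_def by simp
  then have K: "2 * C \<le> K * (1 - r)" using 6 by (simp add: field_simps)
  have K0: "K \<ge> 0" unfolding K_def using CS(1) 6 by (simp add: le_max_iff_disj)
  have "u t \<le> K / real t" if "t \<ge> S'" for t
    using that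
  proof (induction t rule: dec_induct)
    case base
    have "real S' * u S' \<le> K" unfolding K_def by simp
    then show ?case using S' by (simp add: field_simps)
  next
    case (step t)
    have t: "t \<ge> T" "t \<ge> S" "real t > 0" "real t \<ge> 2 / (1 - r)" using step S' by auto
    have "real t * (1 - r) \<ge> 2" using t(4) 6 by (simp add: field_simps)
    then have t2: "(real t + 1) * (1 - r) \<ge> 2" using 6 by (simp add: algebra_simps)
    have "u (Suc t) \<le> r * u t + v t" using 6(4)[OF t(1)] by simp
    also have "\<dots> \<le> r * (K / real t) + C / real t"
      using step t CS 6 by (intro add_mono mult_left_mono) auto
    also have "\<dots> = (r * K + C) / real t" by (simp add: add_divide_distrib)
    also have "\<dots> \<le> K / real (Suc t)"
    proof -
      have "K * 2 \<le> K * ((real t + 1) * (1 - r))" using t2 K0 by (intro mult_left_mono) auto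
      moreover have "2 * C * (real t + 1) \<le> K * (1 - r) * (real t + 1)"
        using K by (intro mult_right_mono) auto
      ultimately have "(r * K + C) * (real t + 1) \<le> K * real t" by (simp add: algebra_simps)
      then show ?thesis using t by (simp add: field_simps)
    qed
    finally show ?case .
  qed
  then show ?case unfolding inverse_rate_def by blast
qed

section \<open>Stable linear recursions driven by a decaying input\<close>

text \<open>The polynomial p in the forward shift operator, applied to the sequence w.\<close>

definition shift_op :: "complex poly \<Rightarrow> (nat \<Rightarrow> complex) \<Rightarrow> nat \<Rightarrow> complex" where
  "shift_op p w t = (\<Sum>k\<le>degree p. coeff p k * w (t + k))"

lemma shift_op_eq_sum:
  assumes "degree p \<le> m"
  shows "shift_op p w t = (\<Sum>k\<le>m. coeff p k * w (t + k))"
  unfolding shift_op_def using assms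
  by (intro sum.mono_neutral_left) (auto simp: coeff_eq_0)

lemma shift_op_1 [simp]: "shift_op 1 w t = w t"
  by (simp add: shift_op_def)

text \<open>Products of polynomials act as compositions of shift operators, so splitting off one
  root leaves a first-order recursion for the sequence filtered by the remaining factor. This takes
  the place of estimates for powers of a companion matrix.\<close>

lemma shift_op_linear_factor:
  "shift_op ([:- r, 1:] * q) w t = shift_op q w (Suc t) - r * shift_op q w t"
proof -
  define m where "m = Suc (degree q)"
  have d: "degree ([:- r, 1:] * q) \<le> m"
    using degree_mult_le[of "[:- r, 1:]" q] by (simp add: m_def)
  have c: "coeff ([:- r, 1:] * q) k = coeff (pCons 0 q) k - r * coeff q k" for k
    by simp
  have "shift_op ([:- r, 1:] * q) w t =
      (\<Sum>k\<le>m. coeff (pCons 0 q) k * w (t + k)) - r * (\<Sum>k\<le>m. coeff q k * w (t + k))"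
    unfolding shift_op_eq_sum[OF d] c
    by (simp add: sum_subtractf sum_distrib_left algebra_simps del: mult_pCons_left)
  also have "(\<Sum>k\<le>m. coeff (pCons 0 q) k * w (t + k)) = (\<Sum>k\<le>degree q. coeff q k * w (Suc t + k))"
    unfolding m_def by (subst sum.atMost_Suc_shift) simp
  also have "(\<Sum>k\<le>m. coeff q k * w (t + k)) = shift_op q w t"
    by (rule shift_op_eq_sum[symmetric]) (simp add: m_def)
  finally show ?thesis by (simp add: shift_op_def)
qed

text \<open>Convexity of the square at the weights \<open>|r|\<close> and \<open>1 - |r|\<close>.\<close>
lemma norm_affine_step_square_le:
  fixes r v g :: complex
  assumes "norm r < 1"
  shows "(norm (r * v + g))\<^sup>2 \<le> norm r * (norm v)\<^sup>2 + (norm g)\<^sup>2 / (1 - norm r)"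
proof -
  define s where "s = norm r"
  define a where "a = norm v"
  define b where "b = norm g"
  have s: "0 \<le> s" "s < 1" using assms by (auto simp: s_def)
  have "norm (r * v + g) \<le> s * a + b"
    unfolding s_def a_def b_def by (metis norm_mult norm_triangle_ineq)
  then have "(norm (r * v + g))\<^sup>2 \<le> (s * a + b)\<^sup>2" by (intro power_mono) auto
  also have "\<dots> \<le> s * a\<^sup>2 + b\<^sup>2 / (1 - s)"
  proof -
    have "s * a\<^sup>2 + b\<^sup>2 / (1 - s) - (s * a + b)\<^sup>2 = s * ((1 - s) * a - b)\<^sup>2 / (1 - s)"
      using s by (simp add: field_simps power2_eq_square)
    moreover have "\<dots> \<ge> 0" using s by simp
    ultimately show ?thesis by linarith
  qed
  finally show ?thesis unfolding s_def a_def b_def .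
qed

text \<open>Induction on the roots: the sequence filtered by all factors but one obeys a first-order
  recursion of ratio r driven by the fully filtered sequence, so \<open>contract\<close> transfers
  the decay one root at a time. Values are complex because the roots may be; boundedness makes all
  the squares integrable.\<close>

lemma (in prob_space) stable_recursion_decay:
  fixes w :: "nat \<Rightarrow> 'a \<Rightarrow> complex"
  assumes R: "decay_class R"
    and meas: "\<And>t. t \<ge> T \<Longrightarrow> w t \<in> borel_measurable M"
    and bounded: "\<And>t. t \<ge> T \<Longrightarrow> \<exists>B. \<forall>\<omega>\<in>space M. norm (w t \<omega>) \<le> B"
    and stable: "\<And>r. r \<in># A \<Longrightarrow> norm r < 1"
    and input: "R (\<lambda>t. expectation (\<lambda>\<omega>. (norm (shift_op (\<Prod>r\<in>#A. [:- r, 1:]) (\<lambda>s. w s \<omega>) t))\<^sup>2))"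
  shows "R (\<lambda>t. expectation (\<lambda>\<omega>. (norm (w t \<omega>))\<^sup>2))"
  using stable input
proof (induction A)
  case empty
  then show ?case by simp
next
  case (add r A)
  define q where "q = (\<Prod>r\<in>#A. [:- r, 1:])"
  define v where "v t \<omega> = shift_op q (\<lambda>s. w s \<omega>) t" for t \<omega>
  define g where "g t \<omega> = shift_op ([:- r, 1:] * q) (\<lambda>s. w s \<omega>) t" for t \<omega>
  have int: "integrable M (\<lambda>\<omega>. (norm (shift_op p (\<lambda>s. w s \<omega>) t))\<^sup>2)" if "t \<ge> T" for t p
  proof -
    have "\<forall>s. \<exists>B. s \<ge> T \<longrightarrow> (\<forall>\<omega>\<in>space M. norm (w s \<omega>) \<le> B)" using bounded by blast
    then obtain B where B: "\<And>s \<omega>. s \<ge> T \<Longrightarrow> \<omega> \<in> space M \<Longrightarrow> norm (w s \<omega>) \<le> B s"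
      by metis
    have "norm (shift_op p (\<lambda>s. w s \<omega>) t) \<le> (\<Sum>k\<le>degree p. norm (coeff p k) * B (t + k))"
      if "\<omega> \<in> space M" for \<omega>
      unfolding shift_op_def using B that \<open>t \<ge> T\<close>
      by (intro order_trans[OF norm_sum] sum_mono) (auto simp: norm_mult intro!: mult_left_mono)
    then have "norm ((norm (shift_op p (\<lambda>s. w s \<omega>) t))\<^sup>2) \<le>
        (\<Sum>k\<le>degree p. norm (coeff p k) * B (t + k))\<^sup>2" if "\<omega> \<in> space M" for \<omega>
      using that by (auto intro!: power_mono)
    moreover have "(\<lambda>\<omega>. shift_op p (\<lambda>s. w s \<omega>) t) \<in> borel_measurable M"
      unfolding shift_op_def using meas \<open>t \<ge> T\<close> by (intro borel_measurable_sum borel_measurable_times) auto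
    ultimately show ?thesis
      by (intro integrable_const_bound[where B = "(\<Sum>k\<le>degree p. norm (coeff p k) * B (t + k))\<^sup>2"]) auto
  qed
  have r: "norm r < 1" using add.prems by simp
  have "R (\<lambda>t. expectation (\<lambda>\<omega>. (norm (g t \<omega>))\<^sup>2))"
    using add.prems(2) by (simp add: g_def q_def del: mult_pCons_left)
  then have "R (\<lambda>t. (1 / (1 - norm r)) * expectation (\<lambda>\<omega>. (norm (g t \<omega>))\<^sup>2))"
    using r by (intro decay_class.scale[OF R]) auto
  then have "R (\<lambda>t. expectation (\<lambda>\<omega>. (norm (v t \<omega>))\<^sup>2))"
  proof (rule decay_class.contract[OF R, where r = "norm r" and T = T])
    fix t assume t: "t \<ge> T"
    have iv: "integrable M (\<lambda>\<omega>. (norm (v s \<omega>))\<^sup>2)" if "s \<ge> T" for s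
      unfolding v_def by (rule int[OF that])
    have ig: "integrable M (\<lambda>\<omega>. (norm (g t \<omega>))\<^sup>2)"
      unfolding g_def by (rule int[OF t])
    have "v (Suc t) \<omega> = r * v t \<omega> + g t \<omega>" for \<omega>
      unfolding g_def v_def shift_op_linear_factor by simp
    then have "(norm (v (Suc t) \<omega>))\<^sup>2 \<le> norm r * (norm (v t \<omega>))\<^sup>2 + (1 / (1 - norm r)) * (norm (g t \<omega>))\<^sup>2"
      for \<omega> using norm_affine_step_square_le[OF r, of "v t \<omega>" "g t \<omega>"] by simp
    then have "expectation (\<lambda>\<omega>. (norm (v (Suc t) \<omega>))\<^sup>2) \<le>
        expectation (\<lambda>\<omega>. norm r * (norm (v t \<omega>))\<^sup>2 + (1 / (1 - norm r)) * (norm (g t \<omega>))\<^sup>2)"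
      using iv[OF t] iv[of "Suc t"] ig t
      by (intro integral_mono Bochner_Integration.integrable_add integrable_mult_right) auto
    also have "\<dots> = norm r * expectation (\<lambda>\<omega>. (norm (v t \<omega>))\<^sup>2)
        + (1 / (1 - norm r)) * expectation (\<lambda>\<omega>. (norm (g t \<omega>))\<^sup>2)"
      using iv[OF t] ig by (subst Bochner_Integration.integral_add) auto
    finally show "0 \<le> expectation (\<lambda>\<omega>. (norm (v t \<omega>))\<^sup>2) \<and>
        expectation (\<lambda>\<omega>. (norm (v (Suc t) \<omega>))\<^sup>2) \<le> norm r * expectation (\<lambda>\<omega>. (norm (v t \<omega>))\<^sup>2)
        + (1 / (1 - norm r)) * expectation (\<lambda>\<omega>. (norm (g t \<omega>))\<^sup>2)" by simp
  qed (use r in auto)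
  then show ?case using add.IH add.prems(1) unfolding v_def q_def by auto
qed

section \<open>The Gaussian distribution function\<close>

lemma gauss_cdf_mono:
  assumes "\<sigma> > 0" "u \<le> v"
  shows "gauss_cdf \<sigma> u \<le> gauss_cdf \<sigma> v"
proof -
  interpret prob_space "density lborel (\<lambda>y. ennreal (normal_density 0 \<sigma> y))"
    by (rule prob_space_normal_density[OF assms(1)])
  show ?thesis unfolding gauss_cdf_def using assms by (intro finite_measure_mono) auto
qed

lemma gauss_cdf_bounds:
  assumes "\<sigma> > 0"
  shows "0 \<le> gauss_cdf \<sigma> u" "gauss_cdf \<sigma> u \<le> 1"
proof -
  interpret prob_space "density lborel (\<lambda>y. ennreal (normal_density 0 \<sigma> y))"
    by (rule prob_space_normal_density[OF assms])
  show "0 \<le> gauss_cdf \<sigma> u" "gauss_cdf \<sigma> u \<le> 1" unfolding gauss_cdf_def by auto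
qed

lemma borel_measurable_gauss_cdf [measurable]:
  assumes "\<sigma> > 0"
  shows "gauss_cdf \<sigma> \<in> borel_measurable borel"
  by (rule borel_measurable_mono) (auto simp: mono_def gauss_cdf_mono[OF assms])

lemma normal_density_antimono_abs:
  assumes "\<bar>x\<bar> \<le> y"
  shows "normal_density 0 \<sigma> y \<le> normal_density 0 \<sigma> x"
proof -
  have "x\<^sup>2 \<le> y\<^sup>2" using assms by (metis abs_ge_zero power2_abs power_mono)
  then have "exp (- y\<^sup>2 / (2 * \<sigma>\<^sup>2)) \<le> exp (- x\<^sup>2 / (2 * \<sigma>\<^sup>2))"
    by (simp add: divide_right_mono)
  then show ?thesis unfolding normal_density_def by (simp add: divide_right_mono)
qed

text \<open>The increment is the Gaussian mass of the interval from u to v, so a lower bound on the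
  density is simply integrated.\<close>

lemma gauss_cdf_increment_ge:
  assumes "\<sigma> > 0" "u \<le> v" "0 \<le> K" and dens: "\<And>y. u \<le> y \<Longrightarrow> y \<le> v \<Longrightarrow> K \<le> normal_density 0 \<sigma> y"
  shows "K * (v - u) \<le> gauss_cdf \<sigma> v - gauss_cdf \<sigma> u"
proof -
  let ?G = "density lborel (\<lambda>y. ennreal (normal_density 0 \<sigma> y))"
  interpret prob_space ?G by (rule prob_space_normal_density[OF assms(1)])
  have "gauss_cdf \<sigma> v - gauss_cdf \<sigma> u = measure ?G ({..v} - {..u})"
    unfolding gauss_cdf_def using assms by (subst finite_measure_Diff) auto
  also have "{..v} - {..u} = {u<..v}" by auto
  finally have eq: "gauss_cdf \<sigma> v - gauss_cdf \<sigma> u = measure ?G {u<..v}" .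
  have "ennreal (K * (v - u)) = (\<integral>\<^sup>+y. ennreal K * indicator {u<..v} y \<partial>lborel)"
    using assms by (simp add: nn_integral_cmult_indicator ennreal_mult)
  also have "\<dots> \<le> (\<integral>\<^sup>+y. ennreal (normal_density 0 \<sigma> y) * indicator {u<..v} y \<partial>lborel)"
    using dens by (intro nn_integral_mono) (auto split: split_indicator intro!: ennreal_leI)
  also have "\<dots> = emeasure ?G {u<..v}" by (subst emeasure_density) auto
  also have "\<dots> = ennreal (measure ?G {u<..v})" by (rule emeasure_eq_measure)
  finally show ?thesis unfolding eq by simp
qed

text \<open>Both arguments c - y and c - z lie within M of c, where the density is at least its
  value at |c| + M. The sign is negative because the estimate enters with a minus.\<close>

lemma gauss_cdf_strongly_monotone:
  assumes "\<sigma> > 0" "0 \<le> K" "K \<le> normal_density 0 \<sigma> (\<bar>c\<bar> + M)" "\<bar>y\<bar> \<le> M" "\<bar>z\<bar> \<le> M"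
  shows "(y - z) * (gauss_cdf \<sigma> (c - y) - gauss_cdf \<sigma> (c - z)) \<le> - K * (y - z)\<^sup>2"
proof -
  have *: "K * (v - u) \<le> gauss_cdf \<sigma> v - gauss_cdf \<sigma> u"
    if "u \<le> v" "c - M \<le> u" "v \<le> c + M" for u v
  proof (rule gauss_cdf_increment_ge)
    fix s assume "u \<le> s" "s \<le> v"
    then have "\<bar>s\<bar> \<le> \<bar>c\<bar> + M" using that by linarith
    then show "K \<le> normal_density 0 \<sigma> s"
      using normal_density_antimono_abs assms(3) order_trans by blast
  qed (use assms that in auto)
  show ?thesis
  proof (cases "y \<le> z")
    case True
    have "K * ((c - y) - (c - z)) \<le> gauss_cdf \<sigma> (c - y) - gauss_cdf \<sigma> (c - z)"
      using assms True by (intro *) auto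
    then have "(y - z) * (gauss_cdf \<sigma> (c - y) - gauss_cdf \<sigma> (c - z)) \<le> (y - z) * (K * ((c - y) - (c - z)))"
      using True by (intro mult_left_mono_neg) auto
    then show ?thesis by (simp add: power2_eq_square algebra_simps)
  next
    case False
    have "K * ((c - z) - (c - y)) \<le> gauss_cdf \<sigma> (c - z) - gauss_cdf \<sigma> (c - y)"
      using assms False by (intro *) auto
    then have "(y - z) * (K * ((c - z) - (c - y))) \<le> (y - z) * (gauss_cdf \<sigma> (c - z) - gauss_cdf \<sigma> (c - y))"
      using False by (intro mult_left_mono) auto
    then show ?thesis by (simp add: power2_eq_square algebra_simps)
  qed
qed

lemma f_M_facts:
  assumes "\<sigma> > 0"
  shows "E i j \<Longrightarrow> i < N \<Longrightarrow> j < N \<Longrightarrow> f_M N E \<sigma> c M \<le> normal_density 0 \<sigma> (\<bar>c i j\<bar> + M)"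
    and "\<exists>i<N. \<exists>j<N. E i j \<Longrightarrow> 0 < f_M N E \<sigma> c M"
proof -
  let ?S = "{normal_density 0 \<sigma> (\<bar>c i j\<bar> + M) | i j. i < N \<and> j < N \<and> E i j}"
  have "?S \<subseteq> (\<lambda>(i, j). normal_density 0 \<sigma> (\<bar>c i j\<bar> + M)) ` ({..<N} \<times> {..<N})" by auto
  then have fin: "finite ?S" by (rule finite_subset) auto
  show "f_M N E \<sigma> c M \<le> normal_density 0 \<sigma> (\<bar>c i j\<bar> + M)" if "E i j" "i < N" "j < N"
    unfolding f_M_def using that fin by (intro Min_le) auto
  show "0 < f_M N E \<sigma> c M" if "\<exists>i<N. \<exists>j<N. E i j"
  proof -
    have "?S \<noteq> {}" using that by auto
    then show ?thesis unfolding f_M_def using fin by (subst Min_gr_iff) (auto simp: normal_density_pos[OF assms])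
  qed
qed

text \<open>Independence of the two sigma-algebras is expressed through identity maps, since
  \<open>indep_var\<close> requires both random variables to have the same type.\<close>
lemma (in prob_space) gaussian_bit_centered:
  assumes sigma: "\<sigma> > 0" and ind: "indep_var F (\<lambda>\<omega>. \<omega>) (vimage_algebra (space M) D borel) (\<lambda>\<omega>. \<omega>)"
    and D: "distributed M lborel D (\<lambda>y. ennreal (normal_density 0 \<sigma> y))"
    and g: "g \<in> borel_measurable F" and z: "z \<in> borel_measurable F"
    and bounded: "\<And>\<omega>. \<omega> \<in> space F \<Longrightarrow> \<bar>g \<omega>\<bar> \<le> B"
  shows "expectation (\<lambda>\<omega>. g \<omega> * (gauss_cdf \<sigma> (c - z \<omega>) - (if z \<omega> + D \<omega> \<le> c then 1 else 0))) = 0"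
proof -
  define T where "T = vimage_algebra (space M) D borel"
  have DT: "D \<in> borel_measurable T" unfolding T_def by (rule measurable_vimage_algebra1) auto
  note [measurable] = g z DT borel_measurable_gauss_cdf[OF sigma]
  define h where "h p = g (fst p) * (gauss_cdf \<sigma> (c - z (fst p)) - (if z (fst p) + D (snd p) \<le> c then 1 else 0))"
    for p :: "'a \<times> 'a"
  have Dm: "random_variable borel D" using distributed_measurable[OF D] by simp
  have Ym: "random_variable T (\<lambda>\<omega>. \<omega>)" and Xm: "random_variable F (\<lambda>\<omega>. \<omega>)"
    using ind by (auto simp: T_def dest: indep_var_rv1 indep_var_rv2)
  have prob_D: "prob {\<omega> \<in> space M. D \<omega> \<le> u} = gauss_cdf \<sigma> u" for u
  proof -
    have "gauss_cdf \<sigma> u = measure (distr M lborel D) {..u}"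
      unfolding gauss_cdf_def distributed_distr_eq_density[OF D] ..
    also have "\<dots> = prob (D -` {..u} \<inter> space M)"
      using Dm by (intro measure_distr) auto
    also have "D -` {..u} \<inter> space M = {\<omega> \<in> space M. D \<omega> \<le> u}" by auto
    finally show ?thesis by simp
  qed
  define P where "P = distr M F (\<lambda>\<omega>. \<omega>)"
  define G where "G = distr M T (\<lambda>\<omega>. \<omega>)"
  interpret P: prob_space P unfolding P_def using Xm by (rule prob_space_distr)
  interpret G: prob_space G unfolding G_def using Ym by (rule prob_space_distr)
  interpret PG: pair_prob_space P G ..
  \<comment> \<open>Independence turns the law of the diagonal map into a product. Since
    \<open>h\<close> keeps past and noise in separate arguments, it can be integrated over the noise
    first.\<close>
  have prod: "P \<Otimes>\<^sub>M G = distr M (F \<Otimes>\<^sub>M T) (\<lambda>\<omega>. (\<omega>, \<omega>))"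
    using ind unfolding indep_var_distribution_eq P_def G_def T_def by simp
  have sP [measurable_cong]: "sets P = sets F" and sG [measurable_cong]: "sets G = sets T"
    by (auto simp: P_def G_def)
  have hm [measurable]: "h \<in> borel_measurable (F \<Otimes>\<^sub>M T)"
    unfolding h_def by measurable
  then have hm': "h \<in> borel_measurable (P \<Otimes>\<^sub>M G)"
    by (simp cong: measurable_cong_sets add: sets_pair_measure_cong[OF sP sG])
  have hb: "norm (h p) \<le> B" if "p \<in> space (P \<Otimes>\<^sub>M G)" for p
  proof -
    have "\<bar>g (fst p)\<bar> \<le> B" using that by (auto simp: space_pair_measure P_def intro!: bounded)
    moreover have "\<bar>gauss_cdf \<sigma> (c - z (fst p)) - (if z (fst p) + D (snd p) \<le> c then 1 else 0)\<bar> \<le> 1"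
      using gauss_cdf_bounds[OF sigma, of "c - z (fst p)"] by auto
    ultimately have "\<bar>g (fst p)\<bar> * \<bar>gauss_cdf \<sigma> (c - z (fst p)) - (if z (fst p) + D (snd p) \<le> c then 1 else 0)\<bar> \<le> B * 1"
      by (intro mult_mono) auto
    then show ?thesis unfolding h_def real_norm_def abs_mult by simp
  qed
  have hint: "integrable (P \<Otimes>\<^sub>M G) h"
    using hb hm' by (intro PG.integrable_const_bound[where B = B]) auto
  have "expectation (\<lambda>\<omega>. h (\<omega>, \<omega>)) = integral\<^sup>L (distr M (F \<Otimes>\<^sub>M T) (\<lambda>\<omega>. (\<omega>, \<omega>))) h"
    using Xm Ym by (intro integral_distr[symmetric]) auto
  also have "\<dots> = (\<integral>x. (\<integral>y. h (x, y) \<partial>G) \<partial>P)"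
    unfolding prod[symmetric] by (rule PG.integral_fst'[symmetric, OF hint])
  \<comment> \<open>With the past frozen at x, the bit has mean
    \<open>gauss_cdf \<sigma> (c - z x)\<close>, which is the term it is subtracted from.\<close>
  also have "\<dots> = (\<integral>x. 0 \<partial>P)"
  proof (rule Bochner_Integration.integral_cong[OF refl])
    fix x assume "x \<in> space P"
    have "(\<integral>y. (if z x + D y \<le> c then 1 else 0 :: real) \<partial>G) = (\<integral>y. (if z x + D y \<le> c then 1 else 0) \<partial>M)"
      unfolding G_def using Ym by (intro integral_distr) auto
    also have "\<dots> = (\<integral>y. indicator {\<omega> \<in> space M. D \<omega> \<le> c - z x} y \<partial>M)"
      by (intro Bochner_Integration.integral_cong) (auto split: split_indicator)
    also have "\<dots> = gauss_cdf \<sigma> (c - z x)" using Dm prob_D by simp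
    finally have e: "(\<integral>y. (if z x + D y \<le> c then 1 else 0) \<partial>G) = gauss_cdf \<sigma> (c - z x)" .
    have "integrable G (\<lambda>y. if z x + D y \<le> c then 1 else 0 :: real)"
      by (intro G.integrable_const_bound[where B = 1]) auto
    then have "(\<integral>y. gauss_cdf \<sigma> (c - z x) - (if z x + D y \<le> c then 1 else 0) \<partial>G) = 0"
      by (subst Bochner_Integration.integral_diff) (auto simp: e G.prob_space)
    then show "(\<integral>y. h (x, y) \<partial>G) = 0"
      unfolding h_def by simp
  qed
  finally show ?thesis by (simp add: h_def)
qed

text \<open>A statement about sigma-algebras rather than tuples of noises, because estimates and
  states are used later only through their measurability in the past.\<close>

lemma (in prob_space) indep_var_past_future:
  assumes ind: "indep_vars (\<lambda>_. N) X I" and J: "J \<subseteq> I" and k: "k \<in> I" "k \<notin> J"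
  shows "indep_var (vimage_algebra (space M) (\<lambda>\<omega>. restrict (\<lambda>i. X i \<omega>) J) (PiM J (\<lambda>_. N))) (\<lambda>\<omega>. \<omega>)
    (vimage_algebra (space M) (X k) N) (\<lambda>\<omega>. \<omega>)"
proof -
  let ?X = "\<lambda>\<omega>. restrict (\<lambda>i. X i \<omega>) J" and ?Y = "\<lambda>\<omega>. restrict (\<lambda>i. X i \<omega>) {k}"
  define F where "F = vimage_algebra (space M) ?X (PiM J (\<lambda>_. N))"
  define T where "T = vimage_algebra (space M) (X k) N"
  have rv: "random_variable N (X i)" if "i \<in> I" for i
    using ind that by (auto simp: indep_vars_def)
  have XJ: "?X \<in> measurable M (PiM J (\<lambda>_. N))" using rv J by (intro measurable_restrict) auto
  have iv: "indep_var (PiM J (\<lambda>_. N)) ?X (PiM {k} (\<lambda>_. N)) ?Y"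
    using J k by (intro indep_var_restrict[OF ind]) auto
  have space_FT: "space F = space M" "space T = space M" by (simp_all add: F_def T_def)
  have sets_F: "sets F = {?X -` A \<inter> space M | A. A \<in> sets (PiM J (\<lambda>_. N))}"
    unfolding F_def using measurable_space[OF XJ] by (intro sets_vimage_algebra2) auto
  have sets_T: "sets T = {X k -` A \<inter> space M | A. A \<in> sets N}"
    unfolding T_def using measurable_space[OF rv[OF k(1)]] by (intro sets_vimage_algebra2) auto
  have id: "(\<lambda>\<omega>. \<omega>) \<in> measurable M S" if "sets S \<subseteq> sets M" "space S = space M" for S
  proof (rule measurableI)
    fix A assume A: "A \<in> sets S"
    then have "A \<subseteq> space M" using sets.sets_into_space that(2) by blast
    then show "(\<lambda>\<omega>. \<omega>) -` A \<inter> space M \<in> sets M" using A that by (auto simp: Int_absorb2)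
  qed (use that in auto)
  have idF: "(\<lambda>\<omega>. \<omega>) \<in> measurable M F"
    using XJ by (intro id) (auto simp: sets_F space_FT intro: measurable_sets)
  have idT: "(\<lambda>\<omega>. \<omega>) \<in> measurable M T"
    using rv[OF k(1)] by (intro id) (auto simp: sets_T space_FT intro: measurable_sets)
  \<comment> \<open>An identity map generates the sigma-algebra of its target, so independence of
    the two maps reduces to that of \<open>F\<close> and \<open>T\<close>.\<close>
  have gen: "sigma_sets (space M) {(\<lambda>\<omega>. \<omega>) -` A \<inter> space M | A. A \<in> sets S} = sets S"
    if "space S = space M" for S :: "'a measure"
  proof -
    have "{(\<lambda>\<omega>. \<omega>) -` A \<inter> space M | A. A \<in> sets S} = sets S"
    proof (rule subset_antisym[OF subsetI subsetI, rotated])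
      fix A assume A: "A \<in> sets S"
      then have "A = (\<lambda>\<omega>. \<omega>) -` A \<inter> space M" using sets.sets_into_space that by blast
      then show "A \<in> {(\<lambda>\<omega>. \<omega>) -` A \<inter> space M | A. A \<in> sets S}" using A by blast
    next
      fix A assume "A \<in> {(\<lambda>\<omega>. \<omega>) -` A \<inter> space M | A. A \<in> sets S}"
      then obtain A' where A': "A = A' \<inter> space M" "A' \<in> sets S" by auto
      then have "A = A'" using sets.sets_into_space that by blast
      then show "A \<in> sets S" using A' by simp
    qed
    then show ?thesis using that sets.sigma_sets_eq[of S] by simp
  qed
  have "sets T \<subseteq> {?Y -` A \<inter> space M | A. A \<in> sets (PiM {k} (\<lambda>_. N))}"
  proof
    fix B assume "B \<in> sets T"
    then obtain A where A: "A \<in> sets N" "B = X k -` A \<inter> space M" by (auto simp: sets_T)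
    \<comment> \<open>The cylinder over A rewrites an event of \<open>X k\<close> as an event of the
      one-coordinate tuple.\<close>
    let ?C = "(\<lambda>f. f k) -` A \<inter> space (PiM {k} (\<lambda>_. N))"
    have "?C \<in> sets (PiM {k} (\<lambda>_. N))"
      using A by (intro measurable_sets[OF measurable_component_singleton]) auto
    moreover have "B = ?Y -` ?C \<inter> space M"
      unfolding A using measurable_space[OF rv[OF k(1)]] by (auto simp: space_PiM)
    ultimately show "B \<in> {?Y -` A \<inter> space M | A. A \<in> sets (PiM {k} (\<lambda>_. N))}" by blast
  qed
  then have subT: "sets T \<subseteq> sigma_sets (space M) {?Y -` A \<inter> space M | A. A \<in> sets (PiM {k} (\<lambda>_. N))}"
    by (auto intro: sigma_sets.Basic)
  have subF: "sets F \<subseteq> sigma_sets (space M) {?X -` A \<inter> space M | A. A \<in> sets (PiM J (\<lambda>_. N))}"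
    unfolding sets_F by (auto intro: sigma_sets.Basic)
  have "indep_set (sets F) (sets T)"
    using iv unfolding indep_var_eq indep_set_def
    by (elim conjE, intro indep_sets_mono_sets[where G = "case_bool (sets F) (sets T)"])
      (use subF subT in \<open>auto split: bool.splits\<close>)
  then show ?thesis
    using idF idT unfolding F_def[symmetric] T_def[symmetric] indep_var_eq
    by (simp only: gen space_FT simp_thms)
qed

section \<open>The ordered spectrum of a real symmetric matrix\<close>

text \<open>Vectors are functions on all naturals of which the first N values count; this type
  carries the product topology that supplies compactness.\<close>

definition dot :: "nat \<Rightarrow> (nat \<Rightarrow> real) \<Rightarrow> (nat \<Rightarrow> real) \<Rightarrow> real" where
  "dot N f g = (\<Sum>i<N. f i * g i)"

definition app :: "nat \<Rightarrow> (nat \<Rightarrow> nat \<Rightarrow> real) \<Rightarrow> (nat \<Rightarrow> real) \<Rightarrow> nat \<Rightarrow> real" where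
  "app N A f i = (\<Sum>j<N. A i j * f j)"

lemma dot_commute: "dot N f g = dot N g f"
  by (simp add: dot_def mult.commute)

lemma dot_cong: "(\<And>i. i < N \<Longrightarrow> f i = f' i) \<Longrightarrow> (\<And>i. i < N \<Longrightarrow> g i = g' i) \<Longrightarrow> dot N f g = dot N f' g'"
  by (auto simp: dot_def intro!: sum.cong)

lemma app_cong: "(\<And>i. i < N \<Longrightarrow> f i = f' i) \<Longrightarrow> app N A f = app N A f'"
  by (auto simp: app_def intro!: sum.cong ext)

lemma dot_smult: "dot N f (\<lambda>i. c * g i) = c * dot N f g" "dot N (\<lambda>i. c * f i) g = c * dot N f g"
  by (simp_all add: dot_def sum_distrib_left algebra_simps)

lemma dot_add: "dot N f (\<lambda>i. g i + h i) = dot N f g + dot N f h"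
    "dot N (\<lambda>i. g i + h i) f = dot N g f + dot N h f"
  by (simp_all add: dot_def sum.distrib algebra_simps)

lemma dot_diff: "dot N f (\<lambda>i. g i - h i) = dot N f g - dot N f h"
    "dot N (\<lambda>i. g i - h i) f = dot N g f - dot N h f"
  by (simp_all add: dot_def sum_subtractf algebra_simps)

lemma dot_self_nonneg: "0 \<le> dot N f f"
  by (auto simp: dot_def intro!: sum_nonneg)

lemma dot_self_eq_0_iff: "dot N f f = 0 \<longleftrightarrow> (\<forall>i<N. f i = 0)"
  unfolding dot_def by (subst sum_nonneg_eq_0_iff) auto

lemma app_smult: "app N A (\<lambda>i. c * f i) = (\<lambda>i. c * app N A f i)"
  by (simp add: app_def fun_eq_iff sum_distrib_left algebra_simps)

lemma app_add: "app N A (\<lambda>i. f i + g i) = (\<lambda>i. app N A f i + app N A g i)"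
  by (simp add: app_def fun_eq_iff sum.distrib algebra_simps)

lemma dot_app_symmetric:
  assumes "\<And>i j. i < N \<Longrightarrow> j < N \<Longrightarrow> A i j = A j i"
  shows "dot N f (app N A g) = dot N (app N A f) g"
proof -
  have "dot N f (app N A g) = (\<Sum>i<N. \<Sum>j<N. f i * (A i j * g j))"
    by (simp add: dot_def app_def sum_distrib_left)
  also have "\<dots> = (\<Sum>j<N. \<Sum>i<N. f i * (A i j * g j))" by (rule sum.swap)
  also have "\<dots> = (\<Sum>j<N. \<Sum>i<N. (A j i * f i) * g j)"
    using assms by (intro sum.cong refl) (auto simp: algebra_simps)
  finally show ?thesis by (simp add: dot_def app_def sum_distrib_right)
qed

lemma exists_orthogonal_vector:
  fixes vs :: "nat \<Rightarrow> nat \<Rightarrow> real"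
  assumes "k < N"
  shows "\<exists>f. (\<exists>i<N. f i \<noteq> 0) \<and> (\<forall>l<k. dot N (vs l) f = 0)"
proof -
  \<comment> \<open>Zero rows pad the k < N conditions to a square matrix. Row k is zero, so the
    matrix is singular, and any kernel vector meets the conditions.\<close>
  define A where "A = mat N N (\<lambda>(r, c). if r < k then vs r c else 0)"
  have A: "A \<in> carrier_mat N N" by (simp add: A_def)
  have "transpose_mat A *\<^sub>v unit_vec N k = 0\<^sub>v N"
  proof (rule eq_vecI)
    fix i assume i: "i < dim_vec (0\<^sub>v N :: real vec)"
    have "row (transpose_mat A) i \<bullet> unit_vec N k = A $$ (k, i)"
      using i assms by (simp add: A_def)
    then show "(transpose_mat A *\<^sub>v unit_vec N k) $ i = 0\<^sub>v N $ i"
      using i assms by (simp add: A_def)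
  qed (simp add: A_def)
  moreover have "unit_vec N k \<noteq> (0\<^sub>v N :: real vec)" using assms by simp
  ultimately have "det (transpose_mat A) = 0"
    using det_0_iff_vec_prod_zero_field[of "transpose_mat A" N] A
    by (auto intro!: exI[of _ "unit_vec N k"])
  then have "det A = 0" using det_transpose[OF A] by simp
  then obtain v where v: "v \<in> carrier_vec N" "v \<noteq> 0\<^sub>v N" "A *\<^sub>v v = 0\<^sub>v N"
    using det_0_iff_vec_prod_zero_field[OF A] by auto
  have "dot N (vs l) (\<lambda>i. v $ i) = 0" if "l < k" for l
  proof -
    have "(A *\<^sub>v v) $ l = dot N (vs l) (\<lambda>i. v $ i)"
      using that assms v(1) unfolding dot_def A_def
      by (auto simp: scalar_prod_def lessThan_atLeast0 intro!: sum.cong)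
    then show ?thesis using v(3) that assms by simp
  qed
  moreover have "\<exists>i<N. v $ i \<noteq> 0"
  proof (rule ccontr)
    assume "\<not> ?thesis"
    then have "v = 0\<^sub>v N" using v(1) by (intro eq_vecI) auto
    then show False using v(2) by simp
  qed
  ultimately show ?thesis by blast
qed

text \<open>Unit vectors have coordinates in [-1, 1], and the coordinates from N on are pinned at 0,
  so the set is closed inside a product of compact sets.\<close>

lemma compact_unit_sphere_orthogonal:
  fixes vs :: "nat \<Rightarrow> nat \<Rightarrow> real"
  shows "compact {f. (\<forall>i\<ge>N. f i = 0) \<and> dot N f f = 1 \<and> (\<forall>l<k. dot N (vs l) f = 0)}" (is "compact ?S")
proof -
  define K where "K = PiE UNIV (\<lambda>i::nat. if i < N then {-1..1} else {0::real})"
  have "compactin (product_topology (\<lambda>_. euclidean) UNIV) K"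
    unfolding K_def by (subst compactin_PiE) auto
  then have K: "compact K" by (simp add: euclidean_product_topology)
  have cont: "continuous_on UNIV (\<lambda>f. dot N (g f) (h f))"
    if "\<And>i. continuous_on UNIV (\<lambda>f. g f i)" "\<And>i. continuous_on UNIV (\<lambda>f. h f i)"
    for g h :: "(nat \<Rightarrow> real) \<Rightarrow> nat \<Rightarrow> real"
    unfolding dot_def using that by (intro continuous_intros)
  have cl: "closed {f :: nat \<Rightarrow> real. dot N f f = 1}" "closed {f. dot N (vs l) f = 0}" for l
    by (intro closed_Collect_eq cont continuous_intros continuous_on_product_coordinates)+
  have "closed ({f. dot N f f = 1} \<inter> (\<Inter>l\<in>{..<k}. {f. dot N (vs l) f = 0}))"
    by (intro closed_Int closed_INT cl ballI)
  then have "compact (K \<inter> ({f. dot N f f = 1} \<inter> (\<Inter>l\<in>{..<k}. {f. dot N (vs l) f = 0})))"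
    by (intro compact_Int_closed K)
  also have "K \<inter> ({f. dot N f f = 1} \<inter> (\<Inter>l\<in>{..<k}. {f. dot N (vs l) f = 0})) = ?S"
  proof -
    have "f \<in> K" if f: "\<forall>i\<ge>N. f i = 0" "dot N f f = 1" for f
    proof -
      have "f i \<in> {-1..1}" if "i < N" for i
      proof -
        have "f i * f i \<le> dot N f f" unfolding dot_def using that by (intro member_le_sum) auto
        then have "(f i)\<^sup>2 \<le> 1\<^sup>2" using f(2) by (simp add: power2_eq_square)
        then have "\<bar>f i\<bar> \<le> 1" by (metis abs_le_square_iff abs_one)
        then show ?thesis by auto
      qed
      then show ?thesis using f unfolding K_def by auto
    qed
    moreover have "\<forall>i\<ge>N. f i = 0" if "f \<in> K" for f
      using that unfolding K_def PiE_def Pi_def by (metis (mono_tags, lifting) CollectD IntD1 UNIV_I leD singletonD)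
    ultimately show ?thesis by blast
  qed
  finally show ?thesis .
qed

text \<open>The Rayleigh quotient attains its minimum on the complement by compactness of the sphere, and
  its first variation vanishes there.\<close>
lemma eigenvector_orthogonal_min:
  assumes sym: "\<And>i j. i < N \<Longrightarrow> j < N \<Longrightarrow> A i j = A j i" and k: "k < N"
    and eig: "\<And>l i. l < k \<Longrightarrow> i < N \<Longrightarrow> app N A (vs l) i = d l * vs l i"
  shows "\<exists>v \<mu>. dot N v v = 1 \<and> (\<forall>l<k. dot N (vs l) v = 0) \<and> (\<forall>i<N. app N A v i = \<mu> * v i) \<and>
    (\<forall>f. (\<forall>l<k. dot N (vs l) f = 0) \<longrightarrow> \<mu> * dot N f f \<le> dot N f (app N A f))"
proof -
  let ?S = "{f. (\<forall>i\<ge>N. f i = 0) \<and> dot N f f = 1 \<and> (\<forall>l<k. dot N (vs l) f = 0)}"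
  \<comment> \<open>Besides rescaling, this erases the coordinates from N on, as membership in
    \<open>?S\<close> demands.\<close>
  define nrm where "nrm f i = (if i < N then f i / sqrt (dot N f f) else 0)" for f :: "nat \<Rightarrow> real" and i
  have nrm: "nrm f \<in> ?S" "dot N f (app N A f) = dot N f f * dot N (nrm f) (app N A (nrm f))"
    if f: "dot N f f \<noteq> 0" "\<And>l. l < k \<Longrightarrow> dot N (vs l) f = 0" for f
  proof -
    define s where "s = 1 / sqrt (dot N f f)"
    have pos: "dot N f f > 0" using f(1) dot_self_nonneg[of N f] by linarith
    then have s2: "s * s * dot N f f = 1" by (simp add: s_def field_simps)
    have e: "nrm f i = s * f i" if "i < N" for i using that by (simp add: nrm_def s_def)
    have "dot N (nrm f) (nrm f) = s * s * dot N f f"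
      using dot_cong[of N "nrm f" "\<lambda>i. s * f i" "nrm f" "\<lambda>i. s * f i"] e by (simp add: dot_smult)
    moreover have "dot N (vs l) (nrm f) = s * dot N (vs l) f" for l
      using dot_cong[of N "vs l" "vs l" "nrm f" "\<lambda>i. s * f i"] e by (simp add: dot_smult)
    ultimately show "nrm f \<in> ?S" using s2 f(2) by (auto simp: nrm_def)
    have "app N A (nrm f) = (\<lambda>i. s * app N A f i)"
      using app_cong[of N "nrm f" "\<lambda>i. s * f i" A] e by (simp add: app_smult)
    then have "dot N (nrm f) (app N A (nrm f)) = s * s * dot N f (app N A f)"
      using dot_cong[of N "nrm f" "\<lambda>i. s * f i" "app N A (nrm f)" "app N A (nrm f)"] e
      by (simp add: dot_smult)
    then have "dot N f f * dot N (nrm f) (app N A (nrm f)) = (s * s * dot N f f) * dot N f (app N A f)"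
      by (simp add: algebra_simps)
    then show "dot N f (app N A f) = dot N f f * dot N (nrm f) (app N A (nrm f))" using s2 by simp
  qed
  obtain f0 where "\<exists>i<N. f0 i \<noteq> 0" "\<forall>l<k. dot N (vs l) f0 = 0"
    using exists_orthogonal_vector[OF k, of vs] by auto
  then have ne: "?S \<noteq> {}" using nrm(1)[of f0] dot_self_eq_0_iff[of N f0] by blast
  have "continuous_on ?S (\<lambda>f. dot N f (app N A f))"
    unfolding dot_def app_def
    by (intro continuous_intros continuous_on_subset[OF continuous_on_product_coordinates]) auto
  from continuous_attains_inf[OF compact_unit_sphere_orthogonal ne this]
  obtain v where v: "v \<in> ?S" and vmin: "\<And>f. f \<in> ?S \<Longrightarrow> dot N v (app N A v) \<le> dot N f (app N A f)"
    by auto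
  define \<mu> where "\<mu> = dot N v (app N A v)"
  have vv: "dot N v v = 1" and vo: "\<And>l. l < k \<Longrightarrow> dot N (vs l) v = 0" using v by auto
  have ray: "\<mu> * dot N f f \<le> dot N f (app N A f)" if "\<And>l. l < k \<Longrightarrow> dot N (vs l) f = 0" for f
  proof (cases "dot N f f = 0")
    case True
    then have "\<forall>i<N. f i = 0" by (simp add: dot_self_eq_0_iff)
    then have "dot N f (app N A f) = 0" by (simp add: dot_def)
    then show ?thesis using True by simp
  next
    case False
    have "\<mu> * dot N f f \<le> dot N (nrm f) (app N A (nrm f)) * dot N f f"
      unfolding \<mu>_def using nrm(1)[OF False that] dot_self_nonneg by (intro mult_right_mono vmin) auto
    then show ?thesis using nrm(2)[OF False that] by (simp add: algebra_simps)
  qed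
  \<comment> \<open>The residual of the eigenvalue equation is the direction of variation; by
    \<open>wo\<close> it respects the orthogonality constraints.\<close>
  define w where "w i = app N A v i - \<mu> * v i" for i
  have wo: "dot N (vs l) w = 0" if "l < k" for l
  proof -
    have "dot N (vs l) (app N A v) = dot N (app N A (vs l)) v" by (rule dot_app_symmetric[OF sym])
    also have "\<dots> = dot N (\<lambda>i. d l * vs l i) v" using eig that by (intro dot_cong) auto
    finally show ?thesis using vo that by (simp add: w_def[abs_def] dot_diff dot_smult)
  qed
  \<comment> \<open>Nonnegative on constrained vectors and zero at v, so its expansion along w
    cannot have a linear term.\<close>
  define \<phi> where "\<phi> f = dot N f (app N A f) - \<mu> * dot N f f" for f
  have \<phi>v: "\<phi> v = 0" by (simp add: \<phi>_def vv \<mu>_def)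
  have expand: "\<phi> (\<lambda>i. v i + s * w i) = 2 * s * dot N w w + s\<^sup>2 * \<phi> w" for s
  proof -
    have "dot N v (app N A w) = dot N w (app N A v)"
      by (subst dot_app_symmetric[OF sym]) (auto intro: dot_commute)
    moreover have "dot N w (app N A v) = dot N w w + \<mu> * dot N w v"
      by (simp add: w_def[abs_def] dot_diff dot_smult right_diff_distrib)
    ultimately have "\<phi> (\<lambda>i. v i + s * w i) = \<phi> v + 2 * s * dot N w w + s\<^sup>2 * \<phi> w"
      unfolding \<phi>_def dot_add dot_smult app_add app_smult dot_commute[of N v w]
      by (simp add: power2_eq_square algebra_simps)
    then show ?thesis using \<phi>v by simp
  qed
  have "dot N w w = 0"
  proof (rule ccontr)
    assume "dot N w w \<noteq> 0"
    then have a: "dot N w w > 0" using dot_self_nonneg[of N w] by linarith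
    define b where "b = \<bar>\<phi> w\<bar> + 1"
    \<comment> \<open>The minimizer of 2 s (w . w) + s^2 b, where b > 0 dominates the true quadratic
      coefficient; the minimum is negative.\<close>
    define s where "s = - (dot N w w / b)"
    have b: "b > 0" "\<phi> w \<le> b" by (auto simp: b_def)
    have "0 \<le> \<phi> (\<lambda>i. v i + s * w i)"
      using ray[of "\<lambda>i. v i + s * w i"] vo wo by (simp add: \<phi>_def dot_add dot_smult)
    also have "\<dots> \<le> 2 * s * dot N w w + s\<^sup>2 * b"
      unfolding expand using b by (intro add_left_mono mult_left_mono) auto
    also have "\<dots> = - (dot N w w)\<^sup>2 / b" using b by (simp add: s_def power2_eq_square field_simps)
    also have "\<dots> < 0" using a b by simp
    finally show False by simp
  qed
  then have "app N A v i = \<mu> * v i" if "i < N" for i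
    using that by (simp add: dot_self_eq_0_iff w_def)
  then show ?thesis using vv vo ray by (intro exI[of _ v] exI[of _ \<mu>]) auto
qed

text \<open>The first eigenpair is prescribed, so that for the Laplacian the basis can start with
  the constant vector, to which the zero-sum vectors are orthogonal. The last conclusion keeps the
  minimality of each eigenvalue, from which both their order and the Poincare inequality
  follow.\<close>

lemma orthonormal_eigenbasis:
  assumes sym: "\<And>i j. i < N \<Longrightarrow> j < N \<Longrightarrow> A i j = A j i" and N: "0 < N"
    and v0: "dot N v0 v0 = 1" "\<And>i. i < N \<Longrightarrow> app N A v0 i = \<mu>0 * v0 i"
      "\<And>f. \<mu>0 * dot N f f \<le> dot N f (app N A f)"
  shows "\<exists>vs d. vs 0 = v0 \<and> d 0 = \<mu>0 \<and>
    (\<forall>k<N. \<forall>l<N. dot N (vs k) (vs l) = (if k = l then 1 else 0)) \<and>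
    (\<forall>k<N. \<forall>i<N. app N A (vs k) i = d k * vs k i) \<and>
    (\<forall>k<N. \<forall>f. (\<forall>l<k. dot N (vs l) f = 0) \<longrightarrow> d k * dot N f f \<le> dot N f (app N A f))"
proof -
  have "\<exists>vs d. vs 0 = v0 \<and> d 0 = \<mu>0 \<and>
    (\<forall>k<m. \<forall>l<m. dot N (vs k) (vs l) = (if k = l then 1 else 0)) \<and>
    (\<forall>k<m. \<forall>i<N. app N A (vs k) i = d k * vs k i) \<and>
    (\<forall>k<m. \<forall>f. (\<forall>l<k. dot N (vs l) f = 0) \<longrightarrow> d k * dot N f f \<le> dot N f (app N A f))"
    if "Suc 0 \<le> m" "m \<le> N" for m
    using that
  proof (induction m rule: dec_induct)
    case base
    show ?case using v0 by (intro exI[of _ "\<lambda>_. v0"] exI[of _ "\<lambda>_. \<mu>0"]) auto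
  next
    case (step m)
    have "m \<le> N" using step.prems by simp
    from step.IH[OF this] obtain vs d where h: "vs 0 = v0" "d 0 = \<mu>0"
      "\<And>k l. k < m \<Longrightarrow> l < m \<Longrightarrow> dot N (vs k) (vs l) = (if k = l then 1 else 0)"
      "\<And>k i. k < m \<Longrightarrow> i < N \<Longrightarrow> app N A (vs k) i = d k * vs k i"
      "\<And>k f. k < m \<Longrightarrow> (\<forall>l<k. dot N (vs l) f = 0) \<Longrightarrow> d k * dot N f f \<le> dot N f (app N A f)"
      by (elim exE conjE) blast
    have "m < N" using step by simp
    have "\<exists>v \<mu>. dot N v v = 1 \<and> (\<forall>l<m. dot N (vs l) v = 0) \<and> (\<forall>i<N. app N A v i = \<mu> * v i) \<and>
        (\<forall>f. (\<forall>l<m. dot N (vs l) f = 0) \<longrightarrow> \<mu> * dot N f f \<le> dot N f (app N A f))"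
      by (rule eigenvector_orthogonal_min[where d = d]) (use sym \<open>m < N\<close> h(4) in auto)
    then obtain v \<mu> where v: "dot N v v = 1" "\<And>l. l < m \<Longrightarrow> dot N (vs l) v = 0"
      "\<And>i. i < N \<Longrightarrow> app N A v i = \<mu> * v i"
      "\<And>f. (\<forall>l<m. dot N (vs l) f = 0) \<Longrightarrow> \<mu> * dot N f f \<le> dot N f (app N A f)"
      by blast
    have v2: "dot N v (vs l) = 0" if "l < m" for l using v(2)[OF that] by (simp add: dot_commute)
    show ?case
    proof (intro exI[of _ "vs(m := v)"] exI[of _ "d(m := \<mu>)"] conjI allI impI)
      fix k f assume k: "k < Suc m" and f: "\<forall>l<k. dot N ((vs(m := v)) l) f = 0"
      have f': "\<forall>l<k. dot N (vs l) f = 0"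
      proof (intro allI impI)
        fix l assume "l < k" then show "dot N (vs l) f = 0" using f[rule_format, of l] k by simp
      qed
      show "(d(m := \<mu>)) k * dot N f f \<le> dot N f (app N A f)"
        using h(5)[of k f] v(4)[of f] f' k by (cases "k = m") auto
    qed (use step h v v2 in \<open>auto simp: less_Suc_eq\<close>)
  qed
  from this[of N] N show ?thesis by simp
qed

text \<open>Makes the description in \<open>sorted_eigs\<close> definite: common linear factors are
  cancelled root by root, and sortedness fixes the order.\<close>

lemma sorted_linear_factors_unique:
  fixes ls ls' :: "real list"
  assumes "sorted ls" "sorted ls'"
    and "prod_list (map (\<lambda>a. [:- a, 1:]) ls) = prod_list (map (\<lambda>a. [:- a, 1:]) ls')"
  shows "ls = ls'"
proof -
  have root: "poly (prod_list (map (\<lambda>a. [:- a, 1:]) xs)) y = 0 \<longleftrightarrow> y \<in> set xs" for xs and y :: real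
    by (induction xs) auto
  have "mset ls = mset ls'" using assms(3)
  proof (induction ls arbitrary: ls')
    case Nil
    then show ?case using root[of ls' "hd ls'"] root[of "[]" "hd ls'"] by (cases ls') (simp_all del: mult_pCons_left)
  next
    case (Cons a ls)
    have "a \<in> set ls'" using root[of ls' a] root[of "a # ls" a] Cons.prems by (metis list.set_intros(1))
    then have e: "prod_list (map (\<lambda>a. [:- a, 1:]) ls') = [:- a, 1:] * prod_list (map (\<lambda>a. [:- a, 1:]) (remove1 a ls'))"
      by (simp only: prod_list_map_remove1)
    have "prod_list (map (\<lambda>a. [:- a, 1:]) ls) = prod_list (map (\<lambda>a. [:- a, 1:]) (remove1 a ls'))"
      using Cons.prems unfolding e by (simp del: mult_pCons_left)
    then have "mset ls = mset (remove1 a ls')" by (rule Cons.IH)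
    then show ?case using \<open>a \<in> set ls'\<close> by simp
  qed
  then show ?thesis using assms(1,2) by (metis properties_for_sort)
qed

lemma sorted_eigs_eqI:
  assumes "sorted ls" "char_poly L = prod_list (map (\<lambda>a. [:- a, 1:]) ls)"
  shows "sorted_eigs L = ls"
  unfolding sorted_eigs_def using assms sorted_linear_factors_unique by (intro the_equality) auto

text \<open>Connects the variational with the algebraic spectrum: the basis forms an orthogonal
  matrix P that conjugates A into the diagonal D, and similar matrices share their characteristic
  polynomial.\<close>

lemma sorted_eigs_orthonormal_eigenbasis:
  assumes orth: "\<And>k l. k < N \<Longrightarrow> l < N \<Longrightarrow> dot N (vs k) (vs l) = (if k = l then 1 else 0)"
    and eig: "\<And>k i. k < N \<Longrightarrow> i < N \<Longrightarrow> app N A (vs k) i = d k * vs k i"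
    and mono: "\<And>k l. k \<le> l \<Longrightarrow> l < N \<Longrightarrow> d k \<le> d l"
  shows "sorted_eigs (mat N N (\<lambda>(i, j). A i j)) = map d [0..<N]"
proof (rule sorted_eigs_eqI)
  show "sorted (map d [0..<N])" using mono by (auto simp: sorted_iff_nth_mono)
  define L where "L = mat N N (\<lambda>(i, j). A i j)"
  define P where "P = mat N N (\<lambda>(i, j). vs j i)"
  define D where "D = mat N N (\<lambda>(i, j). if i = j then d i else 0)"
  have c: "L \<in> carrier_mat N N" "P \<in> carrier_mat N N" "D \<in> carrier_mat N N"
    "transpose_mat P \<in> carrier_mat N N"
    by (auto simp: L_def P_def D_def)
  have PtP: "transpose_mat P * P = 1\<^sub>m N"
  proof (rule eq_matI)
    fix i j assume "i < dim_row (1\<^sub>m N :: real mat)" "j < dim_col (1\<^sub>m N :: real mat)"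
    then show "(transpose_mat P * P) $$ (i, j) = 1\<^sub>m N $$ (i, j)"
      using orth[of i j] unfolding dot_def P_def
      by (simp add: scalar_prod_def lessThan_atLeast0)
  qed (auto simp: P_def)
  then have PPt: "P * transpose_mat P = 1\<^sub>m N" by (rule mat_mult_left_right_inverse[OF c(4,2)])
  have LP: "L * P = P * D"
  proof (rule eq_matI)
    fix i j assume "i < dim_row (P * D)" "j < dim_col (P * D)"
    then have ij: "i < N" "j < N" by (auto simp: P_def D_def)
    have "(L * P) $$ (i, j) = app N A (vs j) i"
      using ij unfolding L_def P_def app_def by (simp add: scalar_prod_def lessThan_atLeast0)
    moreover have "(P * D) $$ (i, j) = (\<Sum>k<N. if k = j then vs k i * d k else 0)"
      using ij unfolding P_def D_def
      by (simp add: scalar_prod_def lessThan_atLeast0 if_distrib[of "\<lambda>y. _ * y"] cong: if_cong)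
    ultimately show "(L * P) $$ (i, j) = (P * D) $$ (i, j)"
      using ij eig[of j i] by (simp add: mult.commute)
  qed (auto simp: L_def P_def D_def)
  have "L = L * (P * transpose_mat P)" unfolding PPt using c by simp
  also have "\<dots> = L * P * transpose_mat P" using c by (intro assoc_mult_mat[symmetric]) auto
  also have "\<dots> = P * D * transpose_mat P" unfolding LP ..
  finally have "similar_mat_wit L D P (transpose_mat P)"
    using c PPt PtP by (intro similar_mat_witI[of _ _ N]) auto
  then have "char_poly L = char_poly D" by (intro char_poly_similar) (auto simp: similar_mat_def)
  also have "\<dots> = prod_list (map (\<lambda>a. [:- a, 1:]) (diag_mat D))"
    by (rule char_poly_upper_triangular[OF c(3)]) (auto simp: D_def upper_triangular_def)
  also have "diag_mat D = map d [0..<N]" by (auto simp: diag_mat_def D_def)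
  finally show "char_poly (mat N N (\<lambda>(i, j). A i j)) = prod_list (map (\<lambda>a. [:- a, 1:]) (map d [0..<N]))"
    by (simp add: L_def)
qed

section \<open>The graph Laplacian\<close>

definition neighbors :: "nat \<Rightarrow> (nat \<Rightarrow> nat \<Rightarrow> bool) \<Rightarrow> nat \<Rightarrow> nat set" where
  "neighbors N E i = {j. j < N \<and> E i j}"

definition edges :: "(nat \<Rightarrow> nat \<Rightarrow> bool) \<Rightarrow> (nat \<times> nat) set" where
  "edges E = {(i, j). E i j}"

definition lap :: "nat \<Rightarrow> (nat \<Rightarrow> nat \<Rightarrow> bool) \<Rightarrow> nat \<Rightarrow> nat \<Rightarrow> real" where
  "lap N E i j = (if i = j then real (deg N E i) else if E i j then -1 else 0)"

lemma laplacian_eq: "laplacian N E = mat N N (\<lambda>(i, j). lap N E i j)"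
  by (simp add: laplacian_def lap_def)

lemma finite_neighbors [simp]: "finite (neighbors N E i)"
  by (simp add: neighbors_def)

context
  fixes N :: nat and E :: "nat \<Rightarrow> nat \<Rightarrow> bool"
  assumes graph: "graph_ok N E"
begin

lemma edge_sym: "E i j \<Longrightarrow> E j i" and edge_less: "E i j \<Longrightarrow> i < N" "E i j \<Longrightarrow> j < N"
  and edge_irrefl: "\<not> E i i"
  using graph by (auto simp: graph_ok_def)

lemma edges_eq_Sigma: "edges E = (SIGMA i:{..<N}. neighbors N E i)"
  using edge_less by (auto simp: edges_def neighbors_def)

lemma finite_edges: "finite (edges E)"
  unfolding edges_eq_Sigma by auto

lemma sum_edges: "(\<Sum>(i, j)\<in>edges E. g i j) = (\<Sum>i<N. \<Sum>j\<in>neighbors N E i. g i j)"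
  unfolding edges_eq_Sigma by (subst sum.Sigma) auto

lemma sum_edges_swap: "(\<Sum>(i, j)\<in>edges E. g i j) = (\<Sum>(i, j)\<in>edges E. g j i)"
  by (rule sum.reindex_bij_witness[of _ "\<lambda>(i, j). (j, i)" "\<lambda>(i, j). (j, i)"])
    (auto simp: edges_def intro: edge_sym)

lemma app_lap:
  assumes "i < N"
  shows "app N (lap N E) f i = (\<Sum>j\<in>neighbors N E i. f i - f j)"
proof -
  have "app N (lap N E) f i = (\<Sum>j<N. (if j = i then real (deg N E i) * f j else 0) + (if E i j then - f j else 0))"
    unfolding app_def lap_def using edge_irrefl by (intro sum.cong) auto
  also have "\<dots> = real (deg N E i) * f i + (\<Sum>j<N. if E i j then - f j else 0)"
    using assms by (simp add: sum.distrib)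
  also have "(\<Sum>j<N. if E i j then - f j else 0) = (\<Sum>j\<in>neighbors N E i. - f j)"
    unfolding neighbors_def by (simp add: sum.If_cases Int_def conj_commute)
  finally show ?thesis by (simp add: sum_subtractf sum_negf deg_def neighbors_def)
qed

text \<open>The factor 2 arises because \<open>edges\<close> consists of ordered pairs and counts
  every undirected edge twice.\<close>

lemma dot_app_lap: "2 * dot N f (app N (lap N E) f) = (\<Sum>(i, j)\<in>edges E. (f i - f j)\<^sup>2)"
proof -
  have e: "dot N f (app N (lap N E) f) = (\<Sum>(i, j)\<in>edges E. f i * (f i - f j))"
    unfolding sum_edges dot_def by (intro sum.cong) (auto simp: app_lap sum_distrib_left)
  have "2 * dot N f (app N (lap N E) f)
      = (\<Sum>(i, j)\<in>edges E. f i * (f i - f j)) + (\<Sum>(i, j)\<in>edges E. f j * (f j - f i))"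
    using e sum_edges_swap[of "\<lambda>i j. f i * (f i - f j)"] by simp
  also have "\<dots> = (\<Sum>(i, j)\<in>edges E. (f i - f j)\<^sup>2)"
    unfolding sum.distrib[symmetric]
    by (intro sum.cong) (auto simp: power2_eq_square algebra_simps)
  finally show ?thesis .
qed

lemma lap_psd: "0 \<le> dot N f (app N (lap N E) f)"
proof -
  have "0 \<le> (\<Sum>(i, j)\<in>edges E. (f i - f j)\<^sup>2)" by (intro sum_nonneg) auto
  then show ?thesis using dot_app_lap[of f] by linarith
qed

text \<open>Zero energy forces equal values across each edge, and connectedness carries the equality
  along paths.\<close>

lemma lap_kernel:
  assumes conn: "connected_graph N E" and "dot N f (app N (lap N E) f) = 0" "i < N" "j < N"
  shows "f i = f j"
proof -
  have "(\<Sum>(i, j)\<in>edges E. (f i - f j)\<^sup>2) = 0" using dot_app_lap[of f] assms by simp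
  then have *: "f i = f j" if "E i j" for i j
    using that finite_edges by (subst (asm) sum_nonneg_eq_0_iff) (auto simp: edges_def)
  have "E\<^sup>*\<^sup>* i j" using conn assms by (simp add: connected_graph_def)
  then show ?thesis by (induction rule: rtranclp_induct) (auto simp: *)
qed

lemma lambda2_facts:
  assumes conn: "connected_graph N E" and N2: "N \<ge> 2"
  shows "0 < lambda2 N E"
    and "(\<Sum>i<N. f i) = 0 \<Longrightarrow> lambda2 N E * dot N f f \<le> dot N f (app N (lap N E) f)"
proof -
  \<comment> \<open>The normalized constant vector, an eigenvector for 0; being orthogonal to it
    means having zero sum.\<close>
  define v0 :: "nat \<Rightarrow> real" where "v0 = (\<lambda>_. 1 / sqrt (real N))"
  have sym: "lap N E i j = lap N E j i" for i j
    using edge_sym by (auto simp: lap_def)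
  have 1: "dot N v0 v0 = 1" using N2 by (simp add: v0_def dot_def)
  have 2: "app N (lap N E) v0 i = 0 * v0 i" if "i < N" for i
    using that by (simp add: app_lap v0_def)
  have 3: "0 * dot N f f \<le> dot N f (app N (lap N E) f)" for f using lap_psd by simp
  have N0: "0 < N" using N2 by simp
  have "\<exists>vs d. vs 0 = v0 \<and> d 0 = 0 \<and>
    (\<forall>k<N. \<forall>l<N. dot N (vs k) (vs l) = (if k = l then 1 else 0)) \<and>
    (\<forall>k<N. \<forall>i<N. app N (lap N E) (vs k) i = d k * vs k i) \<and>
    (\<forall>k<N. \<forall>f. (\<forall>l<k. dot N (vs l) f = 0) \<longrightarrow> d k * dot N f f \<le> dot N f (app N (lap N E) f))"
    by (rule orthonormal_eigenbasis) (use sym N0 1 2 3 in auto)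
  then obtain vs d where b: "vs 0 = v0" "d 0 = 0"
    "\<And>k l. k < N \<Longrightarrow> l < N \<Longrightarrow> dot N (vs k) (vs l) = (if k = l then 1 else 0)"
    "\<And>k i. k < N \<Longrightarrow> i < N \<Longrightarrow> app N (lap N E) (vs k) i = d k * vs k i"
    "\<And>k f. k < N \<Longrightarrow> (\<forall>l<k. dot N (vs l) f = 0) \<Longrightarrow> d k * dot N f f \<le> dot N f (app N (lap N E) f)"
    by (elim exE conjE) blast
  have q: "dot N (vs k) (app N (lap N E) (vs k)) = d k" if "k < N" for k
  proof -
    have "dot N (vs k) (app N (lap N E) (vs k)) = dot N (vs k) (\<lambda>i. d k * vs k i)"
      using b(4) that by (intro dot_cong) auto
    then show ?thesis using b(3)[OF that that] by (simp add: dot_smult)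
  qed
  have "d k \<le> d l" if "k \<le> l" "l < N" for k l
  proof -
    have "d k * dot N (vs l) (vs l) \<le> dot N (vs l) (app N (lap N E) (vs l))"
      using that b(3) by (intro b(5)) auto
    then show ?thesis using q that b(3)[of l l] by simp
  qed
  then have "sorted_eigs (laplacian N E) = map d [0..<N]"
    unfolding laplacian_eq by (intro sorted_eigs_orthonormal_eigenbasis[OF b(3,4)]) auto
  then have l2: "lambda2 N E = d 1" using N2 by (simp add: lambda2_def)
  show "lambda2 N E * dot N f f \<le> dot N f (app N (lap N E) f)" if "(\<Sum>i<N. f i) = 0" for f
  proof -
    have "dot N v0 f = (1 / sqrt (real N)) * (\<Sum>i<N. f i)"
      unfolding dot_def v0_def by (rule sum_distrib_left[symmetric])
    then have "dot N (vs l) f = 0" if "l < 1" for l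
      using that b(1) \<open>(\<Sum>i<N. f i) = 0\<close> by simp
    then show ?thesis unfolding l2 using N2 by (intro b(5)) auto
  qed
  show "0 < lambda2 N E"
  proof (rule ccontr)
    \<comment> \<open>Then the second eigenvector has zero energy and is constant by connectedness;
      being orthogonal to the constant vector, it vanishes.\<close>
    assume "\<not> 0 < lambda2 N E"
    then have "dot N (vs 1) (app N (lap N E) (vs 1)) = 0"
      using q[of 1] N2 lap_psd[of "vs 1"] l2 by simp
    then obtain k where const: "\<And>i. i < N \<Longrightarrow> vs 1 i = k"
      using lap_kernel[OF conn _ _ N0] by blast
    have "dot N (vs 1) v0 = dot N (\<lambda>_. k) v0" using const by (intro dot_cong) auto
    moreover have "dot N (vs 1) v0 = 0" using b(1) b(3)[of 1 0] N2 by simp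
    ultimately have "k = 0" using N0 by (simp add: dot_def v0_def)
    then have "dot N (vs 1) (vs 1) = 0" using const by (simp add: dot_self_eq_0_iff)
    then show False using b(3)[of 1 1] N2 by simp
  qed
qed

end

section \<open>Spectral norms of the incidence matrices\<close>

lemma enorm_nonneg: "0 \<le> enorm v"
  by (auto simp: enorm_def scalar_prod_def intro!: sum_nonneg)

lemma enorm_square: "(enorm v)\<^sup>2 = (\<Sum>i<dim_vec v. (v $ i)\<^sup>2)"
  unfolding enorm_def
  by (subst real_sqrt_pow2)
    (auto simp: scalar_prod_def power2_eq_square lessThan_atLeast0 intro!: sum_nonneg)

lemma enorm_eq_sqrt: "enorm v = sqrt (\<Sum>i<dim_vec v. (v $ i)\<^sup>2)"
  using enorm_square[of v] enorm_nonneg[of v] by (simp add: real_sqrt_unique)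

lemma enorm_smult: "enorm (c \<cdot>\<^sub>v v) = \<bar>c\<bar> * enorm v"
  unfolding enorm_eq_sqrt
  by (simp add: power_mult_distrib sum_distrib_left[symmetric] real_sqrt_mult)

lemma scalar_prod_le_enorm:
  assumes "dim_vec v = dim_vec w"
  shows "\<bar>v \<bullet> w\<bar> \<le> enorm v * enorm w"
proof -
  have "v \<bullet> w = (\<Sum>i<dim_vec w. v $ i * w $ i)" by (simp add: scalar_prod_def lessThan_atLeast0)
  then have "(v \<bullet> w)\<^sup>2 \<le> (\<Sum>i<dim_vec w. (v $ i)\<^sup>2) * (\<Sum>i<dim_vec w. (w $ i)\<^sup>2)"
    using Cauchy_Schwarz_ineq_sum by metis
  also have "\<dots> = (enorm v * enorm w)\<^sup>2" using assms by (simp add: power_mult_distrib enorm_square)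
  finally show ?thesis
    using enorm_nonneg[of v] enorm_nonneg[of w]
    by (metis abs_le_square_iff abs_mult abs_of_nonneg)
qed

text \<open>The supremum defining \<open>spec_norm\<close> is informative only for a bounded set;
  Cauchy-Schwarz in each row bounds it by the Frobenius norm.\<close>

lemma spec_norm_bdd:
  fixes A :: "real mat"
  shows "bdd_above {enorm (A *\<^sub>v v) | v. v \<in> carrier_vec (dim_col A) \<and> enorm v \<le> 1}"
proof (rule bdd_aboveI)
  fix y assume "y \<in> {enorm (A *\<^sub>v v) | v. v \<in> carrier_vec (dim_col A) \<and> enorm v \<le> 1}"
  then obtain v where v: "y = enorm (A *\<^sub>v v)" "v \<in> carrier_vec (dim_col A)" "enorm v \<le> 1" by auto
  have "((A *\<^sub>v v) $ i)\<^sup>2 \<le> (enorm (row A i))\<^sup>2" if "i < dim_row A" for i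
  proof -
    have "\<bar>row A i \<bullet> v\<bar> \<le> enorm (row A i) * enorm v" using v by (intro scalar_prod_le_enorm) auto
    also have "\<dots> \<le> enorm (row A i) * 1" using v enorm_nonneg by (intro mult_left_mono)
    finally have "\<bar>row A i \<bullet> v\<bar> \<le> \<bar>enorm (row A i)\<bar>" by simp
    then have "(row A i \<bullet> v)\<^sup>2 \<le> (enorm (row A i))\<^sup>2" by (simp only: abs_le_square_iff)
    then show ?thesis using that by simp
  qed
  then show "y \<le> sqrt (\<Sum>i<dim_row A. (enorm (row A i))\<^sup>2)"
    unfolding v(1) enorm_eq_sqrt[of "A *\<^sub>v v"] by (auto intro!: sum_mono)
qed

lemma spec_norm_nonneg: "0 \<le> spec_norm A"
proof -
  have "enorm (A *\<^sub>v 0\<^sub>v (dim_col A)) \<le> spec_norm A"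
    unfolding spec_norm_def
    by (intro cSup_upper spec_norm_bdd CollectI exI[of _ "0\<^sub>v (dim_col A)"]) (auto simp: enorm_def)
  then show ?thesis using enorm_nonneg order_trans by blast
qed

lemma enorm_mult_mat_vec_le:
  assumes v: "v \<in> carrier_vec (dim_col A)"
  shows "enorm (A *\<^sub>v v) \<le> spec_norm A * enorm v"
proof (cases "enorm v = 0")
  case True
  have "enorm (A *\<^sub>v v) = 0"
  proof -
    have "(\<Sum>i<dim_vec v. (v $ i)\<^sup>2) = 0" using enorm_square[of v] True by simp
    then have "v = 0\<^sub>v (dim_col A)" using v
      by (subst (asm) sum_nonneg_eq_0_iff) (auto intro!: eq_vecI)
    then have "A *\<^sub>v v = 0\<^sub>v (dim_row A)" by (intro eq_vecI) auto
    then show ?thesis by (simp add: enorm_def)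
  qed
  then show ?thesis using True by simp
next
  case False
  then have pos: "enorm v > 0" using enorm_nonneg[of v] by linarith
  let ?u = "(1 / enorm v) \<cdot>\<^sub>v v"
  have "enorm (A *\<^sub>v ?u) \<le> spec_norm A"
    unfolding spec_norm_def using v pos
    by (intro cSup_upper spec_norm_bdd CollectI exI[of _ ?u]) (auto simp: enorm_smult)
  moreover have "A *\<^sub>v ?u = (1 / enorm v) \<cdot>\<^sub>v (A *\<^sub>v v)"
    using v by (intro mult_mat_vec[of _ "dim_row A" "dim_col A"]) auto
  ultimately show ?thesis using pos by (simp add: enorm_smult field_simps)
qed

context
  fixes N :: nat and E :: "nat \<Rightarrow> nat \<Rightarrow> bool"
  assumes graph: "graph_ok N E"
begin

lemma set_pairs: "set (pairs N E) = edges E"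
  using edge_less[OF graph] by (auto simp: pairs_def edges_def)

lemma distinct_pairs: "distinct (pairs N E)"
proof -
  have "distinct (concat (map (\<lambda>i. map (Pair i) (filter (E i) [0..<N])) is))" if "distinct is" for "is"
    using that by (induction "is") (auto simp: distinct_map inj_on_def)
  moreover have "pairs N E = concat (map (\<lambda>i. map (Pair i) (filter (E i) [0..<N])) [0..<N])"
  proof -
    have "concat (map (\<lambda>j. if E i j then [(i, j)] else []) js) = map (Pair i) (filter (E i) js)" for i js
      by (induction js) auto
    then show ?thesis unfolding pairs_def by simp
  qed
  ultimately show ?thesis by simp
qed

lemma sum_pairs: "(\<Sum>p<length (pairs N E). g (pairs N E ! p)) = (\<Sum>e\<in>edges E. g e)"
  using sum.reindex_bij_betw[OF bij_betw_nth[OF distinct_pairs refl set_pairs[symmetric]], of g] by simp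

text \<open>Lists a function on ordered edges in the order of \<open>pairs\<close>, so that
  \<open>Wmat\<close> and \<open>Qmat\<close> can be read as operations on edges.\<close>

definition evec :: "(nat \<Rightarrow> nat \<Rightarrow> real) \<Rightarrow> real vec" where
  "evec e = vec (length (pairs N E)) (\<lambda>p. e (fst (pairs N E ! p)) (snd (pairs N E ! p)))"

lemma evec_carrier [simp]: "evec e \<in> carrier_vec (length (pairs N E))" "dim_vec (evec e) = length (pairs N E)"
  by (auto simp: evec_def)

lemma enorm_evec: "enorm (evec e) = sqrt (\<Sum>(i, j)\<in>edges E. (e i j)\<^sup>2)"
  unfolding enorm_eq_sqrt using sum_pairs[of "\<lambda>(i, j). (e i j)\<^sup>2"]
  by (simp add: evec_def case_prod_beta)

lemma enorm_vec: "enorm (vec N f) = sqrt (dot N f f)"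
  unfolding enorm_eq_sqrt by (simp add: dot_def power2_eq_square)

lemma Wmat_evec: "Wmat N E *\<^sub>v evec e = vec N (\<lambda>i. \<Sum>j\<in>neighbors N E i. e i j)"
proof (rule eq_vecI)
  fix i assume i: "i < dim_vec (vec N (\<lambda>i. \<Sum>j\<in>neighbors N E i. e i j))"
  have "(Wmat N E *\<^sub>v evec e) $ i =
      (\<Sum>p<length (pairs N E). (\<lambda>(k, j). if k = i then e k j else 0) (pairs N E ! p))"
    using i by (auto simp: Wmat_def evec_def scalar_prod_def lessThan_atLeast0 case_prod_beta intro!: sum.cong)
  also have "\<dots> = (\<Sum>k<N. \<Sum>j\<in>neighbors N E k. if k = i then e k j else 0)"
    unfolding sum_pairs by (rule sum_edges[OF graph])
  also have "\<dots> = (\<Sum>k<N. if k = i then \<Sum>j\<in>neighbors N E k. e k j else 0)"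
    by (intro sum.cong) auto
  also have "\<dots> = (\<Sum>j\<in>neighbors N E i. e i j)" using i by simp
  finally show "(Wmat N E *\<^sub>v evec e) $ i = vec N (\<lambda>i. \<Sum>j\<in>neighbors N E i. e i j) $ i" using i by simp
qed (simp add: Wmat_def)

lemma Qmat_vec: "Qmat N E *\<^sub>v vec N f = evec (\<lambda>i j. f j)"
proof (rule eq_vecI)
  fix p assume p: "p < dim_vec (evec (\<lambda>i j. f j))"
  then have "pairs N E ! p \<in> edges E" using set_pairs by (metis nth_mem evec_carrier(2))
  then have s: "snd (pairs N E ! p) < N" using edge_less(2)[OF graph] by (auto simp: edges_def)
  have "(Qmat N E *\<^sub>v vec N f) $ p = (\<Sum>k<N. if k = snd (pairs N E ! p) then f k else 0)"
    using p s by (simp add: Qmat_def scalar_prod_def lessThan_atLeast0 if_distrib[of "\<lambda>y. y * _"] cong: if_cong)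
  then show "(Qmat N E *\<^sub>v vec N f) $ p = evec (\<lambda>i j. f j) $ p" using p s by (simp add: evec_def)
qed (simp add: Qmat_def evec_def)

lemma laplacian_vec: "laplacian N E *\<^sub>v vec N f = vec N (app N (lap N E) f)"
  unfolding laplacian_eq app_def
  by (intro eq_vecI) (auto simp: scalar_prod_def lessThan_atLeast0)

lemma incidence_carriers [simp]:
  "Wmat N E \<in> carrier_mat N (length (pairs N E))" "Qmat N E \<in> carrier_mat (length (pairs N E)) N"
  "laplacian N E \<in> carrier_mat N N" "JNmat N \<in> carrier_mat N N"
  by (auto simp: Wmat_def Qmat_def laplacian_def JNmat_def)

text \<open>A zero-sum f does not see the mean of the vertex sums, so the mean may be removed before
  the norm is taken; this is how \<open>JNmat\<close> enters \<open>lambda_G\<close>.\<close>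

lemma JW_bound:
  assumes "(\<Sum>i<N. f i) = 0" "N > 0"
  shows "\<bar>\<Sum>i<N. f i * (\<Sum>j\<in>neighbors N E i. e i j)\<bar>
    \<le> spec_norm (JNmat N * Wmat N E) * (sqrt (dot N f f) * sqrt (\<Sum>(i, j)\<in>edges E. (e i j)\<^sup>2))"
proof -
  define w where "w i = (\<Sum>j\<in>neighbors N E i. e i j)" for i
  define m where "m = (\<Sum>i<N. w i) / real N"
  have "JNmat N *\<^sub>v vec N w = vec N (\<lambda>i. w i - m)"
  proof (rule eq_vecI)
    fix i assume i: "i < dim_vec (vec N (\<lambda>i. w i - m))"
    have "(JNmat N *\<^sub>v vec N w) $ i = (\<Sum>j<N. (if j = i then w j else 0) - w j / real N)"
      using i by (auto simp: JNmat_def scalar_prod_def lessThan_atLeast0 algebra_simps intro!: sum.cong)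
    also have "\<dots> = w i - m" using i by (simp add: sum_subtractf m_def sum_divide_distrib)
    finally show "(JNmat N *\<^sub>v vec N w) $ i = vec N (\<lambda>i. w i - m) $ i" using i by simp
  qed (simp add: JNmat_def)
  then have JW: "(JNmat N * Wmat N E) *\<^sub>v evec e = vec N (\<lambda>i. w i - m)"
    using assoc_mult_mat_vec[of "JNmat N" N N "Wmat N E" "length (pairs N E)" "evec e"] Wmat_evec[of e]
    by (simp add: w_def[abs_def])
  have "(\<Sum>i<N. f i * w i) = (\<Sum>i<N. f i * (w i - m)) + m * (\<Sum>i<N. f i)"
    by (simp add: sum_distrib_left sum.distrib[symmetric] algebra_simps)
  also have "\<dots> = vec N f \<bullet> ((JNmat N * Wmat N E) *\<^sub>v evec e)"
    unfolding JW using assms by (simp add: scalar_prod_def lessThan_atLeast0)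
  finally have "\<bar>\<Sum>i<N. f i * w i\<bar> \<le> enorm (vec N f) * enorm ((JNmat N * Wmat N E) *\<^sub>v evec e)"
    by (simp add: scalar_prod_le_enorm JW)
  also have "\<dots> \<le> enorm (vec N f) * (spec_norm (JNmat N * Wmat N E) * enorm (evec e))"
    by (intro mult_left_mono enorm_mult_mat_vec_le enorm_nonneg) (auto simp: Wmat_def)
  finally show ?thesis unfolding w_def enorm_vec enorm_evec by (simp add: algebra_simps)
qed

lemma scalar_prod_evec: "evec e \<bullet> evec g = (\<Sum>(i, j)\<in>edges E. e i j * g i j)"
  using sum_pairs[of "\<lambda>(i, j). e i j * g i j"]
  by (simp add: evec_def scalar_prod_def lessThan_atLeast0 case_prod_beta)

text \<open>The errors held by j move the compressed state that i is estimating, so the error on (i,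
  j) meets the errors on (j, k). This pairing is the quadratic form of Q W.\<close>

lemma QW_bound:
  "\<bar>\<Sum>(i, j)\<in>edges E. e i j * (\<Sum>k\<in>neighbors N E j. e j k)\<bar>
    \<le> spec_norm (Qmat N E * Wmat N E) * (\<Sum>(i, j)\<in>edges E. (e i j)\<^sup>2)"
proof -
  define S where "S = (\<Sum>(i, j)\<in>edges E. (e i j)\<^sup>2)"
  have S: "sqrt S * sqrt S = S" unfolding S_def by (intro real_sqrt_mult_self[THEN trans] abs_of_nonneg sum_nonneg) auto
  have QW: "(Qmat N E * Wmat N E) *\<^sub>v evec e = evec (\<lambda>i j. \<Sum>k\<in>neighbors N E j. e j k)"
    using assoc_mult_mat_vec[of "Qmat N E" "length (pairs N E)" N "Wmat N E" "length (pairs N E)" "evec e"]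
    by (simp add: Wmat_evec Qmat_vec)
  have "\<bar>evec e \<bullet> evec (\<lambda>i j. \<Sum>k\<in>neighbors N E j. e j k)\<bar> \<le> enorm (evec e) * enorm ((Qmat N E * Wmat N E) *\<^sub>v evec e)"
    unfolding QW by (intro scalar_prod_le_enorm) simp
  also have "\<dots> \<le> enorm (evec e) * (spec_norm (Qmat N E * Wmat N E) * enorm (evec e))"
    by (intro mult_left_mono enorm_mult_mat_vec_le enorm_nonneg) (auto simp: Wmat_def)
  also have "\<dots> = spec_norm (Qmat N E * Wmat N E) * (sqrt S * sqrt S)"
    unfolding enorm_evec S_def[symmetric] by (simp only: ac_simps)
  also have "sqrt S * sqrt S = S" by (rule S)
  finally show ?thesis unfolding scalar_prod_evec S_def .
qed

lemma QL_bound: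
  "\<bar>\<Sum>(i, j)\<in>edges E. e i j * app N (lap N E) f j\<bar>
    \<le> spec_norm (Qmat N E * laplacian N E) * (sqrt (dot N f f) * sqrt (\<Sum>(i, j)\<in>edges E. (e i j)\<^sup>2))"
proof -
  have QL: "(Qmat N E * laplacian N E) *\<^sub>v vec N f = evec (\<lambda>i j. app N (lap N E) f j)"
    using assoc_mult_mat_vec[of "Qmat N E" "length (pairs N E)" N "laplacian N E" N "vec N f"]
    by (simp add: laplacian_vec Qmat_vec)
  have "\<bar>evec e \<bullet> evec (\<lambda>i j. app N (lap N E) f j)\<bar> \<le> enorm (evec e) * enorm ((Qmat N E * laplacian N E) *\<^sub>v vec N f)"
    unfolding QL by (intro scalar_prod_le_enorm) simp
  also have "\<dots> \<le> enorm (evec e) * (spec_norm (Qmat N E * laplacian N E) * enorm (vec N f))"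
    by (intro mult_left_mono enorm_mult_mat_vec_le enorm_nonneg) (auto simp: laplacian_def)
  finally show ?thesis unfolding scalar_prod_evec enorm_evec enorm_vec by (simp add: algebra_simps)
qed

lemma lambda_G_pos:
  assumes "E i0 j0" "N \<ge> 2"
  shows "0 < lambda_G N E"
proof (rule ccontr)
  assume "\<not> 0 < lambda_G N E"
  then have 0: "spec_norm (JNmat N * Wmat N E) = 0" by (simp add: lambda_G_def)
  \<comment> \<open>The test pair is the indicator of one edge and the centred indicator of its
    first vertex; their pairing is 1 - 1/N > 0. Positivity matters because
    \<open>alpha_const\<close> divides by \<open>lambda_G\<close>.\<close>
  define f where "f i = (if i = i0 then 1 else 0) - 1 / real N" for i
  define e where "e i j = (if i = i0 \<and> j = j0 then 1 else 0 :: real)" for i j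
  have i0: "i0 < N" "j0 < N" using edge_less[OF graph] assms by auto
  have "(\<Sum>i<N. f i) = 0" using i0 by (simp add: f_def sum_subtractf)
  then have "\<bar>\<Sum>i<N. f i * (\<Sum>j\<in>neighbors N E i. e i j)\<bar> \<le> 0"
    using JW_bound[of f e] i0 0 by simp
  moreover have "(\<Sum>j\<in>neighbors N E i. e i j) = (if i = i0 then 1 else 0)" for i
    using i0 assms by (auto simp: e_def neighbors_def)
  ultimately have "f i0 \<le> 0" using i0 by (simp add: if_distrib[of "\<lambda>y. _ * y"] cong: if_cong)
  then show False using assms(2) by (simp add: f_def)
qed

end

section \<open>The closed loop\<close>

definition bounded_rv :: "'w measure \<Rightarrow> ('w \<Rightarrow> real) \<Rightarrow> bool" where
  "bounded_rv M f \<longleftrightarrow> f \<in> borel_measurable M \<and> (\<exists>B. \<forall>\<omega>\<in>space M. \<bar>f \<omega>\<bar> \<le> B)"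

lemma bounded_rvI: "f \<in> borel_measurable M \<Longrightarrow> (\<And>\<omega>. \<omega> \<in> space M \<Longrightarrow> \<bar>f \<omega>\<bar> \<le> B) \<Longrightarrow> bounded_rv M f"
  unfolding bounded_rv_def by blast

lemma bounded_rv_const: "bounded_rv M (\<lambda>_. c)"
  unfolding bounded_rv_def by auto

lemma bounded_rv_cong:
  "(\<And>\<omega>. \<omega> \<in> space M \<Longrightarrow> f \<omega> = g \<omega>) \<Longrightarrow> bounded_rv M f \<longleftrightarrow> bounded_rv M g"
  unfolding bounded_rv_def using measurable_cong[of M f g borel] by auto

lemma bounded_rv_add:
  assumes "bounded_rv M f" "bounded_rv M g"
  shows "bounded_rv M (\<lambda>\<omega>. f \<omega> + g \<omega>)"
proof -
  from assms obtain A B where "\<forall>\<omega>\<in>space M. \<bar>f \<omega>\<bar> \<le> A" "\<forall>\<omega>\<in>space M. \<bar>g \<omega>\<bar> \<le> B"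
    unfolding bounded_rv_def by blast
  then have "\<bar>f \<omega> + g \<omega>\<bar> \<le> A + B" if "\<omega> \<in> space M" for \<omega> using that by fastforce
  then show ?thesis using assms by (intro bounded_rvI) (auto simp: bounded_rv_def)
qed

lemma bounded_rv_mult:
  assumes "bounded_rv M f" "bounded_rv M g"
  shows "bounded_rv M (\<lambda>\<omega>. f \<omega> * g \<omega>)"
proof -
  from assms obtain A B where "\<forall>\<omega>\<in>space M. \<bar>f \<omega>\<bar> \<le> A" "\<forall>\<omega>\<in>space M. \<bar>g \<omega>\<bar> \<le> B"
    unfolding bounded_rv_def by blast
  then have "\<bar>f \<omega> * g \<omega>\<bar> \<le> A * B" if "\<omega> \<in> space M" for \<omega>
    unfolding abs_mult using that by (intro mult_mono) (auto intro: order_trans[OF abs_ge_zero])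
  then show ?thesis using assms by (intro bounded_rvI) (auto simp: bounded_rv_def)
qed

lemma bounded_rv_diff: "bounded_rv M f \<Longrightarrow> bounded_rv M g \<Longrightarrow> bounded_rv M (\<lambda>\<omega>. f \<omega> - g \<omega>)"
  using bounded_rv_add[OF _ bounded_rv_mult[OF bounded_rv_const[of M "-1"]], of f g] by simp

lemma bounded_rv_sum: "(\<And>i. i \<in> I \<Longrightarrow> bounded_rv M (f i)) \<Longrightarrow> bounded_rv M (\<lambda>\<omega>. \<Sum>i\<in>I. f i \<omega>)"
  by (induction I rule: infinite_finite_induct) (auto intro: bounded_rv_const bounded_rv_add)

lemma bounded_rv_power2: "bounded_rv M f \<Longrightarrow> bounded_rv M (\<lambda>\<omega>. (f \<omega>)\<^sup>2)"
  unfolding power2_eq_square by (intro bounded_rv_mult)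

lemma bounded_rv_divide: "bounded_rv M f \<Longrightarrow> bounded_rv M (\<lambda>\<omega>. f \<omega> / c)"
  using bounded_rv_mult[OF _ bounded_rv_const[of M "1 / c"], of f] by simp

lemmas bounded_rv_intros = bounded_rv_const bounded_rv_add bounded_rv_diff bounded_rv_mult
  bounded_rv_sum bounded_rv_power2 bounded_rv_divide

lemma (in prob_space) bounded_rv_integrable:
  assumes "bounded_rv M f"
  shows "integrable M f"
proof -
  from assms obtain B where "f \<in> borel_measurable M" "\<forall>\<omega>\<in>space M. \<bar>f \<omega>\<bar> \<le> B"
    unfolding bounded_rv_def by blast
  then show ?thesis by (intro integrable_const_bound[where B = B]) auto
qed

lemma proj_abs_le: "M > 0 \<Longrightarrow> \<bar>proj M y\<bar> \<le> M"
  by (auto simp: proj_def)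

lemma proj_nonexpansive: "\<bar>w\<bar> \<le> M \<Longrightarrow> (proj M y - w)\<^sup>2 \<le> (y - w)\<^sup>2"
  by (subst abs_le_square_iff[symmetric]) (auto simp: proj_def max_def min_def)

text \<open>Young's inequality for norms given through their squares; the weight l decides how much
  of a cross term is charged to v and how much to r.\<close>

lemma two_mult_le_weighted:
  fixes v r s l :: real
  assumes "l > 0" "v \<ge> 0" "r \<ge> 0"
  shows "2 * (s * (sqrt v * sqrt r)) \<le> l * v + s\<^sup>2 / l * r"
proof -
  have "0 \<le> (l * sqrt v - s * sqrt r)\<^sup>2 / l" using assms by simp
  also have "\<dots> = (l\<^sup>2 * (sqrt v)\<^sup>2 - 2 * l * (s * (sqrt v * sqrt r)) + s\<^sup>2 * (sqrt r)\<^sup>2) / l"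
    by (simp add: power2_eq_square algebra_simps)
  also have "\<dots> = l * v - 2 * (s * (sqrt v * sqrt r)) + s\<^sup>2 / l * r"
    using assms by (simp add: field_simps power2_eq_square)
  finally show ?thesis by linarith
qed

text \<open>A weight works for some \<eta> > \<theta> exactly when it lies strictly between q / (m -
  \<theta>) and (p - \<theta>) / q, and the last hypothesis says that this interval is
  nonempty.\<close>

lemma lyapunov_weight_exists:
  fixes p q m \<theta> :: real
  assumes "q > 0" "p > \<theta>" "(p - \<theta>) * (m - \<theta>) > q\<^sup>2"
  shows "\<exists>\<kappa> \<eta>. \<kappa> > 0 \<and> \<eta> > \<theta> \<and> p - \<kappa> * q \<ge> \<eta> \<and> \<kappa> * m - q \<ge> \<eta> * \<kappa>"
proof -
  define P where "P = p - \<theta>"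
  define Q where "Q = m - \<theta>"
  have P: "P > 0" "P * Q > q\<^sup>2" using assms by (auto simp: P_def Q_def)
  have "P * Q > 0" using P(2) zero_le_power2[of q] by linarith
  then have Q: "Q > 0" using P(1) by (simp add: zero_less_mult_iff)
  have lt: "q / Q < P / q" using P Q assms(1) by (simp add: field_simps power2_eq_square)
  obtain \<kappa> where k: "q / Q < \<kappa>" "\<kappa> < P / q" using dense[OF lt] by blast
  have k0: "\<kappa> > 0" using k(1) assms(1) Q by (meson divide_pos_pos less_trans)
  have 1: "P - \<kappa> * q > 0" using k(2) assms(1) by (simp add: field_simps)
  have 2: "Q - q / \<kappa> > 0" using k(1) k0 Q by (simp add: field_simps)
  define e where "e = min (P - \<kappa> * q) (Q - q / \<kappa>)"
  have e: "e > 0" "e \<le> P - \<kappa> * q" "e \<le> Q - q / \<kappa>" using 1 2 by (auto simp: e_def)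
  have "e * \<kappa> \<le> (Q - q / \<kappa>) * \<kappa>" using e k0 by (intro mult_right_mono) auto
  then have "e * \<kappa> \<le> Q * \<kappa> - q" using k0 by (simp add: left_diff_distrib)
  then show ?thesis using k0 e
    by (intro exI[of _ \<kappa>] exI[of _ "\<theta> + e"]) (auto simp: P_def Q_def algebra_simps)
qed

locale one_bit_consensus = prob_space Pr
  for Pr :: "'w measure" +
  fixes n N :: nat and a b :: "nat \<Rightarrow> real" and E :: "nat \<Rightarrow> nat \<Rightarrow> bool"
    and c :: "nat \<Rightarrow> nat \<Rightarrow> real" and \<sigma> \<beta> \<gamma> M :: real and t0 :: nat
    and d :: "nat \<Rightarrow> nat \<Rightarrow> nat \<Rightarrow> 'w \<Rightarrow> real"
    and x :: "nat \<Rightarrow> nat \<Rightarrow> 'w \<Rightarrow> real vec"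
    and zh :: "nat \<Rightarrow> nat \<Rightarrow> nat \<Rightarrow> 'w \<Rightarrow> real"
    and x0 :: "nat \<Rightarrow> real vec" and z0 :: "nat \<Rightarrow> nat \<Rightarrow> real"
  assumes n2: "n \<ge> 2" and N2: "N \<ge> 2"
    and graph: "graph_ok N E" and conn: "connected_graph N E"
    and roots: "\<forall>z::complex. poly (comp_poly n b) z = 0 \<longrightarrow> cmod z < 1"
    and sigma_pos: "\<sigma> > 0" and beta_pos: "\<beta> > 0" and gamma_pos: "\<gamma> > 0" and M_pos: "M > 0"
    and t0_bound: "real t0 > \<gamma> * real (dmax N E) - 1"
    and noise_indep: "indep_vars (\<lambda>_. borel) (\<lambda>(i, j, t). d i j t) {(i, j, t). E i j}"
    and noise_distr: "\<And>i j t. E i j \<Longrightarrow>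
                        distributed Pr lborel (d i j t) (\<lambda>y. ennreal (normal_density 0 \<sigma> y))"
    and x0_dim: "\<And>i. i < N \<Longrightarrow> x0 i \<in> carrier_vec n"
    and x0_bd: "\<And>i. i < N \<Longrightarrow> \<bar>K2vec n b \<bullet> x0 i\<bar> \<le> M"
    and z0_bd: "\<And>i j. E i j \<Longrightarrow> \<bar>z0 i j\<bar> \<le> M"
    and x_init: "\<And>i \<omega>. i < N \<Longrightarrow> \<omega> \<in> space Pr \<Longrightarrow> x i (t0 + 1) \<omega> = x0 i"
    and zh_init: "\<And>i j \<omega>. E i j \<Longrightarrow> \<omega> \<in> space Pr \<Longrightarrow> zh i j t0 \<omega> = z0 i j"
    and zh_step: "\<And>i j t \<omega>. E i j \<Longrightarrow> t \<ge> t0 + 1 \<Longrightarrow> \<omega> \<in> space Pr \<Longrightarrow>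
        zh i j t \<omega> = proj M (zh i j (t - 1) \<omega> + \<beta> / real t *
           (gauss_cdf \<sigma> (c i j - zh i j (t - 1) \<omega>)
            - (if K2vec n b \<bullet> x j t \<omega> + d i j t \<omega> \<le> c i j then 1 else 0)))"
    and x_step: "\<And>i t \<omega>. i < N \<Longrightarrow> t \<ge> t0 + 1 \<Longrightarrow> \<omega> \<in> space Pr \<Longrightarrow>
        x i (t + 1) \<omega> = Amat n a *\<^sub>v x i t \<omega> +
          (K1vec n a b \<bullet> x i t \<omega> + \<gamma> / real (t + 1) *
             (\<Sum>j\<in>{j. j < N \<and> E i j}. zh i j t \<omega> - K2vec n b \<bullet> x i t \<omega>)) \<cdot>\<^sub>v Bvec n"
begin

section \<open>Compressed dynamics and deterministic bounds\<close>

definition z :: "nat \<Rightarrow> nat \<Rightarrow> 'w \<Rightarrow> real" where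
  "z i t \<omega> = K2vec n b \<bullet> x i t \<omega>"

definition g :: "nat \<Rightarrow> nat \<Rightarrow> 'w \<Rightarrow> real" where
  "g i t \<omega> = (\<Sum>j\<in>neighbors N E i. zh i j t \<omega> - z i t \<omega>)"

lemma x_carrier: "t \<ge> Suc t0 \<Longrightarrow> i < N \<Longrightarrow> \<omega> \<in> space Pr \<Longrightarrow> x i t \<omega> \<in> carrier_vec n"
proof (induction t rule: dec_induct)
  case base then show ?case using x_init x0_dim by simp
next
  case (step t) then show ?case using x_step[of i t \<omega>]
    by (auto simp: Amat_def Bvec_def intro!: add_carrier_vec mult_mat_vec_carrier smult_carrier_vec)
qed

lemma K2_scalar_prod:
  assumes "v \<in> carrier_vec n"
  shows "K2vec n b \<bullet> v = (\<Sum>k<n - 1. b (Suc k) * v $ k) + v $ (n - 1)"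
proof -
  obtain m where m: "n = Suc m" using n2 by (cases n) auto
  show ?thesis using assms unfolding m scalar_prod_def K2vec_def
    by (simp add: lessThan_atLeast0[symmetric])
qed

lemma x_step_component:
  assumes "i < N" "t \<ge> Suc t0" "\<omega> \<in> space Pr" "k < n"
  shows "x i (Suc t) \<omega> $ k = (if k = n - 1
    then (\<Sum>l<n. (a (Suc l) + K1vec n a b $ l) * x i t \<omega> $ l) + \<gamma> / real (Suc t) * g i t \<omega>
    else x i t \<omega> $ Suc k)"
proof -
  have xc: "x i t \<omega> \<in> carrier_vec n" using x_carrier assms by simp
  have step: "x i (Suc t) \<omega> = Amat n a *\<^sub>v x i t \<omega> +
      (K1vec n a b \<bullet> x i t \<omega> + \<gamma> / real (Suc t) * g i t \<omega>) \<cdot>\<^sub>v Bvec n"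
    using x_step[of i t \<omega>] assms by (simp add: g_def z_def neighbors_def)
  have A: "(Amat n a *\<^sub>v x i t \<omega>) $ k = (\<Sum>l<n. (if k = n - 1 then a (l + 1) else if l = k + 1 then 1 else 0) * x i t \<omega> $ l)"
    using assms(4) xc by (auto simp: Amat_def scalar_prod_def lessThan_atLeast0 intro!: sum.cong)
  show ?thesis
  proof (cases "k = n - 1")
    case True
    have "K1vec n a b \<bullet> x i t \<omega> = (\<Sum>l<n. K1vec n a b $ l * x i t \<omega> $ l)"
      using xc by (simp add: scalar_prod_def lessThan_atLeast0)
    then show ?thesis using True assms(4) A unfolding step
      by (simp add: Bvec_def Amat_def algebra_simps sum.distrib)
  next
    case False
    have "(\<Sum>l<n. (if k = n - 1 then a (l + 1) else if l = k + 1 then 1 else 0) * x i t \<omega> $ l)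
        = (\<Sum>l<n. if l = Suc k then x i t \<omega> $ l else 0)"
      using False by (intro sum.cong) auto
    also have "\<dots> = x i t \<omega> $ Suc k" using False assms(4) by simp
    finally show ?thesis using False assms(4) A unfolding step by (simp add: Bvec_def Amat_def)
  qed
qed

text \<open>The gains make \<open>K\<^sub>2\<close> a left eigenvector of \<open>A + B K\<^sub>1\<close> for the eigenvalue 1, and \<open>K\<^sub>2 B = 1\<close>.\<close>
lemma z_step:
  assumes "i < N" "t \<ge> Suc t0" "\<omega> \<in> space Pr"
  shows "z i (Suc t) \<omega> = z i t \<omega> + \<gamma> / real (Suc t) * g i t \<omega>"
proof -
  obtain m where m: "n = Suc m" "m \<ge> 1" using n2 by (cases n) auto
  \<comment> \<open>Extends b by \<open>B 0\<close> = 0 and \<open>B n\<close> = 1, so that every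
    entry of the closed-loop last row is \<open>B (Suc l) - B l\<close> and one half of the sum
    cancels against the shifted components.\<close>
  define B where "B l = (if l = 0 then 0 else if l \<le> m then b l else 1)" for l
  let ?y = "\<lambda>l. x i t \<omega> $ l"
  have co: "a (Suc l) + K1vec n a b $ l = B (Suc l) - B l" if "l < n" for l
    using that m by (cases "l = m") (auto simp: K1vec_def B_def Let_def)
  have "z i (Suc t) \<omega> = (\<Sum>k<m. b (Suc k) * x i (Suc t) \<omega> $ k) + x i (Suc t) \<omega> $ m"
    unfolding z_def using K2_scalar_prod[OF x_carrier[of "Suc t" i \<omega>]] assms m by simp
  also have "(\<Sum>k<m. b (Suc k) * x i (Suc t) \<omega> $ k) = (\<Sum>k<m. B (Suc k) * ?y (Suc k))"
    using assms m by (intro sum.cong) (auto simp: x_step_component B_def)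
  also have "x i (Suc t) \<omega> $ m = (\<Sum>l<n. (B (Suc l) - B l) * ?y l) + \<gamma> / real (Suc t) * g i t \<omega>"
    using assms m co by (simp add: x_step_component)
  also have "(\<Sum>l<n. (B (Suc l) - B l) * ?y l) = (\<Sum>l<n. B (Suc l) * ?y l) - (\<Sum>l<n. B l * ?y l)"
    by (simp add: sum_subtractf algebra_simps)
  also have "(\<Sum>l<n. B l * ?y l) = (\<Sum>k<m. B (Suc k) * ?y (Suc k))"
    unfolding m sum.lessThan_Suc_shift by (simp add: B_def)
  also have "(\<Sum>l<n. B (Suc l) * ?y l) = (\<Sum>k<m. b (Suc k) * ?y k) + ?y m"
    unfolding m by (simp add: B_def)
  also have "\<dots> = z i t \<omega>"
    unfolding z_def using K2_scalar_prod[OF x_carrier[of t i \<omega>]] assms m by simp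
  finally show ?thesis by simp
qed

lemma card_neighbors_bound:
  assumes "i < N" "t \<ge> Suc t0"
  shows "\<gamma> / real (Suc t) * real (card (neighbors N E i)) \<le> 1"
proof -
  have "card (neighbors N E i) \<le> dmax N E"
    unfolding dmax_def neighbors_def deg_def[symmetric] using assms by (intro Max_ge) auto
  then have "\<gamma> * real (card (neighbors N E i)) \<le> \<gamma> * real (dmax N E)" using gamma_pos by simp
  also have "\<dots> \<le> real (Suc t)" using t0_bound assms by simp
  finally show ?thesis by (simp add: field_simps)
qed

lemma zh_bounded: "t \<ge> t0 \<Longrightarrow> E i j \<Longrightarrow> \<omega> \<in> space Pr \<Longrightarrow> \<bar>zh i j t \<omega>\<bar> \<le> M"
  using zh_init z0_bd zh_step[of i j t \<omega>] proj_abs_le[OF M_pos] by (cases "t = t0") auto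

text \<open>By \<open>card_neighbors_bound\<close> the update is a convex combination of the old
  value and the projected estimates. The monotonicity constant \<open>f_M\<close> is available only
  on this interval.\<close>

lemma z_bounded: "t \<ge> Suc t0 \<Longrightarrow> i < N \<Longrightarrow> \<omega> \<in> space Pr \<Longrightarrow> \<bar>z i t \<omega>\<bar> \<le> M"
proof (induction t rule: dec_induct)
  case base then show ?case using x_init x0_bd by (simp add: z_def)
next
  case (step t)
  define \<theta> where "\<theta> = \<gamma> / real (Suc t)"
  define D where "D = real (card (neighbors N E i))"
  have \<theta>: "\<theta> \<ge> 0" "\<theta> * D \<le> 1"
    using gamma_pos card_neighbors_bound[of i t] step by (auto simp: \<theta>_def D_def)
  have "\<bar>\<Sum>j\<in>neighbors N E i. zh i j t \<omega>\<bar> \<le> (\<Sum>j\<in>neighbors N E i. M)"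
    using step zh_bounded[of t i _ \<omega>] by (intro order_trans[OF sum_abs] sum_mono) (auto simp: neighbors_def)
  then have S: "\<bar>\<Sum>j\<in>neighbors N E i. zh i j t \<omega>\<bar> \<le> D * M" by (simp add: D_def)
  have "z i (Suc t) \<omega> = (1 - \<theta> * D) * z i t \<omega> + \<theta> * (\<Sum>j\<in>neighbors N E i. zh i j t \<omega>)"
    using z_step[of i t \<omega>] step by (simp add: g_def sum_subtractf \<theta>_def D_def algebra_simps)
  also have "\<bar>\<dots>\<bar> \<le> (1 - \<theta> * D) * \<bar>z i t \<omega>\<bar> + \<theta> * \<bar>\<Sum>j\<in>neighbors N E i. zh i j t \<omega>\<bar>"
    using \<theta> by (intro order_trans[OF abs_triangle_ineq]) (simp add: abs_mult)
  also have "\<dots> \<le> (1 - \<theta> * D) * M + \<theta> * (D * M)"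
    using \<theta> S step by (intro add_mono mult_left_mono) auto
  finally show ?case by (simp add: algebra_simps)
qed

text \<open>Bounds at most N terms of size 2 M; it enters only the constants of second-order
  terms.\<close>

definition G :: real where "G = 2 * M * real N"

lemma g_bounded:
  assumes "i < N" "t \<ge> Suc t0" "\<omega> \<in> space Pr"
  shows "\<bar>g i t \<omega>\<bar> \<le> G"
proof -
  have "\<bar>zh i j t \<omega> - z i t \<omega>\<bar> \<le> 2 * M" if "j \<in> neighbors N E i" for j
    using zh_bounded[of t i j \<omega>] z_bounded[of t i \<omega>] assms that by (auto simp: neighbors_def)
  then have "\<bar>g i t \<omega>\<bar> \<le> (\<Sum>j\<in>neighbors N E i. 2 * M)"
    unfolding g_def by (intro order_trans[OF sum_abs] sum_mono)
  also have "\<dots> = 2 * M * real (card (neighbors N E i))" by simp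
  also have "\<dots> \<le> G"
  proof -
    have "card (neighbors N E i) \<le> card {..<N}" by (intro card_mono) (auto simp: neighbors_def)
    then show ?thesis unfolding G_def using M_pos by simp
  qed
  finally show ?thesis .
qed

subsection \<open>Measurability with respect to the noise\<close>

text \<open>States run one step ahead: \<open>z i (Suc t)\<close> is fixed by the noises up to t,
  just as \<open>zh i j t\<close> is. The sigma-algebra is arbitrary because both the whole space
  and the past of a given time are needed.\<close>

lemma zh_z_measurable:
  assumes sp: "space F = space Pr"
    and dm: "\<And>i j r. E i j \<Longrightarrow> r \<le> s \<Longrightarrow> d i j r \<in> borel_measurable F"
  shows "t \<ge> t0 \<Longrightarrow> t \<le> s \<Longrightarrow> (\<forall>i j. E i j \<longrightarrow> zh i j t \<in> borel_measurable F) \<and>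
    (\<forall>i<N. z i (Suc t) \<in> borel_measurable F)"
proof (induction t rule: dec_induct)
  case base
  have "zh i j t0 \<in> borel_measurable F" if "E i j" for i j
    using measurable_cong[of F "zh i j t0" "\<lambda>_. z0 i j" borel] zh_init[OF that] sp by simp
  moreover have "z i (Suc t0) \<in> borel_measurable F" if "i < N" for i
    using measurable_cong[of F "z i (Suc t0)" "\<lambda>_. K2vec n b \<bullet> x0 i" borel] x_init[OF that] sp
    by (simp add: z_def)
  ultimately show ?case by blast
next
  case (step t)
  note [measurable] = borel_measurable_gauss_cdf[OF sigma_pos]
  have IH: "\<And>i j. E i j \<Longrightarrow> zh i j t \<in> borel_measurable F" "\<And>i. i < N \<Longrightarrow> z i (Suc t) \<in> borel_measurable F"
    using step by auto
  have zh': "zh i j (Suc t) \<in> borel_measurable F" if e: "E i j" for i j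
  proof -
    have [measurable]: "zh i j t \<in> borel_measurable F" "z j (Suc t) \<in> borel_measurable F"
      "d i j (Suc t) \<in> borel_measurable F"
      using IH e edge_less[OF graph e] dm step by auto
    have "(\<lambda>\<omega>. proj M (zh i j t \<omega> + \<beta> / real (Suc t) * (gauss_cdf \<sigma> (c i j - zh i j t \<omega>)
        - (if z j (Suc t) \<omega> + d i j (Suc t) \<omega> \<le> c i j then 1 else 0)))) \<in> borel_measurable F"
      unfolding proj_def by measurable
    then show ?thesis
      using measurable_cong[of F "zh i j (Suc t)" _ borel] zh_step[OF e, of "Suc t"] step sp
      by (simp add: z_def)
  qed
  have "z i (Suc (Suc t)) \<in> borel_measurable F" if i: "i < N" for i
  proof -
    have [measurable]: "z i (Suc t) \<in> borel_measurable F" using IH i by auto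
    have "(\<lambda>\<omega>. z i (Suc t) \<omega> + \<gamma> / real (Suc (Suc t)) * (\<Sum>j\<in>neighbors N E i. zh i j (Suc t) \<omega> - z i (Suc t) \<omega>))
      \<in> borel_measurable F"
      using zh' by (intro borel_measurable_add borel_measurable_times borel_measurable_sum
          borel_measurable_diff) (auto simp: neighbors_def)
    then show ?thesis
      using measurable_cong[of F "z i (Suc (Suc t))" _ borel] z_step[OF i, of "Suc t"] step sp
      by (simp add: g_def)
  qed
  then show ?case using zh' by blast
qed

lemma noise_measurable: "E i j \<Longrightarrow> d i j t \<in> borel_measurable Pr"
  using distributed_measurable[OF noise_distr] by simp

lemma bounded_rv_zh: "t \<ge> t0 \<Longrightarrow> E i j \<Longrightarrow> bounded_rv Pr (zh i j t)"
  using zh_z_measurable[of Pr t t] noise_measurable zh_bounded by (intro bounded_rvI[where B = M]) auto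

lemma bounded_rv_z:
  assumes "t \<ge> Suc t0" "i < N"
  shows "bounded_rv Pr (z i t)"
proof -
  obtain s where "t = Suc s" "s \<ge> t0" using assms by (cases t) auto
  then show ?thesis
    using zh_z_measurable[of Pr s s] noise_measurable z_bounded assms by (intro bounded_rvI[where B = M]) auto
qed

lemma bounded_rv_g: "t \<ge> Suc t0 \<Longrightarrow> i < N \<Longrightarrow> bounded_rv Pr (g i t)"
  unfolding g_def[abs_def] by (intro bounded_rv_intros bounded_rv_zh bounded_rv_z) (auto simp: neighbors_def)

lemma bounded_rv_x: "t \<ge> Suc t0 \<Longrightarrow> i < N \<Longrightarrow> k < n \<Longrightarrow> bounded_rv Pr (\<lambda>\<omega>. x i t \<omega> $ k)"
proof (induction t arbitrary: k rule: dec_induct)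
  case base
  then show ?case
    using bounded_rv_cong[of Pr "\<lambda>\<omega>. x i (Suc t0) \<omega> $ k" "\<lambda>_. x0 i $ k"] x_init
    by (simp add: bounded_rv_const)
next
  case (step t)
  have "bounded_rv Pr (\<lambda>\<omega>. x i (Suc t) \<omega> $ k) \<longleftrightarrow> bounded_rv Pr (\<lambda>\<omega>. if k = n - 1
    then (\<Sum>l<n. (a (Suc l) + K1vec n a b $ l) * x i t \<omega> $ l) + \<gamma> / real (Suc t) * g i t \<omega>
    else x i t \<omega> $ Suc k)"
    using x_step_component step by (intro bounded_rv_cong) auto
  also have "\<dots>"
  proof (cases "k = n - 1")
    case True
    have "bounded_rv Pr (\<lambda>\<omega>. (\<Sum>l<n. (a (Suc l) + K1vec n a b $ l) * x i t \<omega> $ l) + \<gamma> / real (Suc t) * g i t \<omega>)"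
      using step by (intro bounded_rv_add bounded_rv_sum bounded_rv_mult bounded_rv_const bounded_rv_g) auto
    then show ?thesis using True by simp
  next
    case False
    then show ?thesis using step by simp
  qed
  finally show ?case .
qed

subsection \<open>Centering of the received bits\<close>

text \<open>The noise of the bit, centred at the true compressed state rather than at its
  estimate.\<close>

definition xi :: "nat \<Rightarrow> nat \<Rightarrow> nat \<Rightarrow> 'w \<Rightarrow> real" where
  "xi i j t \<omega> = gauss_cdf \<sigma> (c i j - z j t \<omega>) - (if z j t \<omega> + d i j t \<omega> \<le> c i j then 1 else 0)"

lemma bounded_rv_xi:
  assumes "E i j" "t \<ge> Suc t0"
  shows "bounded_rv Pr (xi i j t)"
proof (rule bounded_rvI[where B = 1])
  note [measurable] = borel_measurable_gauss_cdf[OF sigma_pos]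
  have [measurable]: "z j t \<in> borel_measurable Pr" "d i j t \<in> borel_measurable Pr"
    using bounded_rv_z[of t j] noise_measurable assms edge_less[OF graph] by (auto simp: bounded_rv_def)
  show "xi i j t \<in> borel_measurable Pr" unfolding xi_def[abs_def] by measurable
  show "\<bar>xi i j t \<omega>\<bar> \<le> 1" for \<omega>
    using gauss_cdf_bounds[OF sigma_pos, of "c i j - z j t \<omega>"] by (auto simp: xi_def)
qed

text \<open>The factor in front is a function of the noises up to t, whereas the bit contains the
  fresh noise of time \<open>Suc t\<close>.\<close>

lemma expectation_xi:
  assumes e: "E i j" and t: "t \<ge> Suc t0"
  shows "expectation (\<lambda>\<omega>. (zh i j t \<omega> - z j (Suc t) \<omega>) * xi i j (Suc t) \<omega>) = 0"
proof -
  define X where "X = (\<lambda>(i, j, t). d i j t)"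
  define J where "J = {(i, j, s). E i j \<and> s \<le> t}"
  define F where "F = vimage_algebra (space Pr) (\<lambda>\<omega>. restrict (\<lambda>k. X k \<omega>) J) (PiM J (\<lambda>_. borel :: real measure))"
  have sp: "space F = space Pr" by (simp add: F_def)
  have dm: "d i j r \<in> borel_measurable F" if "E i j" "r \<le> t" for i j r
  proof -
    have k: "(i, j, r) \<in> J" using that by (simp add: J_def)
    have "(\<lambda>\<omega>. restrict (\<lambda>k. X k \<omega>) J) \<in> measurable F (PiM J (\<lambda>_. borel))"
      unfolding F_def by (rule measurable_vimage_algebra1) (auto simp: space_PiM)
    from measurable_compose[OF this measurable_component_singleton[OF k]]
    show ?thesis using k by (simp add: X_def)
  qed
  have "indep_var F (\<lambda>\<omega>. \<omega>) (vimage_algebra (space Pr) (X (i, j, Suc t)) borel) (\<lambda>\<omega>. \<omega>)"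
    unfolding F_def using e
    by (intro indep_var_past_future[OF noise_indep[folded X_def]]) (auto simp: J_def)
  then have ind: "indep_var F (\<lambda>\<omega>. \<omega>) (vimage_algebra (space Pr) (d i j (Suc t)) borel) (\<lambda>\<omega>. \<omega>)"
    by (simp add: X_def)
  have j: "j < N" using edge_less[OF graph e] by simp
  have [measurable]: "zh i j t \<in> borel_measurable F" "z j (Suc t) \<in> borel_measurable F"
    using zh_z_measurable[OF sp dm, of t] t e j by auto
  show ?thesis
    unfolding xi_def
  proof (rule gaussian_bit_centered[OF sigma_pos ind noise_distr[OF e], where B = "2 * M"])
    fix \<omega> assume "\<omega> \<in> space F"
    then show "\<bar>zh i j t \<omega> - z j (Suc t) \<omega>\<bar> \<le> 2 * M"
      using zh_bounded[of t i j \<omega>] z_bounded[of "Suc t" j \<omega>] t e j sp by auto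
  qed measurable
qed

subsection \<open>Disagreement and estimation error\<close>

definition avg :: "nat \<Rightarrow> 'w \<Rightarrow> real" where
  "avg t \<omega> = (\<Sum>i<N. z i t \<omega>) / real N"

definition delta :: "nat \<Rightarrow> nat \<Rightarrow> 'w \<Rightarrow> real" where
  "delta t i \<omega> = z i t \<omega> - avg t \<omega>"

definition eps :: "nat \<Rightarrow> nat \<Rightarrow> nat \<Rightarrow> 'w \<Rightarrow> real" where
  "eps t i j \<omega> = zh i j t \<omega> - z j t \<omega>"

definition V :: "nat \<Rightarrow> 'w \<Rightarrow> real" where
  "V t \<omega> = dot N (\<lambda>i. delta t i \<omega>) (\<lambda>i. delta t i \<omega>)"

definition R :: "nat \<Rightarrow> 'w \<Rightarrow> real" where
  "R t \<omega> = (\<Sum>(i, j)\<in>edges E. (eps t i j \<omega>)\<^sup>2)"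

text \<open>Zero-mean part of the increment of \<open>R\<close>. The error is measured against
  \<open>z j (Suc t)\<close>, the value that the bit at \<open>Suc t\<close> samples, and not
  against \<open>z j t\<close> as in \<open>eps\<close>.\<close>

definition Mart :: "nat \<Rightarrow> 'w \<Rightarrow> real" where
  "Mart t \<omega> = (\<Sum>(i, j)\<in>edges E. (zh i j t \<omega> - z j (Suc t) \<omega>) * xi i j (Suc t) \<omega>)"

abbreviation "sG \<equiv> spec_norm (JNmat N * Wmat N E)"
abbreviation "sQW \<equiv> spec_norm (Qmat N E * Wmat N E)"
abbreviation "sQL \<equiv> spec_norm (Qmat N E * laplacian N E)"
abbreviation "l2 \<equiv> lambda2 N E"
abbreviation "lG \<equiv> lambda_G N E"
abbreviation "fM \<equiv> f_M N E \<sigma> c M"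

lemma N_pos: "0 < N" "0 < real N"
  using N2 by auto

text \<open>Guarantees that \<open>f_M\<close> is a minimum over a nonempty set and that
  \<open>lambda_G\<close> is positive.\<close>

lemma edge_exists: "\<exists>i j. E i j"
proof -
  have "E\<^sup>*\<^sup>* 0 1" using conn N2 by (simp add: connected_graph_def)
  then show ?thesis by (cases rule: converse_rtranclpE) auto
qed

lemma l2_pos: "0 < l2" and lG_pos: "0 < lG" and fM_pos: "0 < fM"
proof -
  obtain i j where e: "E i j" using edge_exists by blast
  show "0 < l2" by (rule lambda2_facts(1)[OF graph conn N2])
  show "0 < lG" by (rule lambda_G_pos[OF graph e N2])
  show "0 < fM" using f_M_facts(2)[OF sigma_pos] e edge_less[OF graph e] by blast
qed

lemma V_nonneg: "0 \<le> V t \<omega>"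
  unfolding V_def by (rule dot_self_nonneg)

lemma R_nonneg: "0 \<le> R t \<omega>"
  unfolding R_def by (intro sum_nonneg) auto

lemma sum_delta: "(\<Sum>i<N. delta t i \<omega>) = 0"
  using N_pos by (simp add: delta_def avg_def sum_subtractf)

text \<open>Each summand is the error \<open>eps t i j\<close> minus the difference of two
  disagreements: exact consensus feedback perturbed by estimation errors.\<close>

lemma g_eq:
  assumes "i < N"
  shows "g i t \<omega> = (\<Sum>j\<in>neighbors N E i. eps t i j \<omega>) - app N (lap N E) (\<lambda>i. delta t i \<omega>) i"
  unfolding g_def app_lap[OF graph assms] sum_subtractf[symmetric]
  by (intro sum.cong) (auto simp: eps_def delta_def)

text \<open>The Laplacian contributes -2 \<open>l2\<close> V; half of this absorbs the V-part of the
  cross term with the estimation errors.\<close>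

lemma delta_drift:
  "2 * (\<Sum>i<N. delta t i \<omega> * g i t \<omega>) \<le> - l2 * V t \<omega> + lG / l2 * R t \<omega>"
proof -
  let ?\<delta> = "\<lambda>i. delta t i \<omega>"
  have "(\<Sum>i<N. ?\<delta> i * g i t \<omega>) = (\<Sum>i<N. ?\<delta> i * (\<Sum>j\<in>neighbors N E i. eps t i j \<omega>))
      - dot N ?\<delta> (app N (lap N E) ?\<delta>)"
    unfolding dot_def sum_subtractf[symmetric] by (intro sum.cong) (auto simp: g_eq right_diff_distrib)
  moreover have "l2 * V t \<omega> \<le> dot N ?\<delta> (app N (lap N E) ?\<delta>)"
    unfolding V_def by (rule lambda2_facts(2)[OF graph conn N2 sum_delta])
  moreover have "(\<Sum>i<N. ?\<delta> i * (\<Sum>j\<in>neighbors N E i. eps t i j \<omega>)) \<le> sG * (sqrt (V t \<omega>) * sqrt (R t \<omega>))"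
    unfolding V_def R_def by (rule order_trans[OF abs_ge_self JW_bound[OF graph sum_delta N_pos(1)]])
  moreover have "2 * (sG * (sqrt (V t \<omega>) * sqrt (R t \<omega>))) \<le> l2 * V t \<omega> + lG / l2 * R t \<omega>"
    unfolding lambda_G_def by (rule two_mult_le_weighted[OF l2_pos V_nonneg R_nonneg])
  ultimately show ?thesis by linarith
qed

lemma eps_drift:
  "- 2 * (\<Sum>(i, j)\<in>edges E. eps t i j \<omega> * g j t \<omega>) \<le> alpha_const N E * R t \<omega> + lG / l2 * V t \<omega>"
proof -
  let ?\<delta> = "\<lambda>i. delta t i \<omega>"
  define S1 where "S1 = (\<Sum>(i, j)\<in>edges E. eps t i j \<omega> * (\<Sum>k\<in>neighbors N E j. eps t j k \<omega>))"
  define S2 where "S2 = (\<Sum>(i, j)\<in>edges E. eps t i j \<omega> * app N (lap N E) ?\<delta> j)"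
  have "(\<Sum>(i, j)\<in>edges E. eps t i j \<omega> * g j t \<omega>) = S1 - S2"
    unfolding S1_def S2_def sum_subtractf[symmetric]
    using edge_less[OF graph] by (intro sum.cong) (auto simp: edges_def g_eq right_diff_distrib)
  moreover have "\<bar>S1\<bar> \<le> sQW * R t \<omega>" unfolding S1_def R_def by (rule QW_bound[OF graph])
  moreover have "\<bar>S2\<bar> \<le> sQL * (sqrt (V t \<omega>) * sqrt (R t \<omega>))"
    unfolding S2_def V_def R_def by (rule QL_bound[OF graph])
  \<comment> \<open>The weight \<open>lG / l2\<close> copies the coupling coefficient of
    \<open>delta_drift\<close>, so both off-diagonal rates agree; what remains at R is the second
    summand of \<open>alpha_const\<close>.\<close>
  moreover have "2 * (sQL * (sqrt (V t \<omega>) * sqrt (R t \<omega>))) \<le> lG / l2 * V t \<omega> + sQL\<^sup>2 / (lG / l2) * R t \<omega>"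
    using l2_pos lG_pos by (intro two_mult_le_weighted V_nonneg R_nonneg) auto
  moreover have "alpha_const N E * R t \<omega> = 2 * (sQW * R t \<omega>) + sQL\<^sup>2 / (lG / l2) * R t \<omega>"
    by (simp add: alpha_const_def lambda_QW_def lambda_QL_def spec_norm_nonneg algebra_simps)
  ultimately show ?thesis by linarith
qed

lemma V_step:
  assumes "t \<ge> Suc t0" "\<omega> \<in> space Pr"
  shows "V (Suc t) \<omega> \<le> V t \<omega> + (1 / real (Suc t)) * (- (\<gamma> * l2) * V t \<omega> + \<gamma> * lG / l2 * R t \<omega>)
    + (\<gamma>\<^sup>2 * real N * (2 * G)\<^sup>2) / (real (Suc t))\<^sup>2"
proof -
  define h where "h = 1 / real (Suc t)"
  define gb where "gb = (\<Sum>i<N. g i t \<omega>) / real N"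
  have "avg (Suc t) \<omega> = (\<Sum>i<N. z i t \<omega> + \<gamma> * h * g i t \<omega>) / real N"
    unfolding avg_def using z_step assms by (intro arg_cong2[where f = "(/)"] sum.cong) (auto simp: h_def)
  also have "\<dots> = avg t \<omega> + \<gamma> * h * gb"
    by (simp add: avg_def gb_def sum.distrib sum_distrib_left add_divide_distrib)
  finally have av: "avg (Suc t) \<omega> = avg t \<omega> + \<gamma> * h * gb" .
  have ds: "delta (Suc t) i \<omega> = delta t i \<omega> + \<gamma> * h * (g i t \<omega> - gb)" if "i < N" for i
    using z_step[OF that assms] av by (simp add: delta_def h_def algebra_simps)
  have gb: "\<bar>gb\<bar> \<le> G"
  proof -
    have "\<bar>\<Sum>i<N. g i t \<omega>\<bar> \<le> (\<Sum>i<N. G)"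
      using g_bounded assms by (intro order_trans[OF sum_abs] sum_mono) auto
    then show ?thesis using N_pos by (simp add: gb_def field_simps)
  qed
  have sq: "(g i t \<omega> - gb)\<^sup>2 \<le> (2 * G)\<^sup>2" if "i < N" for i
    using g_bounded[OF that assms] gb by (subst abs_le_square_iff[symmetric]) auto
  have "V (Suc t) \<omega> = (\<Sum>i<N. (delta t i \<omega>)\<^sup>2 + 2 * (\<gamma> * h) * (delta t i \<omega> * g i t \<omega>)
      - 2 * (\<gamma> * h) * gb * delta t i \<omega> + (\<gamma> * h)\<^sup>2 * (g i t \<omega> - gb)\<^sup>2)"
    unfolding V_def dot_def by (intro sum.cong) (auto simp: ds power2_eq_square algebra_simps)
  also have "\<dots> = V t \<omega> + (\<gamma> * h) * (2 * (\<Sum>i<N. delta t i \<omega> * g i t \<omega>))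
      - 2 * (\<gamma> * h) * gb * (\<Sum>i<N. delta t i \<omega>) + (\<gamma> * h)\<^sup>2 * (\<Sum>i<N. (g i t \<omega> - gb)\<^sup>2)"
    by (simp add: V_def dot_def sum.distrib sum_subtractf sum_distrib_left power2_eq_square algebra_simps)
  \<comment> \<open>The term with the mean \<open>gb\<close> drops out because the disagreements sum
    to zero.\<close>
  also have "\<dots> \<le> V t \<omega> + (\<gamma> * h) * (- l2 * V t \<omega> + lG / l2 * R t \<omega>)
      - 2 * (\<gamma> * h) * gb * 0 + (\<gamma> * h)\<^sup>2 * (\<Sum>i<N. (2 * G)\<^sup>2)"
    unfolding sum_delta using delta_drift gamma_pos sq
    by (intro add_mono diff_mono mult_left_mono sum_mono order_refl) (auto simp: h_def)
  also have "\<dots> = V t \<omega> + h * (- (\<gamma> * l2) * V t \<omega> + \<gamma> * lG / l2 * R t \<omega>) + (\<gamma>\<^sup>2 * real N * (2 * G)\<^sup>2) * h\<^sup>2"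
    by (simp add: algebra_simps power_mult_distrib)
  finally show ?thesis by (simp add: h_def power_divide)
qed

text \<open>The summands bound, in order, the squared motion of the target, the cost of replacing
  the moved error by \<open>eps\<close> in the monotone term, and the squared correction of the
  estimate.\<close>

definition Ceps :: real where
  "Ceps = \<gamma>\<^sup>2 * G\<^sup>2 + 8 * (\<beta> * fM * \<gamma> * M * G) + \<beta>\<^sup>2"

text \<open>The correction splits into a restoring force, the difference of the distribution
  function at estimate and target, and the centred noise \<open>xi\<close>. Projection can only
  reduce the error because the target lies in [-M, M].\<close>

lemma eps_step:
  assumes e: "E i j" and t: "t \<ge> Suc t0" and \<omega>: "\<omega> \<in> space Pr"
  shows "(eps (Suc t) i j \<omega>)\<^sup>2 \<le> (eps t i j \<omega>)\<^sup>2
    + (1 / real (Suc t)) * (- 2 * \<gamma> * (eps t i j \<omega> * g j t \<omega>) - 2 * \<beta> * fM * (eps t i j \<omega>)\<^sup>2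
      + 2 * \<beta> * ((zh i j t \<omega> - z j (Suc t) \<omega>) * xi i j (Suc t) \<omega>)) + Ceps / (real (Suc t))\<^sup>2"
proof -
  define h where "h = 1 / real (Suc t)"
  define y where "y = zh i j t \<omega>"
  define w where "w = z j (Suc t) \<omega>"
  define \<epsilon> where "\<epsilon> = eps t i j \<omega>"
  define \<gamma>h where "\<gamma>h = \<gamma> * h"
  define gj where "gj = g j t \<omega>"
  define \<Delta> where "\<Delta> = gauss_cdf \<sigma> (c i j - y) - gauss_cdf \<sigma> (c i j - w)"
  define \<xi> where "\<xi> = xi i j (Suc t) \<omega>"
  have j: "i < N" "j < N" using edge_less[OF graph e] by auto
  have h: "h > 0" by (simp add: h_def)
  have y: "\<bar>y\<bar> \<le> M" using zh_bounded[of t i j \<omega>] t e \<omega> by (simp add: y_def)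
  have w: "\<bar>w\<bar> \<le> M" using z_bounded[of "Suc t" j \<omega>] t j \<omega> by (simp add: w_def)
  have gj: "\<bar>gj\<bar> \<le> G" unfolding gj_def by (rule g_bounded[OF j(2) t \<omega>])
  have eb: "\<bar>\<epsilon>\<bar> \<le> 2 * M"
    using y z_bounded[of t j \<omega>] t j \<omega> by (auto simp: \<epsilon>_def eps_def y_def)
  have yw: "y - w = \<epsilon> - \<gamma>h * gj"
    using z_step[OF j(2) t \<omega>] by (simp add: y_def w_def \<epsilon>_def eps_def gj_def \<gamma>h_def h_def)
  have "zh i j (Suc t) \<omega> = proj M (y + \<beta> * h * (\<Delta> + \<xi>))"
    using zh_step[OF e, of "Suc t" \<omega>] t \<omega>
    by (simp add: y_def h_def \<Delta>_def \<xi>_def xi_def w_def z_def)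
  then have "(eps (Suc t) i j \<omega>)\<^sup>2 \<le> (y + \<beta> * h * (\<Delta> + \<xi>) - w)\<^sup>2"
    using proj_nonexpansive[OF w] by (simp add: eps_def w_def)
  also have "\<dots> = (y - w)\<^sup>2 + 2 * \<beta> * h * ((y - w) * \<Delta>) + 2 * \<beta> * h * ((y - w) * \<xi>) + \<beta>\<^sup>2 * h\<^sup>2 * (\<Delta> + \<xi>)\<^sup>2"
    by (simp add: power2_eq_square algebra_simps)
  also have "\<dots> \<le> (y - w)\<^sup>2 + 2 * \<beta> * h * (- fM * (y - w)\<^sup>2) + 2 * \<beta> * h * ((y - w) * \<xi>) + \<beta>\<^sup>2 * h\<^sup>2 * 1"
  proof -
    have "(y - w) * \<Delta> \<le> - fM * (y - w)\<^sup>2"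
      unfolding \<Delta>_def using fM_pos f_M_facts(1)[OF sigma_pos, of E i j N c M] e j
      by (intro gauss_cdf_strongly_monotone[OF sigma_pos _ _ y w]) auto
    then have "2 * \<beta> * h * ((y - w) * \<Delta>) \<le> 2 * \<beta> * h * (- fM * (y - w)\<^sup>2)"
      using beta_pos h by (intro mult_left_mono) auto
    \<comment> \<open>The sum is the whole innovation, a probability minus a bit.\<close>
    moreover have "\<bar>\<Delta> + \<xi>\<bar> \<le> \<bar>1\<bar>"
      using gauss_cdf_bounds[OF sigma_pos, of "c i j - y"] by (simp add: \<Delta>_def \<xi>_def xi_def w_def)
    then have "(\<Delta> + \<xi>)\<^sup>2 \<le> 1" using abs_le_square_iff[of "\<Delta> + \<xi>" 1] by simp
    then have "\<beta>\<^sup>2 * h\<^sup>2 * (\<Delta> + \<xi>)\<^sup>2 \<le> \<beta>\<^sup>2 * h\<^sup>2 * 1" by (intro mult_left_mono) auto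
    ultimately show ?thesis by linarith
  qed
  also have "\<dots> \<le> \<epsilon>\<^sup>2 + h * (- 2 * \<gamma> * (\<epsilon> * gj) - 2 * \<beta> * fM * \<epsilon>\<^sup>2 + 2 * \<beta> * ((y - w) * \<xi>)) + Ceps * h\<^sup>2"
  proof -
    have 1: "gj\<^sup>2 \<le> G\<^sup>2" using gj by (subst abs_le_square_iff[symmetric]) auto
    then have 1: "\<gamma>h\<^sup>2 * gj\<^sup>2 \<le> \<gamma>h\<^sup>2 * G\<^sup>2" by (intro mult_left_mono) auto
    have sq: "(y - w)\<^sup>2 = \<epsilon>\<^sup>2 - 2 * \<gamma>h * (\<epsilon> * gj) + \<gamma>h\<^sup>2 * gj\<^sup>2"
      unfolding yw by (simp add: power2_eq_square algebra_simps)
    have "\<bar>\<epsilon> * gj\<bar> \<le> 2 * M * G" unfolding abs_mult using eb gj by (intro mult_mono) auto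
    then have "\<epsilon> * gj \<le> 2 * M * G" by linarith
    then have "2 * \<gamma>h * (\<epsilon> * gj) \<le> 2 * \<gamma>h * (2 * M * G)"
      using gamma_pos h by (intro mult_left_mono) (auto simp: \<gamma>h_def)
    \<comment> \<open>The monotone term carries a minus sign, so the square must be bounded from
      below here; its second-order part is dropped.\<close>
    then have "(y - w)\<^sup>2 \<ge> \<epsilon>\<^sup>2 - 4 * \<gamma>h * M * G" unfolding sq by (simp add: algebra_simps add_increasing)
    then have "2 * \<beta> * h * fM * (\<epsilon>\<^sup>2 - 4 * \<gamma>h * M * G) \<le> 2 * \<beta> * h * fM * (y - w)\<^sup>2"
      using beta_pos fM_pos h by (intro mult_left_mono) auto
    then show ?thesis using 1 unfolding sq Ceps_def \<gamma>h_def
      by (simp add: algebra_simps power2_eq_square)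
  qed
  finally show ?thesis
    by (simp add: h_def power_divide y_def w_def \<epsilon>_def gj_def \<xi>_def)
qed

lemma R_step:
  assumes t: "t \<ge> Suc t0" and \<omega>: "\<omega> \<in> space Pr"
  shows "R (Suc t) \<omega> \<le> R t \<omega> + (1 / real (Suc t)) * (\<gamma> * lG / l2 * V t \<omega>
      - (2 * \<beta> * fM - \<gamma> * alpha_const N E) * R t \<omega> + 2 * \<beta> * Mart t \<omega>)
    + (real (card (edges E)) * Ceps) / (real (Suc t))\<^sup>2"
proof -
  define h where "h = 1 / real (Suc t)"
  have "R (Suc t) \<omega> \<le> (\<Sum>(i, j)\<in>edges E. (eps t i j \<omega>)\<^sup>2
    + h * (- 2 * \<gamma> * (eps t i j \<omega> * g j t \<omega>) - 2 * \<beta> * fM * (eps t i j \<omega>)\<^sup>2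
      + 2 * \<beta> * ((zh i j t \<omega> - z j (Suc t) \<omega>) * xi i j (Suc t) \<omega>)) + Ceps / (real (Suc t))\<^sup>2)"
    unfolding R_def[of "Suc t"] h_def using eps_step[OF _ t \<omega>] by (intro sum_mono) (auto simp: edges_def)
  also have "\<dots> = R t \<omega> + h * (\<gamma> * (- 2 * (\<Sum>(i, j)\<in>edges E. eps t i j \<omega> * g j t \<omega>)) - 2 * \<beta> * fM * R t \<omega>
      + 2 * \<beta> * Mart t \<omega>) + real (card (edges E)) * Ceps / (real (Suc t))\<^sup>2"
    unfolding R_def Mart_def
    by (simp add: case_prod_beta sum.distrib sum_subtractf sum_distrib_left sum_negf algebra_simps)
  also have "\<dots> \<le> R t \<omega> + h * (\<gamma> * (alpha_const N E * R t \<omega> + lG / l2 * V t \<omega>) - 2 * \<beta> * fM * R t \<omega>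
      + 2 * \<beta> * Mart t \<omega>) + real (card (edges E)) * Ceps / (real (Suc t))\<^sup>2"
    using eps_drift gamma_pos
    by (intro add_mono diff_mono mult_left_mono order_refl) (auto simp: h_def)
  finally show ?thesis unfolding h_def by (simp add: algebra_simps)
qed

section \<open>Expected drift of the Lyapunov function\<close>

lemma bounded_rv_delta:
  assumes "t \<ge> Suc t0" "i < N"
  shows "bounded_rv Pr (delta t i)"
  unfolding delta_def[abs_def] avg_def using assms
  by (intro bounded_rv_diff bounded_rv_divide bounded_rv_sum bounded_rv_z) auto

lemma bounded_rv_V:
  assumes "t \<ge> Suc t0"
  shows "bounded_rv Pr (V t)"
  unfolding V_def[abs_def] dot_def using assms
  by (intro bounded_rv_sum bounded_rv_mult bounded_rv_delta) auto

lemma bounded_rv_R: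
  assumes "t \<ge> Suc t0"
  shows "bounded_rv Pr (R t)"
  unfolding R_def[abs_def] case_prod_beta eps_def using assms edge_less[OF graph]
  by (intro bounded_rv_sum bounded_rv_power2 bounded_rv_diff bounded_rv_zh bounded_rv_z)
    (auto simp: edges_def)

lemma bounded_rv_Mart_summand:
  assumes "t \<ge> Suc t0" "E i j"
  shows "bounded_rv Pr (\<lambda>\<omega>. (zh i j t \<omega> - z j (Suc t) \<omega>) * xi i j (Suc t) \<omega>)"
  using assms edge_less[OF graph assms(2)]
  by (intro bounded_rv_mult bounded_rv_diff bounded_rv_zh bounded_rv_z bounded_rv_xi) auto

lemma bounded_rv_Mart:
  assumes "t \<ge> Suc t0"
  shows "bounded_rv Pr (Mart t)"
  unfolding Mart_def[abs_def] case_prod_beta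
  by (intro bounded_rv_sum bounded_rv_Mart_summand assms) (auto simp: edges_def)

lemma expectation_Mart:
  assumes "t \<ge> Suc t0"
  shows "expectation (Mart t) = 0"
proof -
  have "expectation (Mart t) = (\<Sum>e\<in>edges E.
      expectation (\<lambda>\<omega>. (zh (fst e) (snd e) t \<omega> - z (snd e) (Suc t) \<omega>) * xi (fst e) (snd e) (Suc t) \<omega>))"
    unfolding Mart_def[abs_def] case_prod_beta
    by (intro Bochner_Integration.integral_sum bounded_rv_integrable bounded_rv_Mart_summand assms)
      (auto simp: edges_def)
  also have "\<dots> = 0" using expectation_xi assms by (intro sum.neutral) (auto simp: edges_def)
  finally show ?thesis .
qed

text \<open>Expectation removes \<open>Mart\<close>, and the combined drift has the coefficients p -
  \<kappa> q at V and \<kappa> m - q at R; since V and R are nonnegative, each may be compared with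
  \<eta> times its weight separately.\<close>

lemma lyapunov_step:
  assumes "\<kappa> > 0" "\<gamma> * l2 - \<kappa> * (\<gamma> * lG / l2) \<ge> \<eta>"
    "\<kappa> * (2 * \<beta> * fM - \<gamma> * alpha_const N E) - \<gamma> * lG / l2 \<ge> \<eta> * \<kappa>"
  defines "u \<equiv> \<lambda>t. expectation (V t) + \<kappa> * expectation (R t)"
  shows "\<exists>C. \<forall>t\<ge>Suc t0. u (Suc t) \<le> (1 - \<eta> / real (Suc t)) * u t + C / (real (Suc t))\<^sup>2"
proof -
  define C1 where "C1 = \<gamma>\<^sup>2 * real N * (2 * G)\<^sup>2"
  define C2 where "C2 = real (card (edges E)) * Ceps"
  define p where "p = \<gamma> * l2"
  define q where "q = \<gamma> * lG / l2"
  define m where "m = 2 * \<beta> * fM - \<gamma> * alpha_const N E"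
  have "u (Suc t) \<le> (1 - \<eta> / real (Suc t)) * u t + (C1 + \<kappa> * C2) / (real (Suc t))\<^sup>2" if t: "t \<ge> Suc t0" for t
  proof -
    define h where "h = 1 / real (Suc t)"
    have h: "h > 0" by (simp add: h_def)
    note int = bounded_rv_integrable[OF bounded_rv_V[OF t]] bounded_rv_integrable[OF bounded_rv_R[OF t]]
      bounded_rv_integrable[OF bounded_rv_Mart[OF t]]
    have "expectation (V (Suc t)) \<le> expectation (\<lambda>\<omega>. V t \<omega> + h * (- p * V t \<omega> + q * R t \<omega>) + C1 * h\<^sup>2)"
    proof (rule integral_mono)
      show "integrable Pr (V (Suc t))" using t by (intro bounded_rv_integrable bounded_rv_V) auto
      show "integrable Pr (\<lambda>\<omega>. V t \<omega> + h * (- p * V t \<omega> + q * R t \<omega>) + C1 * h\<^sup>2)"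
        by (intro bounded_rv_integrable bounded_rv_add bounded_rv_mult bounded_rv_const bounded_rv_V bounded_rv_R t)
    qed (use V_step[OF t] in \<open>simp add: h_def C1_def p_def q_def power_divide\<close>)
    also have "\<dots> = expectation (V t) + h * (- p * expectation (V t) + q * expectation (R t)) + C1 * h\<^sup>2"
      using int by (simp add: prob_space)
    finally have 1: "expectation (V (Suc t)) \<le> \<dots>" .
    have "expectation (R (Suc t)) \<le> expectation (\<lambda>\<omega>. R t \<omega> + h * (q * V t \<omega> - m * R t \<omega> + 2 * \<beta> * Mart t \<omega>) + C2 * h\<^sup>2)"
    proof (rule integral_mono)
      show "integrable Pr (R (Suc t))" using t by (intro bounded_rv_integrable bounded_rv_R) auto
      show "integrable Pr (\<lambda>\<omega>. R t \<omega> + h * (q * V t \<omega> - m * R t \<omega> + 2 * \<beta> * Mart t \<omega>) + C2 * h\<^sup>2)"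
        by (intro bounded_rv_integrable bounded_rv_add bounded_rv_diff bounded_rv_mult bounded_rv_const
            bounded_rv_V bounded_rv_R bounded_rv_Mart t)
    qed (use R_step[OF t] in \<open>simp add: h_def C2_def m_def q_def power_divide\<close>)
    also have "\<dots> = expectation (R t) + h * (q * expectation (V t) - m * expectation (R t)) + C2 * h\<^sup>2"
      using int expectation_Mart[OF t] by (simp add: prob_space)
    finally have "\<kappa> * expectation (R (Suc t)) \<le> \<kappa> * \<dots>" using assms(1) by (intro mult_left_mono) auto
    with 1 have "u (Suc t) \<le> u t - h * ((p - \<kappa> * q) * expectation (V t) + (\<kappa> * m - q) * expectation (R t))
        + (C1 + \<kappa> * C2) * h\<^sup>2"
      unfolding u_def by (simp add: algebra_simps)
    also have "\<dots> \<le> u t - h * (\<eta> * expectation (V t) + (\<eta> * \<kappa>) * expectation (R t)) + (C1 + \<kappa> * C2) * h\<^sup>2"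
      using assms(2,3) h V_nonneg R_nonneg
      by (intro add_right_mono diff_left_mono mult_left_mono add_mono mult_right_mono)
        (auto simp: p_def q_def m_def)
    also have "\<dots> = (1 - \<eta> * h) * u t + (C1 + \<kappa> * C2) * h\<^sup>2"
      unfolding u_def by (simp add: algebra_simps)
    finally show ?thesis by (simp add: h_def power_divide)
  qed
  then show ?thesis by blast
qed

subsection \<open>From the compressed states to the states\<close>

definition y :: "nat \<Rightarrow> nat \<Rightarrow> nat \<Rightarrow> 'w \<Rightarrow> real" where
  "y i k t \<omega> = x i t \<omega> $ k - (\<Sum>l<N. x l t \<omega> $ k) / real N"

lemma enorm_deviation:
  assumes "i < N" "t \<ge> Suc t0" "\<omega> \<in> space Pr"
  shows "(enorm (x i t \<omega> - xbar n N (\<lambda>k. x k t \<omega>)))\<^sup>2 = (\<Sum>k<n. (y i k t \<omega>)\<^sup>2)"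
  using x_carrier[of t i \<omega>] assms unfolding enorm_square
  by (auto simp: xbar_def y_def intro!: sum.cong)

lemma y_shift:
  assumes "i < N" "t \<ge> Suc t0" "\<omega> \<in> space Pr" "Suc k < n"
  shows "y i k (Suc t) \<omega> = y i (Suc k) t \<omega>"
proof -
  have "x l (Suc t) \<omega> $ k = x l t \<omega> $ Suc k" if "l < N" for l
  proof -
    have "k \<noteq> n - 1" using assms(4) by simp
    then show ?thesis using x_step_component[of l t \<omega> k] that assms by (simp only: if_False Suc_lessD)
  qed
  then have "(\<Sum>l<N. x l (Suc t) \<omega> $ k) = (\<Sum>l<N. x l t \<omega> $ Suc k)" "x i (Suc t) \<omega> $ k = x i t \<omega> $ Suc k"
    using assms(1) by (auto intro!: sum.cong)
  then show ?thesis unfolding y_def by simp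
qed

text \<open>In companion form component k is component 0 read k steps later, so one scalar sequence
  carries the whole deviation.\<close>

lemma y_eq_shift:
  assumes "i < N" "t \<ge> Suc t0" "\<omega> \<in> space Pr" "k < n"
  shows "y i k t \<omega> = y i 0 (t + k) \<omega>"
  using assms(4,2)
proof (induction k arbitrary: t)
  case (Suc k)
  then show ?case using y_shift[of i t \<omega> k] assms by simp
qed simp

text \<open>Compression is linear and commutes with averaging. Read through
  \<open>y_eq_shift\<close>, this is a linear recursion for the first component with polynomial
  \<open>comp_poly n b\<close> and input \<open>delta\<close>.\<close>

lemma y_compressed:
  assumes "i < N" "t \<ge> Suc t0" "\<omega> \<in> space Pr"
  shows "(\<Sum>k<n - 1. b (Suc k) * y i k t \<omega>) + y i (n - 1) t \<omega> = delta t i \<omega>"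
proof -
  have z: "z l t \<omega> = (\<Sum>k<n - 1. b (Suc k) * x l t \<omega> $ k) + x l t \<omega> $ (n - 1)" if "l < N" for l
    unfolding z_def using K2_scalar_prod x_carrier that assms by simp
  have "avg t \<omega> = ((\<Sum>l<N. \<Sum>k<n - 1. b (Suc k) * x l t \<omega> $ k) + (\<Sum>l<N. x l t \<omega> $ (n - 1))) / real N"
  proof -
    have "(\<Sum>l<N. z l t \<omega>) = (\<Sum>l<N. (\<Sum>k<n - 1. b (Suc k) * x l t \<omega> $ k) + x l t \<omega> $ (n - 1))"
      using z by (intro sum.cong) auto
    then show ?thesis unfolding avg_def sum.distrib by simp
  qed
  also have "(\<Sum>l<N. \<Sum>k<n - 1. b (Suc k) * x l t \<omega> $ k) = (\<Sum>k<n - 1. b (Suc k) * (\<Sum>l<N. x l t \<omega> $ k))"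
    by (subst sum.swap) (simp add: sum_distrib_left)
  finally have "avg t \<omega> = (\<Sum>k<n - 1. b (Suc k) * ((\<Sum>l<N. x l t \<omega> $ k) / real N)) + (\<Sum>l<N. x l t \<omega> $ (n - 1)) / real N"
    by (simp add: add_divide_distrib sum_divide_distrib[of _ "{..<n - Suc 0}"])
  then show ?thesis unfolding delta_def z[OF assms(1)] y_def
    by (simp add: sum_subtractf right_diff_distrib)
qed

lemma coeff_comp_poly: "coeff (comp_poly n b) k =
    (if k = n - 1 then 1 else if k < n - 1 then complex_of_real (b (Suc k)) else 0)"
proof -
  have "coeff (\<Sum>l = 1..n - 1. monom (complex_of_real (b l)) (l - 1)) k
      = (\<Sum>l = 1..n - 1. if l = Suc k then complex_of_real (b l) else 0)"
    unfolding coeff_sum by (intro sum.cong) auto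
  also have "\<dots> = (if k < n - 1 then complex_of_real (b (Suc k)) else 0)" by auto
  finally show ?thesis unfolding comp_poly_def by auto
qed

lemma degree_comp_poly: "degree (comp_poly n b) = n - 1"
  by (rule antisym) (auto simp: coeff_comp_poly intro!: degree_le le_degree)

lemma comp_poly_factorization:
  "\<exists>A. comp_poly n b = (\<Prod>r\<in>#A. [:- r, 1:]) \<and> (\<forall>r. r \<in># A \<longrightarrow> norm r < 1)"
proof -
  have lc: "lead_coeff (comp_poly n b) = 1" by (simp add: degree_comp_poly coeff_comp_poly)
  then have "comp_poly n b \<noteq> 0" by auto
  from alg_closed_imp_factorization[OF this] lc
  obtain A where A: "comp_poly n b = (\<Prod>r\<in>#A. [:- r, 1:])" by auto
  have "norm r < 1" if "r \<in># A" for r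
  proof -
    have "poly (\<Prod>r\<in>#A. [:- r, 1:]) r = 0" using that by (auto simp: poly_prod_mset prod_mset_zero_iff)
    then show ?thesis using roots A by auto
  qed
  then show ?thesis using A by blast
qed

lemma bounded_rv_y:
  assumes "t \<ge> Suc t0" "i < N" "k < n"
  shows "bounded_rv Pr (y i k t)"
  unfolding y_def[abs_def] using assms
  by (intro bounded_rv_diff bounded_rv_divide bounded_rv_sum bounded_rv_x) auto

text \<open>The input \<open>delta\<close> of the stable recursion has square at most V, so the
  first component of the deviation inherits the decay; the remaining components are its
  shifts.\<close>

lemma state_decay:
  assumes D: "decay_class D" and V: "D (\<lambda>t. expectation (V t))" and i: "i < N"
  shows "D (\<lambda>t. expectation (\<lambda>\<omega>. (enorm (x i t \<omega> - xbar n N (\<lambda>k. x k t \<omega>)))\<^sup>2))"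
proof -
  define w where "w t \<omega> = complex_of_real (y i 0 t \<omega>)" for t \<omega>
  have n0: "0 < n" using n2 by simp
  have bw: "bounded_rv Pr (y i 0 t)" if "t \<ge> Suc t0" for t
    using that i n0 by (intro bounded_rv_y)
  obtain A where A: "comp_poly n b = (\<Prod>r\<in>#A. [:- r, 1:])" "\<And>r. r \<in># A \<Longrightarrow> norm r < 1"
    using comp_poly_factorization by blast
  have op: "shift_op (comp_poly n b) (\<lambda>s. w s \<omega>) t = complex_of_real (delta t i \<omega>)"
    if "t \<ge> Suc t0" "\<omega> \<in> space Pr" for t \<omega>
  proof -
    have "shift_op (comp_poly n b) (\<lambda>s. w s \<omega>) t
        = complex_of_real ((\<Sum>k<n - 1. b (Suc k) * y i 0 (t + k) \<omega>) + y i 0 (t + (n - 1)) \<omega>)"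
      unfolding shift_op_def degree_comp_poly coeff_comp_poly w_def
      by (simp add: lessThan_Suc_atMost[symmetric])
    also have "(\<Sum>k<n - 1. b (Suc k) * y i 0 (t + k) \<omega>) + y i 0 (t + (n - 1)) \<omega>
        = (\<Sum>k<n - 1. b (Suc k) * y i k t \<omega>) + y i (n - 1) t \<omega>"
      using y_eq_shift[OF i that] n0 by simp
    also have "\<dots> = delta t i \<omega>" by (rule y_compressed[OF i that])
    finally show ?thesis .
  qed
  have "D (\<lambda>t. expectation (\<lambda>\<omega>. (norm (shift_op (\<Prod>r\<in>#A. [:- r, 1:]) (\<lambda>s. w s \<omega>) t))\<^sup>2))"
  proof (rule decay_class.mono[OF D V, where T = "Suc t0"])
    fix t assume t: "t \<ge> Suc t0"
    have "expectation (\<lambda>\<omega>. (norm (shift_op (\<Prod>r\<in>#A. [:- r, 1:]) (\<lambda>s. w s \<omega>) t))\<^sup>2)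
        = expectation (\<lambda>\<omega>. (delta t i \<omega>)\<^sup>2)"
      unfolding A(1)[symmetric] using op[OF t] by (intro Bochner_Integration.integral_cong) auto
    also have "\<dots> \<le> expectation (V t)"
    proof (rule integral_mono)
      show "integrable Pr (\<lambda>\<omega>. (delta t i \<omega>)\<^sup>2)"
        by (intro bounded_rv_integrable bounded_rv_power2 bounded_rv_delta t i)
      show "integrable Pr (V t)" by (intro bounded_rv_integrable bounded_rv_V t)
      show "(delta t i \<omega>)\<^sup>2 \<le> V t \<omega>" for \<omega>
        unfolding V_def dot_def power2_eq_square using i
        by (intro member_le_sum[where f = "\<lambda>i. delta t i \<omega> * delta t i \<omega>"]) auto
    qed
    finally show "0 \<le> expectation (\<lambda>\<omega>. (norm (shift_op (\<Prod>r\<in>#A. [:- r, 1:]) (\<lambda>s. w s \<omega>) t))\<^sup>2) \<and>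
      expectation (\<lambda>\<omega>. (norm (shift_op (\<Prod>r\<in>#A. [:- r, 1:]) (\<lambda>s. w s \<omega>) t))\<^sup>2) \<le> expectation (V t)"
      by simp
  qed
  then have "D (\<lambda>t. expectation (\<lambda>\<omega>. (norm (w t \<omega>))\<^sup>2))"
  proof (rule stable_recursion_decay[OF D, where T = "Suc t0", rotated 3])
    fix t assume t: "t \<ge> Suc t0"
    show "w t \<in> borel_measurable Pr"
      unfolding w_def[abs_def] using bw[OF t] by (auto simp: bounded_rv_def)
    show "\<exists>B. \<forall>\<omega>\<in>space Pr. norm (w t \<omega>) \<le> B"
      using bw[OF t] by (auto simp: bounded_rv_def w_def)
  qed (use A(2) in auto)
  then have "D (\<lambda>t. expectation (\<lambda>\<omega>. (y i 0 t \<omega>)\<^sup>2))" by (simp add: w_def)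
  then have "D (\<lambda>t. expectation (\<lambda>\<omega>. (y i 0 (t + k) \<omega>)\<^sup>2))" for k
    using decay_class.shift[OF D] by fastforce
  then have "D (\<lambda>t. \<Sum>k<n. expectation (\<lambda>\<omega>. (y i 0 (t + k) \<omega>)\<^sup>2))"
    by (intro decay_class.sum[OF D])
  then show ?thesis
  proof (rule decay_class.mono[OF D, where T = "Suc t0"])
    fix t assume t: "t \<ge> Suc t0"
    have "expectation (\<lambda>\<omega>. (enorm (x i t \<omega> - xbar n N (\<lambda>k. x k t \<omega>)))\<^sup>2)
        = expectation (\<lambda>\<omega>. \<Sum>k<n. (y i 0 (t + k) \<omega>)\<^sup>2)"
      using enorm_deviation[OF i t] y_eq_shift[OF i t]
      by (intro Bochner_Integration.integral_cong) auto
    also have "\<dots> = (\<Sum>k<n. expectation (\<lambda>\<omega>. (y i 0 (t + k) \<omega>)\<^sup>2))"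
      using t by (intro Bochner_Integration.integral_sum bounded_rv_integrable bounded_rv_power2 bw) auto
    finally show "0 \<le> expectation (\<lambda>\<omega>. (enorm (x i t \<omega> - xbar n N (\<lambda>k. x k t \<omega>)))\<^sup>2) \<and>
      expectation (\<lambda>\<omega>. (enorm (x i t \<omega> - xbar n N (\<lambda>k. x k t \<omega>)))\<^sup>2)
        \<le> (\<Sum>k<n. expectation (\<lambda>\<omega>. (y i 0 (t + k) \<omega>)\<^sup>2))"
      by (simp add: sum_nonneg)
  qed
qed

section \<open>The two claims\<close>

text \<open>The threshold \<theta> is 0 for convergence and 1 for the rate 1/t.\<close>

lemma lyapunov_recursion:
  assumes "\<gamma> * l2 > \<theta>"
    "(\<gamma> * l2 - \<theta>) * (2 * \<beta> * fM - \<gamma> * alpha_const N E - \<theta>) > (\<gamma> * lG / l2)\<^sup>2"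
  shows "\<exists>u \<eta> C. \<eta> > \<theta> \<and> (\<forall>t. 0 \<le> u t \<and> expectation (V t) \<le> u t) \<and>
    (\<forall>t\<ge>Suc t0. u (Suc t) \<le> (1 - \<eta> / real (Suc t)) * u t + C / (real (Suc t))\<^sup>2)"
proof -
  have "\<gamma> * lG / l2 > 0" using gamma_pos lG_pos l2_pos by simp
  from lyapunov_weight_exists[OF this assms]
  obtain \<kappa> \<eta> where k: "\<kappa> > 0" "\<eta> > \<theta>" "\<gamma> * l2 - \<kappa> * (\<gamma> * lG / l2) \<ge> \<eta>"
    "\<kappa> * (2 * \<beta> * fM - \<gamma> * alpha_const N E) - \<gamma> * lG / l2 \<ge> \<eta> * \<kappa>" by blast
  define u where "u t = expectation (V t) + \<kappa> * expectation (R t)" for t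
  have nn: "0 \<le> expectation (V t)" "0 \<le> \<kappa> * expectation (R t)" for t
    using V_nonneg R_nonneg k(1) by auto
  have "\<exists>C. \<forall>t\<ge>Suc t0. u (Suc t) \<le> (1 - \<eta> / real (Suc t)) * u t + C / (real (Suc t))\<^sup>2"
    unfolding u_def by (rule lyapunov_step[OF k(1,3,4)])
  then obtain C where "\<forall>t\<ge>Suc t0. u (Suc t) \<le> (1 - \<eta> / real (Suc t)) * u t + C / (real (Suc t))\<^sup>2" by blast
  moreover have "\<forall>t. 0 \<le> u t \<and> expectation (V t) \<le> u t" using nn by (simp add: u_def)
  ultimately show ?thesis using k(2) by blast
qed

lemma consensus_mean_square:
  assumes "\<beta> > 1 / (2 * fM) * (\<gamma> * lG\<^sup>2 / l2 ^ 3 + \<gamma> * alpha_const N E)" "i < N"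
  shows "(\<lambda>t. expectation (\<lambda>\<omega>. (enorm (x i t \<omega> - xbar n N (\<lambda>k. x k t \<omega>)))\<^sup>2)) \<longlonglongrightarrow> 0"
proof -
  have "2 * \<beta> * fM - \<gamma> * alpha_const N E > \<gamma> * lG\<^sup>2 / l2 ^ 3"
    using assms(1) fM_pos by (simp add: field_simps)
  \<comment> \<open>Multiplication by \<gamma> \<open>l2\<close> turns the bound on \<beta> into the
    determinant condition of \<open>lyapunov_recursion\<close> at \<theta> = 0.\<close>
  then have "(\<gamma> * l2) * (2 * \<beta> * fM - \<gamma> * alpha_const N E) > (\<gamma> * l2) * (\<gamma> * lG\<^sup>2 / l2 ^ 3)"
    using gamma_pos l2_pos by (intro mult_strict_left_mono) auto
  moreover have "(\<gamma> * l2) * (\<gamma> * lG\<^sup>2 / l2 ^ 3) = (\<gamma> * lG / l2)\<^sup>2"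
    using l2_pos by (simp add: field_simps power2_eq_square power3_eq_cube)
  ultimately obtain u \<eta> C where u: "\<eta> > 0" "\<And>t. 0 \<le> u t" "\<And>t. expectation (V t) \<le> u t"
    "\<And>t. t \<ge> Suc t0 \<Longrightarrow> u (Suc t) \<le> (1 - \<eta> / real (Suc t)) * u t + C / (real (Suc t))\<^sup>2"
    using lyapunov_recursion[of 0] gamma_pos l2_pos by auto
  have "u \<longlonglongrightarrow> 0" using u by (intro recursion_tendsto_0[where T = "Suc t0" and C = C and \<eta> = \<eta>]) auto
  then have "(\<lambda>t. expectation (V t)) \<longlonglongrightarrow> 0"
    using decay_class.mono[OF decay_class_tendsto_0, of u 0 "\<lambda>t. expectation (V t)"] u(3) V_nonneg by auto
  then show ?thesis by (rule state_decay[OF decay_class_tendsto_0 _ assms(2)])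
qed

lemma consensus_rate:
  assumes gam: "\<gamma> > 1 / l2"
    and "\<beta> > 1 / (2 * fM) * (\<gamma>\<^sup>2 * lG\<^sup>2 / (l2\<^sup>2 * (\<gamma> * l2 - 1)) + \<gamma> * alpha_const N E + 1)" "i < N"
  shows "\<exists>C. \<forall>t\<ge>t0 + 1. expectation (\<lambda>\<omega>. (enorm (x i t \<omega> - xbar n N (\<lambda>k. x k t \<omega>)))\<^sup>2) \<le> C / real t"
proof -
  have p: "\<gamma> * l2 > 1" using gam l2_pos by (simp add: field_simps)
  have "2 * \<beta> * fM - \<gamma> * alpha_const N E - 1 > \<gamma>\<^sup>2 * lG\<^sup>2 / (l2\<^sup>2 * (\<gamma> * l2 - 1))"
  proof -
    have "\<gamma>\<^sup>2 * lG\<^sup>2 / (l2\<^sup>2 * (\<gamma> * l2 - 1)) + \<gamma> * alpha_const N E + 1 < \<beta> * (2 * fM)"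
      using assms(2) fM_pos by (simp add: pos_divide_less_eq)
    then show ?thesis by (simp add: algebra_simps)
  qed
  \<comment> \<open>The same with \<gamma> \<open>l2\<close> - 1, positive by the bound on \<gamma>,
    for \<theta> = 1.\<close>
  then have "(\<gamma> * l2 - 1) * (2 * \<beta> * fM - \<gamma> * alpha_const N E - 1)
      > (\<gamma> * l2 - 1) * (\<gamma>\<^sup>2 * lG\<^sup>2 / (l2\<^sup>2 * (\<gamma> * l2 - 1)))"
    using p by (intro mult_strict_left_mono) auto
  moreover have "(\<gamma> * l2 - 1) * (\<gamma>\<^sup>2 * lG\<^sup>2 / (l2\<^sup>2 * (\<gamma> * l2 - 1))) = (\<gamma> * lG / l2)\<^sup>2"
    using p by (simp add: power_divide power_mult_distrib)
  ultimately obtain u \<eta> C where u: "\<eta> > 1" "\<And>t. 0 \<le> u t" "\<And>t. expectation (V t) \<le> u t"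
    "\<And>t. t \<ge> Suc t0 \<Longrightarrow> u (Suc t) \<le> (1 - \<eta> / real (Suc t)) * u t + C / (real (Suc t))\<^sup>2"
    using lyapunov_recursion[of 1] p by auto
  have "inverse_rate u"
    unfolding inverse_rate_def using u
    by (intro recursion_rate_inverse[where T = "Suc t0" and C = C and \<eta> = \<eta>]) auto
  then have "inverse_rate (\<lambda>t. expectation (V t))"
    using decay_class.mono[OF decay_class_inverse_rate, of u 0 "\<lambda>t. expectation (V t)"] u(3) V_nonneg by auto
  from state_decay[OF decay_class_inverse_rate this assms(3)]
  show ?thesis by (intro inverse_rate_from) auto
qed

end

theorem theorem2:
  fixes n N :: nat and a b :: "nat \<Rightarrow> real" and E :: "nat \<Rightarrow> nat \<Rightarrow> bool"
    and c :: "nat \<Rightarrow> nat \<Rightarrow> real" and \<sigma> \<beta> \<gamma> M :: real and t0 :: nat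
    and Pr :: "'w measure"
    and d :: "nat \<Rightarrow> nat \<Rightarrow> nat \<Rightarrow> 'w \<Rightarrow> real"
    and x :: "nat \<Rightarrow> nat \<Rightarrow> 'w \<Rightarrow> real vec"
    and zh :: "nat \<Rightarrow> nat \<Rightarrow> nat \<Rightarrow> 'w \<Rightarrow> real"
    and x0 :: "nat \<Rightarrow> real vec" and z0 :: "nat \<Rightarrow> nat \<Rightarrow> real"
  assumes n2: "n \<ge> 2" and N2: "N \<ge> 2"
    and graph: "graph_ok N E" and conn: "connected_graph N E"
    and roots: "\<forall>z::complex. poly (comp_poly n b) z = 0 \<longrightarrow> cmod z < 1"
    and sigma_pos: "\<sigma> > 0" and beta_pos: "\<beta> > 0" and gamma_pos: "\<gamma> > 0" and M_pos: "M > 0"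
    and t0_bound: "real t0 > \<gamma> * real (dmax N E) - 1"
    and prob: "prob_space Pr"
    and noise_indep: "prob_space.indep_vars Pr (\<lambda>_. borel) (\<lambda>(i, j, t). d i j t)
                        {(i, j, t). E i j}"
    and noise_distr: "\<And>i j t. E i j \<Longrightarrow>
                        distributed Pr lborel (d i j t) (\<lambda>y. ennreal (normal_density 0 \<sigma> y))"
    and x0_dim: "\<And>i. i < N \<Longrightarrow> x0 i \<in> carrier_vec n"
    and x0_bd: "\<And>i. i < N \<Longrightarrow> \<bar>K2vec n b \<bullet> x0 i\<bar> \<le> M"
    and z0_bd: "\<And>i j. E i j \<Longrightarrow> \<bar>z0 i j\<bar> \<le> M"
    and x_init: "\<And>i \<omega>. i < N \<Longrightarrow> \<omega> \<in> space Pr \<Longrightarrow> x i (t0 + 1) \<omega> = x0 i"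
    and zh_init: "\<And>i j \<omega>. E i j \<Longrightarrow> \<omega> \<in> space Pr \<Longrightarrow> zh i j t0 \<omega> = z0 i j"
    and zh_step: "\<And>i j t \<omega>. E i j \<Longrightarrow> t \<ge> t0 + 1 \<Longrightarrow> \<omega> \<in> space Pr \<Longrightarrow>
        zh i j t \<omega> = proj M (zh i j (t - 1) \<omega> + \<beta> / real t *
           (gauss_cdf \<sigma> (c i j - zh i j (t - 1) \<omega>)
            - (if K2vec n b \<bullet> x j t \<omega> + d i j t \<omega> \<le> c i j then 1 else 0)))"
    and x_step: "\<And>i t \<omega>. i < N \<Longrightarrow> t \<ge> t0 + 1 \<Longrightarrow> \<omega> \<in> space Pr \<Longrightarrow>
        x i (t + 1) \<omega> = Amat n a *\<^sub>v x i t \<omega> +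
          (K1vec n a b \<bullet> x i t \<omega> + \<gamma> / real (t + 1) *
             (\<Sum>j\<in>{j. j < N \<and> E i j}. zh i j t \<omega> - K2vec n b \<bullet> x i t \<omega>)) \<cdot>\<^sub>v Bvec n"
  shows
    "(\<beta> > 1 / (2 * f_M N E \<sigma> c M) *
          (\<gamma> * (lambda_G N E)\<^sup>2 / (lambda2 N E) ^ 3 + \<gamma> * alpha_const N E)
       \<longrightarrow> (\<forall>i<N. ((\<lambda>t. LINT \<omega>|Pr. (enorm (x i t \<omega> - xbar n N (\<lambda>k. x k t \<omega>)))\<^sup>2)
                      \<longlonglongrightarrow> 0)))
   \<and> (\<gamma> > 1 / lambda2 N E \<and>
       \<beta> > 1 / (2 * f_M N E \<sigma> c M) *
          (\<gamma>\<^sup>2 * (lambda_G N E)\<^sup>2 / ((lambda2 N E)\<^sup>2 * (\<gamma> * lambda2 N E - 1))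
           + \<gamma> * alpha_const N E + 1)
       \<longrightarrow> (\<forall>i<N. \<exists>C. \<forall>t\<ge>t0 + 1.
              (LINT \<omega>|Pr. (enorm (x i t \<omega> - xbar n N (\<lambda>k. x k t \<omega>)))\<^sup>2) \<le> C / real t))"
proof -
  interpret one_bit_consensus Pr n N a b E c \<sigma> \<beta> \<gamma> M t0 d x zh x0 z0
    by (intro one_bit_consensus.intro one_bit_consensus_axioms.intro) (fact assms)+
  show ?thesis using consensus_mean_square consensus_rate by blast
qed

end
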